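(* Let $X$ be a compact Hausdorff space and let $\{\mu_x\}_{x\in X}$ be a weakly continuous family of Borel probability measures on $[0,1)$ such that for every $x\in X$, $\mu_x$ is singular or Lebesgue measure. Let $\{g_n\}_{n=0}^\infty$ be the auxiliary sequence of $\{e^{2\pi i ny}\}_{n=0}^{\infty}\subseteq WC(X,L^2(\mu_x))$, and let $V_{\mu_{\{x\}}}:WC(X,L^2(\mu_x))\to C(X,H^2(\mathbb{D}))$ be the operator $V_{\mu_{\{x\}}}(f)=\sum_{n=0}^\infty\langle f,g_n\rangle w^n$. Let $\{b^x(w)\}_{x\in X}$ be the family of inner functions and zero functions corresponding to $\{\mu_x\}_{x\in X}$ via the Herglotz theorem. Then $$\operatorname{Im}V_{\mu_{\{x\}}}=[b^x(w)C(X,H^2(\mathbb{D}))]^{\perp}.$$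
   Context: Weakly continuous means that for every $g\in C_b([0,1))$ the function $x\mapsto\int_0^1 g\,d\mu_x$ is continuous on $X$. Singular means singular with respect to Lebesgue measure on $[0,1)$. $WC(X,L^2(\mu_x))$: let $V$ be the space of all finite $C(X)$-linear combinations $\sum_n c_n e^{2\pi i ny}$ ($n\ge0$, $c_n\in C(X)$), viewed as functions $f$ on $X$ with $f(x)=\sum_n c_n(x)e^{2\pi i ny}\in L^2(\mu_x)$, with $C(X)$-valued inner product $\langle\sum_nc_ne^{2\pi i ny},\sum_kd_ke^{2\pi i ky}\rangle(x)=\sum_n\sum_kc_n(x)\overline{d_k(x)}\int_0^1e^{2\pi i(n-k)y}\,d\mu_x(y)$; then $WC(X,L^2(\mu_x))$ is the completion of $V$ in the norm $\|f\|=\sqrt{\|\langle f,f\rangle\|_{C(X)}}$, a Hilbert $C(X)$-module. The auxiliary sequence of a sequence $\{e_n\}_{n=0}^\infty$ with $\langle e_n,e_n\rangle=1$ is $g_0=e_0$, $g_n=e_n-\sum_{k=0}^{n-1}\langle e_n,e_k\rangle g_k$ for $n\ge1$. $H^2(\mathbb{D})$ is the Hardy space of functions $\sum_{n\ge0}a_nw^n$ on the unit disk $\mathbb{D}$ with $\sum|a_n|^2<\infty$ (norm $(\sum|a_n|^2)^{1/2}$); $C(X,H^2(\mathbb{D}))$ is the Hilbert $C(X)$-module of norm-continuous functions $X\to H^2(\mathbb{D})$ with pointwise inner product; $\sum_n\langle f,g_n\rangle w^n$ denotes the function $x\mapsto\sum_n\langle f,g_n\rangle(x)w^n$. An inner function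 is a bounded analytic $b$ on $\mathbb{D}$ with $\|bf\|_{H^2(\mathbb{D})}=\|f\|_{H^2(\mathbb{D})}$ for all $f\in H^2(\mathbb{D})$. Herglotz theorem: Borel probability measures $\mu$ on $[0,1)$ correspond one-to-one to analytic functions $b$ on $\mathbb{D}$ bounded by one with $b(0)=0$ via $\frac{1+b(w)}{1-b(w)}=\int_0^1\frac{1+we^{-2\pi i y}}{1-we^{-2\pi i y}}\,d\mu(y)$; singular measures correspond to inner functions vanishing at $0$, and Lebesgue measure to $b=0$. $[b^x(w)C(X,H^2(\mathbb{D}))]^\perp$ is the set of $h\in C(X,H^2(\mathbb{D}))$ such that $\langle h(x),b^x f(x)\rangle_{H^2(\mathbb{D})}=0$ for all $x\in X$ and all $f\in C(X,H^2(\mathbb{D}))$. *)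

theory Defs
  imports "HOL-Complex_Analysis.Complex_Analysis" "HOL-Probability.Probability"
begin

section \<open>Measures on \<open>[0,1)\<close>\<close>

definition borel01 :: "real measure" where
  "borel01 = restrict_space borel {0..<1}"

definition lebesgue01 :: "real measure" where
  "lebesgue01 = restrict_space lborel {0..<1}"

definition singular_measure :: "real measure \<Rightarrow> bool" where
  "singular_measure M \<longleftrightarrow> (\<exists>A. A \<in> null_sets M \<and> {0..<1} - A \<in> null_sets lebesgue01)"

definition weakly_continuous :: "('x::topological_space \<Rightarrow> real measure) \<Rightarrow> bool" where
  "weakly_continuous \<mu> \<longleftrightarrow>
     (\<forall>g::real \<Rightarrow> complex. continuous_on {0..<1} g \<and> bounded (g ` {0..<1}) \<longrightarrow>
        continuous_on UNIV (\<lambda>x. LINT y|\<mu> x. g y))"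


section \<open>The Hilbert module \<open>WC(X, L\<^sup>2(\<mu>\<^sub>x))\<close>\<close>

text \<open>
  Throughout, the space \<open>X\<close> is the universe of the type \<open>'x\<close>. An element \<open>f\<close> of the
  pre-Hilbert module \<open>V\<close> is a function of \<open>x\<close> and \<open>y\<close>, read as \<open>x \<mapsto> f x \<in> L\<^sup>2(\<mu>\<^sub>x)\<close>.
  Functions that agree almost everywhere for every \<open>\<mu>\<^sub>x\<close> are at distance \<open>0\<close> and
  so are identified in the completion.
\<close>

definition expo :: "nat \<Rightarrow> 'x \<Rightarrow> real \<Rightarrow> complex" where
  "expo n = (\<lambda>x y. exp (2 * of_real pi * \<i> * of_nat n * of_real y))"

definition trig_module :: "('x::topological_space \<Rightarrow> real \<Rightarrow> complex) set" where
  "trig_module = {f. \<exists>N c. (\<forall>n. continuous_on UNIV (c n :: 'x \<Rightarrow> complex)) \<and>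
                           f = (\<lambda>x y. \<Sum>n<N. c n x * expo n x y)}"

definition V_inner ::
  "('x \<Rightarrow> real measure) \<Rightarrow> ('x \<Rightarrow> real \<Rightarrow> complex) \<Rightarrow> ('x \<Rightarrow> real \<Rightarrow> complex) \<Rightarrow> 'x \<Rightarrow> complex"
  where "V_inner \<mu> f g x = (LINT y|\<mu> x. f x y * cnj (g x y))"

lemma V_inner_trig:
  fixes \<mu> :: "'x \<Rightarrow> real measure" and c d :: "nat \<Rightarrow> 'x \<Rightarrow> complex"
  assumes "prob_space (\<mu> x)" "sets (\<mu> x) = sets borel01"
  shows "V_inner \<mu> (\<lambda>x y. \<Sum>n<N. c n x * expo n x y) (\<lambda>x y. \<Sum>k<K. d k x * expo k x y) x
       = (\<Sum>n<N. \<Sum>k<K. c n x * cnj (d k x) *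
            (LINT y|\<mu> x. exp (2 * of_real pi * \<i> * of_int (int n - int k) * of_real y)))"
proof -
  interpret prob_space "\<mu> x" by fact
  have meas: "borel_measurable (\<mu> x) = (borel_measurable borel01 :: (real \<Rightarrow> complex) set)"
    using assms(2) by (intro measurable_cong_sets) auto
  let ?e = "\<lambda>j y. exp (2 * of_real pi * \<i> * of_int j * of_real y) :: complex"
  have int: "integrable (\<mu> x) (?e j)" for j :: int
  proof (rule integrable_const_bound[where B = 1])
    show "AE y in \<mu> x. norm (?e j y) \<le> 1"
      by (simp add: norm_exp_eq_Re)
    have "continuous_on UNIV (?e j)"
      by (intro continuous_intros)
    then show "?e j \<in> borel_measurable (\<mu> x)"
      unfolding meas borel01_def
      by (intro measurable_restrict_space1 borel_measurable_continuous_onI)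
  qed
  have prod: "expo n x y * cnj (expo k x y) = ?e (int n - int k) y" for n k y
    by (simp add: expo_def exp_cnj flip: exp_add) (simp add: algebra_simps)
  have eq: "(\<Sum>n<N. c n x * expo n x y) * cnj (\<Sum>k<K. d k x * expo k x y)
      = (\<Sum>n<N. \<Sum>k<K. c n x * cnj (d k x) * ?e (int n - int k) y)" for y
    unfolding cnj_sum sum_product prod[symmetric] complex_cnj_mult
    by (intro sum.cong refl) (simp only: mult_ac)
  show ?thesis
    unfolding V_inner_def eq by (simp add: int del: of_int_diff)
qed

definition V_norm :: "('x \<Rightarrow> real measure) \<Rightarrow> ('x \<Rightarrow> real \<Rightarrow> complex) \<Rightarrow> real" where
  "V_norm \<mu> f = sqrt (SUP x. cmod (V_inner \<mu> f f x))"

abbreviation V_dist ::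
  "('x \<Rightarrow> real measure) \<Rightarrow> ('x \<Rightarrow> real \<Rightarrow> complex) \<Rightarrow> ('x \<Rightarrow> real \<Rightarrow> complex) \<Rightarrow> real"
  where "V_dist \<mu> f g \<equiv> V_norm \<mu> (\<lambda>x y. f x y - g x y)"

text \<open>The completion consists of Cauchy sequences in \<open>V\<close> modulo null sequences.\<close>

definition WC_cauchy ::
  "('x::topological_space \<Rightarrow> real measure) \<Rightarrow> (nat \<Rightarrow> 'x \<Rightarrow> real \<Rightarrow> complex) set" where
  "WC_cauchy \<mu> = {u. (\<forall>n. u n \<in> trig_module) \<and>
                      (\<forall>\<epsilon>>0. \<exists>N. \<forall>m\<ge>N. \<forall>n\<ge>N. V_dist \<mu> (u m) (u n) < \<epsilon>)}"

definition WC_rel ::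
  "('x::topological_space \<Rightarrow> real measure) \<Rightarrow> (nat \<Rightarrow> 'x \<Rightarrow> real \<Rightarrow> complex) rel" where
  "WC_rel \<mu> = {(u, v). u \<in> WC_cauchy \<mu> \<and> v \<in> WC_cauchy \<mu> \<and>
                       (\<lambda>n. V_dist \<mu> (u n) (v n)) \<longlonglongrightarrow> 0}"

definition WC ::
  "('x::topological_space \<Rightarrow> real measure) \<Rightarrow> (nat \<Rightarrow> 'x \<Rightarrow> real \<Rightarrow> complex) set set" where
  "WC \<mu> = WC_cauchy \<mu> // WC_rel \<mu>"

definition WC_embed ::
  "('x::topological_space \<Rightarrow> real measure) \<Rightarrow> ('x \<Rightarrow> real \<Rightarrow> complex) \<Rightarrow>
     (nat \<Rightarrow> 'x \<Rightarrow> real \<Rightarrow> complex) set" where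
  "WC_embed \<mu> f = WC_rel \<mu> `` {\<lambda>_. f}"

text \<open>The inner product of \<open>V\<close>, extended by continuity to classes \<open>F\<close> and \<open>G\<close>.\<close>

definition WC_inner ::
  "('x::topological_space \<Rightarrow> real measure) \<Rightarrow> (nat \<Rightarrow> 'x \<Rightarrow> real \<Rightarrow> complex) set \<Rightarrow>
     (nat \<Rightarrow> 'x \<Rightarrow> real \<Rightarrow> complex) set \<Rightarrow> 'x \<Rightarrow> complex" where
  "WC_inner \<mu> F G x = (THE z. \<forall>u\<in>F. \<forall>v\<in>G. (\<lambda>n. V_inner \<mu> (u n) (v n) x) \<longlonglongrightarrow> z)"


section \<open>The auxiliary sequence\<close>

text \<open>
  If all terms of \<open>e\<close> lie in \<open>V\<close>, then so do all terms of the auxiliary sequence, so the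
  recursion is carried out in \<open>V\<close>. The empty sum gives \<open>g\<^sub>0 = e\<^sub>0\<close>.
\<close>

fun auxiliary_seq ::
  "('x \<Rightarrow> real measure) \<Rightarrow> (nat \<Rightarrow> 'x \<Rightarrow> real \<Rightarrow> complex) \<Rightarrow> nat \<Rightarrow> 'x \<Rightarrow> real \<Rightarrow> complex"
  where
  "auxiliary_seq \<mu> e n =
     (\<lambda>x y. e n x y - (\<Sum>k<n. V_inner \<mu> (e n) (e k) x * auxiliary_seq \<mu> e k x y))"

declare auxiliary_seq.simps [simp del]


section \<open>The Hardy space\<close>

text \<open>
  Functions on the unit disk are extensional, so that equality of functions is
  equality on the disk. The coefficients, norm and inner product depend only on
  the values near \<open>0\<close> and may be applied to non-extensional functions.
\<close>

definition hardy2 :: "(complex \<Rightarrow> complex) set" where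
  "hardy2 = {F. \<exists>a. summable (\<lambda>n. (cmod (a n))\<^sup>2) \<and> F = (\<lambda>w\<in>ball 0 1. \<Sum>n. a n * w ^ n)}"

definition taylor_coeff :: "(complex \<Rightarrow> complex) \<Rightarrow> nat \<Rightarrow> complex" where
  "taylor_coeff F n = fps_nth (fps_expansion F 0) n"

definition hardy2_inner :: "(complex \<Rightarrow> complex) \<Rightarrow> (complex \<Rightarrow> complex) \<Rightarrow> complex" where
  "hardy2_inner F G = (\<Sum>n. taylor_coeff F n * cnj (taylor_coeff G n))"

definition hardy2_norm :: "(complex \<Rightarrow> complex) \<Rightarrow> real" where
  "hardy2_norm F = sqrt (\<Sum>n. (cmod (taylor_coeff F n))\<^sup>2)"

definition C_hardy2 :: "('x::topological_space \<Rightarrow> complex \<Rightarrow> complex) set" where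
  "C_hardy2 = {F. (\<forall>x. F x \<in> hardy2) \<and>
                  (\<forall>x\<^sub>0. ((\<lambda>x. hardy2_norm (\<lambda>w. F x w - F x\<^sub>0 w)) \<longlongrightarrow> 0) (nhds x\<^sub>0))}"

definition perp_mult ::
  "('x::topological_space \<Rightarrow> complex \<Rightarrow> complex) \<Rightarrow> ('x \<Rightarrow> complex \<Rightarrow> complex) set" where
  "perp_mult b = {h \<in> C_hardy2. \<forall>x. \<forall>f\<in>C_hardy2.
                    hardy2_inner (h x) (\<lambda>w\<in>ball 0 1. b x w * f x w) = 0}"


section \<open>The Herglotz correspondence and the operator \<open>V\<close>\<close>

text \<open>
  \<open>|b| \<le> 1\<close> and \<open>b(0) = 0\<close> force \<open>|b| < 1\<close> on the disk, so the denominator does not vanish.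
\<close>

definition herglotz :: "real measure \<Rightarrow> (complex \<Rightarrow> complex) \<Rightarrow> bool" where
  "herglotz M b \<longleftrightarrow>
     b holomorphic_on ball 0 1 \<and> (\<forall>w\<in>ball 0 1. cmod (b w) \<le> 1) \<and> b 0 = 0 \<and>
     (\<forall>w\<in>ball 0 1. (1 + b w) / (1 - b w) =
        (LINT y|M. (1 + w * exp (- 2 * of_real pi * \<i> * of_real y)) /
                   (1 - w * exp (- 2 * of_real pi * \<i> * of_real y))))"

definition V_op ::
  "('x::topological_space \<Rightarrow> real measure) \<Rightarrow> (nat \<Rightarrow> 'x \<Rightarrow> real \<Rightarrow> complex) set \<Rightarrow>
     'x \<Rightarrow> complex \<Rightarrow> complex" where
  "V_op \<mu> F = (\<lambda>x. \<lambda>w\<in>ball 0 1.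
      \<Sum>n. WC_inner \<mu> F (WC_embed \<mu> (auxiliary_seq \<mu> expo n)) x * w ^ n)"

end

theory Submission
  imports Defs
begin

text \<open>
  Fix a point \<open>x\<close> and write \<open>T\<close> for multiplication by \<open>b\<^sup>x\<close> on the Hardy space, as an
  infinite lower triangular matrix. The Herglotz formula says that the moments of \<open>\<mu>\<^sub>x\<close>
  are, up to conjugation, the coefficients of \<open>1 / (1 - b\<^sup>x)\<close>. The recursion for the
  auxiliary sequence inverts the triangular Toeplitz matrix of the moments, so
  \<open>g\<^sub>n = e\<^sub>n - \<Sum>\<^sub>j cnj (b\<^sub>n\<^sub>-\<^sub>j) e\<^sub>j\<close> explicitly, and the Gram matrix of the auxiliary
  sequence turns out to be \<open>1 - T T\<^sup>*\<close> (\<open>gram_eq\<close>). This much holds for every probability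
  measure.

  If \<open>\<mu>\<^sub>x\<close> is singular, then \<open>b\<^sup>x\<close> has \<open>\<ell>\<^sup>2\<close> norm \<open>1\<close> (\<open>singular_imp_norm_b_1\<close>). Boundary values
  are not needed for this: \<open>1 - |b|\<^sup>2\<close> is at most \<open>1\<close> and at most four times the Poisson
  integral of \<open>\<mu>\<^sub>x\<close>, and a measure carried by a Lebesgue null set has Poisson integrals that
  are small outside a set of small Lebesgue measure, by duality with trigonometric
  polynomials. The norm of \<open>g\<^sub>n\<close> is the part of the norm \<open>1\<close> that the first coefficients of
  \<open>b\<^sup>x\<close> leave over, so \<open>g\<^sub>n \<rightarrow> 0\<close> in \<open>L\<^sup>2(\<mu>\<^sub>x)\<close>; then the entries along each diagonal of the
  Gram matrix tend to \<open>0\<close> too, and this says precisely that \<open>T\<close> is an isometry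
  (\<open>shift_orthonormal\<close>). For Lebesgue measure \<open>T = 0\<close>. In both cases \<open>1 - T T\<^sup>*\<close> is the
  orthogonal projection onto the complement of the range of \<open>T\<close>
  (\<open>gram_orthogonal_shift\<close>, \<open>gram_row_norm\<close>).

  It remains to let \<open>x\<close> vary. The functions \<open>x \<mapsto> b\<^sup>x\<close> need not be norm continuous, but the
  rows of the Gram matrix are: their entries and their norms are continuous, and Dini's
  theorem applies. Hence \<open>V\<close> maps trigonometric polynomials into the complement
  of \<open>b\<^sup>x C(X, H\<^sup>2)\<close>, and by Bessel's inequality the completion as well
  (\<open>V_op_in_perp_mult\<close>). Conversely, if \<open>h\<close> with coefficients \<open>h\<^sub>n\<close> lies in the complement,
  then \<open>\<Sum>\<^sub>n h\<^sub>n g\<^sub>n\<close> converges in the module, since \<open>1 - T T\<^sup>* \<le> 1\<close> and the tails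
  of \<open>\<Sum>\<^sub>n |h\<^sub>n|\<^sup>2\<close> are uniformly small on the compact space \<open>X\<close>; its image is
  \<open>(1 - T T\<^sup>*) h = h\<close> (\<open>perp_mult_in_image\<close>).
\<close>

section \<open>Bounded Borel functions and the semi-inner product of a measure\<close>

definition bdd_borel :: "(real \<Rightarrow> 'a::real_normed_vector) \<Rightarrow> bool" where
  "bdd_borel f \<longleftrightarrow> f \<in> borel_measurable borel \<and> bounded (range f)"

definition circ :: "int \<Rightarrow> real \<Rightarrow> complex" where
  "circ j y = exp (2 * of_real pi * \<i> * of_int j * of_real y)"

definition ip :: "real measure \<Rightarrow> (real \<Rightarrow> complex) \<Rightarrow> (real \<Rightarrow> complex) \<Rightarrow> complex" where
  "ip M f g = (LINT y|M. f y * cnj (g y))"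

abbreviation nsq :: "real measure \<Rightarrow> (real \<Rightarrow> complex) \<Rightarrow> real" where
  "nsq M f \<equiv> Re (ip M f f)"

abbreviation moment :: "real measure \<Rightarrow> int \<Rightarrow> complex" where
  "moment M j \<equiv> (LINT y|M. circ j y)"

lemma V_inner_eq_ip: "V_inner \<mu> f g x = ip (\<mu> x) (f x) (g x)"
  by (simp add: V_inner_def ip_def)

lemma expo_eq_circ: "expo n x = circ (int n)"
  by (auto simp: expo_def circ_def)

lemma circ_0: "circ 0 = (\<lambda>_. 1)"
  by (auto simp: circ_def)

lemma circ_add: "circ (i + j) y = circ i y * circ j y"
  by (simp add: circ_def ring_distribs flip: exp_add)

lemma circ_minus: "circ (- j) y = cnj (circ j y)"
  by (simp add: circ_def exp_cnj)

lemma circ_diff: "circ (i - j) y = circ i y * cnj (circ j y)"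
  using circ_add[of i "- j" y] by (simp add: circ_minus)

lemma norm_circ [simp]: "cmod (circ j y) = 1"
  by (simp add: circ_def)

lemma circ_power: "circ (int n) y = circ 1 y ^ n"
  by (simp add: circ_def mult_ac flip: exp_of_nat_mult)

lemma continuous_circ: "continuous_on A (circ j)"
  unfolding circ_def by (intro continuous_intros)

lemma borel_measurable_circ [measurable]: "circ j \<in> borel_measurable borel"
  by (intro borel_measurable_continuous_onI continuous_circ)

lemma bdd_borelI:
  assumes "f \<in> borel_measurable borel" "\<And>y. norm (f y) \<le> B"
  shows "bdd_borel f"
  using assms by (auto simp: bdd_borel_def bounded_iff)

lemma bdd_borelD:
  assumes "bdd_borel f"
  obtains B where "f \<in> borel_measurable borel" "\<And>y. norm (f y) \<le> B"
  using assms by (auto simp: bdd_borel_def bounded_iff)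

named_theorems bdd_borel_intros

lemma bdd_borel_const [bdd_borel_intros]: "bdd_borel (\<lambda>_. c)"
  by (rule bdd_borelI[where B = "norm c"]) auto

lemma bdd_borel_circ [bdd_borel_intros]: "bdd_borel (circ j)"
  by (rule bdd_borelI[where B = 1]) auto

lemma bdd_borel_add [bdd_borel_intros]:
  fixes f g :: "real \<Rightarrow> 'a::{real_normed_vector,second_countable_topology}"
  assumes "bdd_borel f" "bdd_borel g" shows "bdd_borel (\<lambda>y. f y + g y)"
proof -
  obtain B C where "f \<in> borel_measurable borel" "\<And>y. norm (f y) \<le> B"
    "g \<in> borel_measurable borel" "\<And>y. norm (g y) \<le> C"
    using assms by (meson bdd_borelD)
  then show ?thesis
    by (intro bdd_borelI[where B = "B + C"]) (auto intro!: norm_triangle_mono)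
qed

lemma bdd_borel_mult [bdd_borel_intros]:
  fixes f g :: "real \<Rightarrow> 'a::{real_normed_algebra,second_countable_topology}"
  assumes "bdd_borel f" "bdd_borel g" shows "bdd_borel (\<lambda>y. f y * g y)"
proof -
  obtain B C where *: "f \<in> borel_measurable borel" "\<And>y. norm (f y) \<le> B"
    "g \<in> borel_measurable borel" "\<And>y. norm (g y) \<le> C"
    using assms by (meson bdd_borelD)
  have "0 \<le> B" using *(2)[of 0] norm_ge_zero[of "f 0"] by linarith
  with * show ?thesis
    by (intro bdd_borelI[where B = "B * C"])
       (auto intro!: order_trans[OF norm_mult_ineq] mult_mono)
qed

lemma bdd_borel_cnj [bdd_borel_intros]:
  assumes "bdd_borel f" shows "bdd_borel (\<lambda>y. cnj (f y))"
proof -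
  obtain B where *: "f \<in> borel_measurable borel" "\<And>y. norm (f y) \<le> B"
    using assms by (meson bdd_borelD)
  have "continuous_on UNIV cnj" by (intro continuous_intros)
  then have "(\<lambda>y. cnj (f y)) \<in> borel_measurable borel"
    by (rule borel_measurable_continuous_on) (rule *(1))
  with * show ?thesis by (intro bdd_borelI[where B = B]) simp_all
qed

lemma bdd_borel_diff [bdd_borel_intros]:
  fixes f g :: "real \<Rightarrow> complex"
  assumes "bdd_borel f" "bdd_borel g" shows "bdd_borel (\<lambda>y. f y - g y)"
proof -
  have "bdd_borel (\<lambda>y. f y + (- 1) * g y)"
    by (intro bdd_borel_intros assms)
  then show ?thesis by simp
qed

lemma bdd_borel_sum [bdd_borel_intros]:
  fixes f :: "'i \<Rightarrow> real \<Rightarrow> complex"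
  assumes "\<And>i. i \<in> I \<Longrightarrow> bdd_borel (f i)" shows "bdd_borel (\<lambda>y. \<Sum>i\<in>I. f i y)"
  using assms by (induction I rule: infinite_finite_induct) (auto intro: bdd_borel_intros)

lemma bdd_borel_Re:
  assumes "bdd_borel f" shows "bdd_borel (\<lambda>y. Re (f y))"
proof -
  obtain B where "f \<in> borel_measurable borel" "\<And>y. norm (f y) \<le> B"
    using assms by (meson bdd_borelD)
  then show ?thesis
    using order_trans[OF abs_Re_le_cmod] by (intro bdd_borelI[where B = B]) auto
qed

locale unit_interval_measure = prob_space M for M :: "real measure" +
  assumes sets_M: "sets M = sets borel01"
begin

lemma space_M: "space M = {0..<1}"
  using sets_eq_imp_space_eq[OF sets_M] by (simp add: borel01_def space_restrict_space)

lemma measurable_M: "f \<in> borel_measurable borel \<Longrightarrow> f \<in> borel_measurable M"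
  unfolding measurable_cong_sets[OF sets_M refl] borel01_def by (rule measurable_restrict_space1)

lemma integrable_bdd_borel:
  fixes f :: "real \<Rightarrow> 'a::{banach,second_countable_topology}"
  assumes "bdd_borel f" shows "integrable M f"
proof -
  obtain B where "f \<in> borel_measurable borel" "\<And>y. norm (f y) \<le> B"
    using assms by (meson bdd_borelD)
  then show ?thesis
    by (intro integrable_const_bound[where B = B] measurable_M) auto
qed

lemma ip_diff_left:
  "bdd_borel f \<Longrightarrow> bdd_borel g \<Longrightarrow> bdd_borel h \<Longrightarrow>
    ip M (\<lambda>y. f y - g y) h = ip M f h - ip M g h"
  by (simp add: ip_def left_diff_distrib Bochner_Integration.integral_diff integrable_bdd_borel bdd_borel_intros)

lemma ip_sum_left:
  "(\<And>i. i \<in> I \<Longrightarrow> bdd_borel (f i)) \<Longrightarrow> bdd_borel h \<Longrightarrow>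
    ip M (\<lambda>y. \<Sum>i\<in>I. f i y) h = (\<Sum>i\<in>I. ip M (f i) h)"
  unfolding ip_def sum_distrib_right
  by (rule Bochner_Integration.integral_sum) (auto intro!: integrable_bdd_borel bdd_borel_intros)

lemma ip_scale_left: "ip M (\<lambda>y. c * f y) h = c * ip M f h"
  by (simp add: ip_def mult.assoc)

lemma ip_sym: "ip M g f = cnj (ip M f g)"
  unfolding ip_def by (subst Bochner_Integration.integral_cnj[symmetric]) (simp add: mult.commute)

lemma ip_diff_right:
  "bdd_borel f \<Longrightarrow> bdd_borel g \<Longrightarrow> bdd_borel h \<Longrightarrow>
    ip M h (\<lambda>y. f y - g y) = ip M h f - ip M h g"
  using arg_cong[OF ip_diff_left[of f g h], of cnj] by (simp flip: ip_sym)

lemma ip_sum_right: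
  "(\<And>i. i \<in> I \<Longrightarrow> bdd_borel (f i)) \<Longrightarrow> bdd_borel h \<Longrightarrow>
    ip M h (\<lambda>y. \<Sum>i\<in>I. f i y) = (\<Sum>i\<in>I. ip M h (f i))"
  using arg_cong[OF ip_sum_left[of I f h], of cnj] by (simp flip: ip_sym)

lemma ip_scale_right: "ip M h (\<lambda>y. c * f y) = cnj c * ip M h f"
  using arg_cong[OF ip_scale_left[of c f h], of cnj] by (simp flip: ip_sym)

lemma nsq_nonneg: "0 \<le> nsq M f"
proof -
  have "ip M f f = of_real (LINT y|M. (cmod (f y))\<^sup>2)"
    unfolding ip_def complex_norm_square[symmetric] of_real_power[symmetric]
    by (rule integral_complex_of_real)
  then show ?thesis by simp
qed

lemma ip_self: "ip M f f = of_real (nsq M f)"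
  using arg_cong[OF ip_sym[of f f], of Im] by (simp add: complex_eq_iff)

lemma nsq_diff_scaled:
  assumes "bdd_borel f" "bdd_borel g"
  shows "nsq M (\<lambda>y. f y - c * g y) =
    nsq M f - 2 * Re (cnj c * ip M f g) + (cmod c)\<^sup>2 * nsq M g"
proof -
  have bc: "bdd_borel (\<lambda>y. c * g y)"
    by (intro bdd_borel_intros assms)
  have "ip M (\<lambda>y. f y - c * g y) (\<lambda>y. f y - c * g y) =
      ip M f f - cnj c * ip M f g - (c * ip M g f - c * cnj c * ip M g g)"
    unfolding ip_diff_left[OF assms(1) bc bdd_borel_diff[OF assms(1) bc]]
      ip_diff_right[OF assms(1) bc assms(1)] ip_diff_right[OF assms(1) bc bc]
      ip_scale_left ip_scale_right
    by (simp add: mult.assoc)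
  moreover have "c * ip M g f = cnj (cnj c * ip M f g)"
    using ip_sym[of g f] by simp
  moreover have "c * cnj c * ip M g g = of_real ((cmod c)\<^sup>2 * nsq M g)"
    by (subst ip_self) (simp flip: complex_norm_square)
  ultimately show ?thesis by simp
qed

lemma ip_Cauchy_Schwarz:
  assumes "bdd_borel f" "bdd_borel g"
  shows "cmod (ip M f g) \<le> sqrt (nsq M f) * sqrt (nsq M g)"
proof -
  define I where "I = (cmod (ip M f g))\<^sup>2"
  have q: "0 \<le> nsq M f - 2 * s * I + s\<^sup>2 * I * nsq M g" for s :: real
  proof -
    have "cnj (of_real s * ip M f g) * ip M f g = of_real (s * I)"
      unfolding of_real_mult I_def complex_norm_square
      by (simp only: complex_cnj_mult complex_cnj_complex_of_real mult_ac)
    then have "Re (cnj (of_real s * ip M f g) * ip M f g) = s * I"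
      by (simp only: Re_complex_of_real)
    moreover have "(cmod (of_real s * ip M f g))\<^sup>2 = s\<^sup>2 * I"
      by (simp add: I_def norm_mult power_mult_distrib)
    ultimately show ?thesis
      using nsq_nonneg[of "\<lambda>y. f y - (of_real s * ip M f g) * g y"]
      unfolding nsq_diff_scaled[OF assms] by (simp only: mult.assoc)
  qed
  have I0: "0 \<le> I" by (simp add: I_def)
  have "I \<le> nsq M f * nsq M g"
  proof (cases "nsq M g = 0")
    case True
    have "I = 0"
    proof (rule ccontr)
      assume "I \<noteq> 0"
      then show False
        using q[of "(nsq M f + 1) / I"] True nsq_nonneg[of f] by simp
    qed
    then show ?thesis using True by simp
  next
    case False
    then have pos: "0 < nsq M g" using nsq_nonneg[of g] by simp
    have "(1 / nsq M g)\<^sup>2 * I * nsq M g = I / nsq M g"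
      using pos by (simp add: power2_eq_square)
    then have "0 \<le> nsq M f - I / nsq M g"
      using q[of "1 / nsq M g"] by simp
    then show ?thesis using pos by (simp add: field_simps)
  qed
  then show ?thesis
    unfolding I_def real_sqrt_mult[symmetric] by (rule real_le_rsqrt)
qed

lemma ip_circ: "ip M (circ i) (circ j) = moment M (i - j)"
  by (simp add: ip_def circ_diff)

lemma moment_minus: "moment M (- j) = cnj (moment M j)"
  by (simp add: circ_minus)

lemma moment_0 [simp]: "moment M 0 = 1"
  using prob_space by (simp add: circ_0)

lemma norm_moment_le: "cmod (moment M j) \<le> 1"
proof -
  have "cmod (moment M j) \<le> (LINT y|M. cmod (circ j y))"
    by (rule integral_norm_bound)
  then show ?thesis using prob_space by simp
qed

end

section \<open>The auxiliary sequence of a single measure\<close>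

locale herglotz_measure = unit_interval_measure +
  fixes b :: "complex \<Rightarrow> complex"
  assumes herglotz: "herglotz M b"
begin

abbreviation bc :: "nat \<Rightarrow> complex" where
  "bc n \<equiv> taylor_coeff b n"

text \<open>The row \<open>shift j\<close> holds the Taylor coefficients of \<open>b(w) w\<^sup>j\<close>.\<close>

definition shift :: "nat \<Rightarrow> nat \<Rightarrow> complex" where
  "shift j m = (if j \<le> m then bc (m - j) else 0)"

text \<open>
  This closed form is shown to agree with the auxiliary sequence of the exponentials
  in \<open>auxiliary_seq_eq\<close>.
\<close>

definition aux :: "nat \<Rightarrow> real \<Rightarrow> complex" where
  "aux n y = circ (int n) y - (\<Sum>j\<le>n. cnj (bc (n - j)) * circ (int j) y)"

definition gram :: "nat \<Rightarrow> nat \<Rightarrow> complex" where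
  "gram n m = ip M (aux n) (aux m)"

text \<open>
  This is the integral in the Herglotz formula. It equals twice the Cauchy transform of the
  measure, minus \<open>1\<close>.
\<close>

definition herglotz_fun :: "complex \<Rightarrow> complex" where
  "herglotz_fun w = 2 * (\<Sum>j. cnj (moment M (int j)) * w ^ j) - 1"

lemma b_holo: "b holomorphic_on ball 0 1" and b_le: "w \<in> ball 0 1 \<Longrightarrow> cmod (b w) \<le> 1"
  and b_0: "b 0 = 0"
  using herglotz by (auto simp: herglotz_def)

lemma b_fps: "b has_fps_expansion fps_expansion b 0"
  using b_holo by (intro has_fps_expansion_fps_expansion[of "ball 0 1"]) auto

lemma bc_0 [simp]: "bc 0 = 0"
  using b_0 by (simp add: taylor_coeff_def fps_expansion_def)

lemma cauchy_transform_sums: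
  assumes "cmod w < 1"
  shows "(\<lambda>j. cnj (moment M (int j)) * w ^ j) sums (LINT y|M. 1 / (1 - w * circ (- 1) y))"
proof -
  have trm: "(w * circ (- 1) y) ^ j = w ^ j * circ (- int j) y" for j y
    using circ_power[of j y] by (simp add: power_mult_distrib circ_minus)
  have nrm: "cmod (w * circ (- 1) y) < 1" for y
    using assms by (simp add: norm_mult)
  have nrm': "cmod ((w * circ (- 1) y) ^ j) = cmod w ^ j" for y j
    by (simp add: norm_mult norm_power)
  have int: "integrable M (\<lambda>y. (w * circ (- 1) y) ^ j)" for j
    unfolding trm by (intro integrable_bdd_borel bdd_borel_intros)
  have "(\<lambda>j. (LINT y|M. (w * circ (- 1) y) ^ j)) sums (LINT y|M. (\<Sum>j. (w * circ (- 1) y) ^ j))"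
    using int assms by (intro sums_integral) (auto simp: nrm' prob_space simp del: prob_space intro!: summable_geometric)
  moreover have "(\<Sum>j. (w * circ (- 1) y) ^ j) = 1 / (1 - w * circ (- 1) y)" for y
    using nrm by (rule suminf_geometric)
  moreover have "(LINT y|M. (w * circ (- 1) y) ^ j) = cnj (moment M (int j)) * w ^ j" for j
    unfolding trm by (simp add: moment_minus)
  ultimately show ?thesis by simp
qed

lemma herglotz_fun_eq:
  assumes "cmod w < 1"
  shows "(1 + b w) / (1 - b w) = herglotz_fun w"
proof -
  have circ_eq: "exp (- 2 * of_real pi * \<i> * of_real y) = circ (- 1) y" for y
    by (simp add: circ_def)
  have "1 - w * circ (- 1) y \<noteq> 0" for y
  proof
    assume "1 - w * circ (- 1) y = 0"
    then have "cmod (w * circ (- 1) y) = 1" by simp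
    then show False using assms by (simp add: norm_mult)
  qed
  then have k: "(1 + w * exp (- 2 * of_real pi * \<i> * of_real y)) /
      (1 - w * exp (- 2 * of_real pi * \<i> * of_real y)) = 2 * (1 / (1 - w * circ (- 1) y)) - 1" for y
    unfolding circ_eq by (simp add: field_simps)
  have b1: "cmod (1 / (1 - w * circ (- 1) y)) \<le> 1 / (1 - cmod w)" for y
  proof -
    have "1 - cmod w \<le> cmod (1 - w * circ (- 1) y)"
      using norm_triangle_ineq2[of 1 "w * circ (- 1) y"] by (simp add: norm_mult)
    then show ?thesis using assms by (simp add: norm_divide frac_le)
  qed
  have "integrable M (\<lambda>y. 1 / (1 - w * circ (- 1) y))"
  proof (intro integrable_bdd_borel bdd_borelI[OF _ b1])
    show "(\<lambda>y. 1 / (1 - w * circ (- 1) y)) \<in> borel_measurable borel" by measurable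
  qed
  then have "(LINT y|M. 2 * (1 / (1 - w * circ (- 1) y)) - 1)
      = 2 * (LINT y|M. 1 / (1 - w * circ (- 1) y)) - 1"
  proof -
    assume "integrable M (\<lambda>y. 1 / (1 - w * circ (- 1) y))"
    then have "integrable M (\<lambda>y. 2 * (1 / (1 - w * circ (- 1) y)))"
      by (rule integrable_mult_right)
    then have "(LINT y|M. 2 * (1 / (1 - w * circ (- 1) y)) - 1)
        = (LINT y|M. 2 * (1 / (1 - w * circ (- 1) y))) - (LINT y|M. 1)"
      by (rule Bochner_Integration.integral_diff) simp
    then show ?thesis
      by (simp only: integral_mult_right_zero) (simp add: prob_space)
  qed
  moreover have "(1 + b w) / (1 - b w) = (LINT y|M. 2 * (1 / (1 - w * circ (- 1) y)) - 1)"
    unfolding k[symmetric] using herglotz assms by (auto simp: herglotz_def)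
  ultimately show ?thesis
    using sums_unique[OF cauchy_transform_sums[OF assms]] by (simp add: herglotz_fun_def)
qed

text \<open>
  The Herglotz formula, solved for the Cauchy transform \<open>C\<close>, reads \<open>(1 - b) C = 1\<close>. As an
  identity of formal power series it turns every relation between moments and Taylor
  coefficients into algebra.
\<close>

lemma fps_cauchy_transform: "(1 - fps_expansion b 0) * Abs_fps (\<lambda>j. cnj (moment M (int j))) = 1"
proof -
  define C where "C = (\<lambda>w. \<Sum>j. cnj (moment M (int j)) * w ^ j)"
  have ball: "eventually (\<lambda>w::complex. w \<in> ball 0 1) (nhds 0)"
    by (intro eventually_nhds_in_open) auto
  have "eventually (\<lambda>w. (\<lambda>j. fps_nth (Abs_fps (\<lambda>j. cnj (moment M (int j)))) j * w ^ j) sums C w) (nhds 0)"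
    using ball
  proof eventually_elim
    case (elim w)
    then show ?case
      using cauchy_transform_sums[of w] by (simp add: C_def sums_iff)
  qed
  then have C: "C has_fps_expansion Abs_fps (\<lambda>j. cnj (moment M (int j)))"
    by (rule has_fps_expansionI)
  have "isCont b 0"
    using b_holo by (intro continuous_on_interior[of "ball 0 1"] holomorphic_on_imp_continuous_on) auto
  then have "(b \<longlongrightarrow> b 0) (nhds 0)"
    by (simp add: isCont_def tendsto_at_iff_tendsto_nhds)
  then have "eventually (\<lambda>w. b w \<in> - {1}) (nhds 0)"
    by (rule topological_tendstoD) (auto simp: b_0)
  with ball have "eventually (\<lambda>w. (1 - b w) * C w = 1) (nhds 0)"
  proof eventually_elim
    case (elim w)
    have "(1 + b w) / (1 - b w) = 2 * C w - 1"
      using herglotz_fun_eq[of w] elim by (simp add: herglotz_fun_def C_def)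
    then show ?case
    proof -
      have "1 + b w = (2 * C w - 1) * (1 - b w)"
        using elim \<open>(1 + b w) / (1 - b w) = 2 * C w - 1\<close> by (simp add: divide_eq_eq)
      then have "2 * ((1 - b w) * C w) = 2 * 1" by (simp add: algebra_simps)
      then show ?thesis by (simp only: mult_left_cancel[OF zero_neq_numeral[symmetric]])
    qed
  qed
  then have "(\<lambda>w. (1 - b w) * C w) has_fps_expansion 1 \<longleftrightarrow> (\<lambda>_. 1) has_fps_expansion (1 :: complex fps)"
    by (rule has_fps_expansion_cong) simp
  then have "(\<lambda>w. (1 - b w) * C w) has_fps_expansion 1"
    using has_fps_expansion_1 by simp
  moreover have "(\<lambda>w. (1 - b w) * C w) has_fps_expansion
      (1 - fps_expansion b 0) * Abs_fps (\<lambda>j. cnj (moment M (int j)))"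
    by (intro fps_expansion_intros b_fps C)
  ultimately show ?thesis
    using fps_expansion_unique_complex by blast
qed

lemma bc_moment:
  "(\<Sum>k\<le>n. bc k * cnj (moment M (int (n - k)))) = cnj (moment M (int n)) - (if n = 0 then 1 else 0)"
proof -
  have "fps_expansion b 0 * Abs_fps (\<lambda>j. cnj (moment M (int j)))
      = Abs_fps (\<lambda>j. cnj (moment M (int j))) - 1"
    using fps_cauchy_transform by (simp add: algebra_simps)
  from arg_cong[OF this, of "\<lambda>F. fps_nth F n"] show ?thesis
    by (simp add: fps_mult_nth taylor_coeff_def atLeast0AtMost)
qed

text \<open>
  In this form the moments determine the coefficients one after another, which makes the
  latter continuous in a parameter as soon as the moments are.
\<close>

lemma bc_recursion:
  "0 < n \<Longrightarrow> bc n = cnj (moment M (int n)) - (\<Sum>k<n. bc k * cnj (moment M (int (n - k))))"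
  using bc_moment[of n]
  by (simp add: lessThan_Suc_atMost[symmetric] eq_diff_eq add.commute)

text \<open>
  For fixed \<open>y\<close>, the generating function of \<open>aux n y\<close> is that of the exponentials
  times \<open>1 - B\<close>, where \<open>B\<close> has the conjugate coefficients of \<open>b\<close>; multiplying by the generating
  function of the moments inverts this.
\<close>

lemma circ_eq_sum_aux: "circ (int n) y = (\<Sum>k\<le>n. moment M (int (n - k)) * aux k y)"
proof -
  define E where "E = Abs_fps (\<lambda>n. circ (int n) y)"
  define B where "B = Abs_fps (\<lambda>n. cnj (bc n))"
  define C where "C = Abs_fps (\<lambda>j. moment M (int j))"
  have "fps_nth (B * C) n = fps_nth (C - 1) n" for n
    using arg_cong[OF bc_moment[of n], of cnj]
    by (simp add: B_def C_def fps_mult_nth atLeast0AtMost)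
  then have "B * C = C - 1" by (simp add: fps_eq_iff)
  moreover have "fps_nth (E * B) n = (\<Sum>j\<le>n. cnj (bc (n - j)) * circ (int j) y)" for n
    unfolding E_def B_def fps_mult_nth fps_nth_Abs_fps atLeast0AtMost
    by (intro sum.cong refl mult.commute)
  then have "Abs_fps (\<lambda>n. aux n y) = E - E * B"
    by (simp add: fps_eq_iff aux_def) (simp add: E_def)
  ultimately have "E = Abs_fps (\<lambda>n. aux n y) * C"
    by (simp add: left_diff_distrib right_diff_distrib mult.assoc)
  from arg_cong[OF this, of "\<lambda>F. fps_nth F n"] show ?thesis
    by (simp add: E_def C_def fps_mult_nth atLeast0AtMost mult.commute)
qed

lemma aux_bdd_borel [bdd_borel_intros]: "bdd_borel (aux n)"
  unfolding aux_def by (intro bdd_borel_intros)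

lemma auxiliary_seq_eq:
  assumes "\<mu> x = M"
  shows "auxiliary_seq \<mu> expo n x = aux n"
proof (induction n rule: less_induct)
  case (less n)
  have "auxiliary_seq \<mu> expo n x y = aux n y" for y
  proof -
    have "auxiliary_seq \<mu> expo n x y
        = circ (int n) y - (\<Sum>k<n. moment M (int n - int k) * aux k y)"
      by (subst auxiliary_seq.simps) (simp add: less V_inner_eq_ip expo_eq_circ assms ip_circ)
    also have "(\<Sum>k<n. moment M (int n - int k) * aux k y) = circ (int n) y - aux n y"
      by (subst circ_eq_sum_aux) (simp add: lessThan_Suc_atMost[symmetric] of_nat_diff)
    finally show ?thesis by simp
  qed
  then show ?case by auto
qed

text \<open>
  This is the energy balance of the Kaczmarz algorithm: each step subtracts from the residual
  its projection to the next exponential, a unit vector. The coefficient of that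
  projection is the inner product of \<open>f\<close> with the next term of the auxiliary sequence, so
  the squared norm of the residual drops by exactly its squared modulus.
\<close>

lemma bessel_aux:
  assumes f: "bdd_borel f"
  shows "(\<Sum>n<N. (cmod (ip M f (aux n)))\<^sup>2) \<le> nsq M f"
proof -
  define r where "r = (\<lambda>N y. f y - (\<Sum>n<N. ip M f (aux n) * circ (int n) y))"
  have r_borel: "bdd_borel (r N)" for N
    unfolding r_def by (intro bdd_borel_intros f)
  have coeff: "ip M (r N) (circ (int N)) = ip M f (aux N)" for N
  proof -
    have "ip M f (circ (int N)) = ip M f (\<lambda>y. \<Sum>k\<le>N. moment M (int (N - k)) * aux k y)"
      using circ_eq_sum_aux[of N] by (intro arg_cong[where f = "ip M f"]) auto
    also have "\<dots> = (\<Sum>k\<le>N. cnj (moment M (int (N - k))) * ip M f (aux k))"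
      by (subst ip_sum_right[OF _ f]) (simp_all add: ip_scale_right bdd_borel_intros)
    also have "\<dots> = (\<Sum>k<N. cnj (moment M (int (N - k))) * ip M f (aux k)) + ip M f (aux N)"
      unfolding lessThan_Suc_atMost[symmetric] sum.lessThan_Suc by simp
    also have "(\<Sum>k<N. cnj (moment M (int (N - k))) * ip M f (aux k))
        = (\<Sum>n<N. ip M f (aux n) * ip M (circ (int n)) (circ (int N)))"
    proof (intro sum.cong refl)
      fix k assume "k \<in> {..<N}"
      then have "int k - int N = - int (N - k)" by simp
      then show "cnj (moment M (int (N - k))) * ip M f (aux k)
          = ip M f (aux k) * ip M (circ (int k)) (circ (int N))"
        by (simp only: ip_circ moment_minus mult.commute)
    qed
    finally show ?thesis
      unfolding r_def by (simp add: ip_diff_left ip_sum_left ip_scale_left bdd_borel_intros f)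
  qed
  have "nsq M (r N) = nsq M f - (\<Sum>n<N. (cmod (ip M f (aux n)))\<^sup>2)" for N
  proof (induction N)
    case 0
    then show ?case by (simp add: r_def)
  next
    case (Suc N)
    have "r (Suc N) = (\<lambda>y. r N y - ip M f (aux N) * circ (int N) y)"
      by (simp add: r_def fun_eq_iff)
    then have "nsq M (r (Suc N)) = nsq M (r N) - 2 * Re (cnj (ip M f (aux N)) * ip M f (aux N))
        + (cmod (ip M f (aux N)))\<^sup>2 * nsq M (circ (int N))"
      by (simp only: nsq_diff_scaled[OF r_borel bdd_borel_circ] coeff)
    also have "Re (cnj (ip M f (aux N)) * ip M f (aux N)) = (cmod (ip M f (aux N)))\<^sup>2"
      by (simp add: cmod_power2 flip: power2_eq_square)
    also have "nsq M (circ (int N)) = 1"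
      by (simp add: ip_circ)
    finally show ?case using Suc by simp
  qed
  with nsq_nonneg[of "r N"] show ?thesis by simp
qed

lemma ip_1_aux: "ip M (circ 0) (aux m) = (if m = 0 then 1 else 0)"
proof -
  have "ip M (circ 0) (aux m) = cnj (moment M (int m)) - (\<Sum>j\<le>m. bc (m - j) * cnj (moment M (int j)))"
    unfolding aux_def using moment_minus
    by (simp add: ip_diff_right ip_sum_right ip_scale_right ip_circ bdd_borel_intros)
  also have "(\<Sum>j\<le>m. bc (m - j) * cnj (moment M (int j))) = (\<Sum>k\<le>m. bc k * cnj (moment M (int (m - k))))"
    by (rule sum.reindex_bij_witness[where i = "\<lambda>k. m - k" and j = "\<lambda>k. m - k"]) auto
  finally show ?thesis unfolding bc_moment by simp
qed

lemma aux_Suc: "aux (Suc n) y = circ 1 y * aux n y - cnj (bc (Suc n)) * circ 0 y"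
  unfolding aux_def sum.atMost_Suc_shift
  by (simp add: circ_add algebra_simps sum_distrib_left)

lemma aux_0: "aux 0 = circ 0"
  by (auto simp: aux_def)

text \<open>
  Multiplication by \<open>e\<^sup>2\<^sup>\<pi>\<^sup>i\<^sup>y\<close> preserves inner products and moves \<open>aux n\<close> to \<open>aux (Suc n)\<close> up to a
  constant function, and \<open>ip_1_aux\<close> knows all inner products with constants. So the Gram
  matrix changes by a rank one matrix when both indices are shifted.
\<close>

lemma gram_Suc_Suc: "gram (Suc n) (Suc m) = gram n m - cnj (bc (Suc n)) * bc (Suc m)"
proof -
  let ?U = "\<lambda>n y. circ 1 y * aux n y"
  have B [bdd_borel_intros]: "bdd_borel (?U n)" for n by (intro bdd_borel_intros)
  have S: "aux (Suc n) = (\<lambda>y. ?U n y - cnj (bc (Suc n)) * circ 0 y)" for n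
    using aux_Suc by auto
  have U: "ip M (circ 0) (?U m) = bc (Suc m)" for m
    using ip_1_aux[of "Suc m"] unfolding S
    by (simp add: ip_diff_right ip_scale_right bdd_borel_intros ip_circ B)
  have UU: "ip M (?U n) (?U m) = gram n m"
  proof -
    have "circ 1 y * z * cnj (circ 1 y * w) = z * cnj w" for y z w
    proof -
      have "circ 1 y * cnj (circ 1 y) = 1"
        using circ_diff[of 1 1 y] by (simp add: circ_0)
      then show ?thesis
        by (metis (no_types, lifting) complex_cnj_mult mult.assoc mult.commute mult.left_neutral)
    qed
    then show ?thesis by (simp only: ip_def gram_def)
  qed
  have "gram (Suc n) (Suc m) = ip M (?U n) (?U m) - bc (Suc m) * ip M (?U n) (circ 0)
     - cnj (bc (Suc n)) * (ip M (circ 0) (?U m) - bc (Suc m) * ip M (circ 0) (circ 0))"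
    unfolding gram_def S
    by (simp add: ip_diff_left ip_diff_right ip_scale_left ip_scale_right bdd_borel_intros B)
  also have "ip M (?U n) (circ 0) = cnj (bc (Suc n))"
    using U by (subst ip_sym) simp
  finally show ?thesis
    by (simp add: U UU ip_circ mult.commute)
qed

text \<open>
  Adding up these rank one changes shows that the Gram matrix is \<open>1 - T T\<^sup>*\<close>, where \<open>T\<close> is
  multiplication by \<open>b\<close> on the Hardy space.
\<close>

lemma gram_eq: "gram n m = (if n = m then 1 else 0) - (\<Sum>j\<le>n. cnj (shift j n) * shift j m)"
proof (induction n arbitrary: m)
  case 0
  then show ?case
    using ip_1_aux[of m] by (simp add: gram_def aux_0 shift_def)
next
  case (Suc n)
  show ?case
  proof (cases m)
    case 0
    have "gram (Suc n) 0 = 0"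
      using ip_1_aux[of "Suc n"] unfolding gram_def aux_0 by (subst ip_sym) simp
    moreover have "shift j 0 = 0" for j by (simp add: shift_def)
    ultimately show ?thesis using 0 by simp
  next
    case (Suc k)
    have "shift (Suc j) (Suc i) = shift j i" "shift 0 (Suc i) = bc (Suc i)" for i j
      by (auto simp: shift_def)
    then show ?thesis
      unfolding Suc gram_Suc_Suc Suc.IH sum.atMost_Suc_shift by simp
  qed
qed

end

section \<open>Fourier coefficients on circles inside the disk\<close>

lemma emeasure_lebesgue01: "A \<in> sets borel \<Longrightarrow> A \<subseteq> {0..<1} \<Longrightarrow> emeasure lebesgue01 A = emeasure lborel A"
  unfolding lebesgue01_def by (subst emeasure_restrict_space) auto

interpretation leb: unit_interval_measure lebesgue01
proof -
  have "space lebesgue01 = {0..<1}"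
    by (simp add: lebesgue01_def space_restrict_space)
  then have "prob_space lebesgue01"
    by (intro prob_spaceI) (simp add: emeasure_lebesgue01)
  moreover have "sets lebesgue01 = sets borel01"
    by (simp add: lebesgue01_def borel01_def sets_restrict_space)
  ultimately show "unit_interval_measure lebesgue01"
    by (simp add: unit_interval_measure_def unit_interval_measure_axioms_def)
qed

lemma moment_lebesgue01: "moment lebesgue01 j = (if j = 0 then 1 else 0)"
proof (cases "j = 0")
  case False
  define a where "a = 2 * of_real pi * \<i> * (of_int j :: complex)"
  have a: "a \<noteq> 0" using False by (simp add: a_def)
  have e: "circ j = (\<lambda>y. exp (a * of_real y))"
    by (auto simp: circ_def a_def)
  have "circ j 1 = 1"
    by (simp add: circ_def exp_eq_1)
  have "moment lebesgue01 j = (LINT y|lborel. indicator {0..<1} y *\<^sub>R circ j y)"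
    unfolding lebesgue01_def by (subst integral_restrict_space) auto
  also have "\<dots> = (LINT y|lborel. indicator {0..1} y *\<^sub>R circ j y)"
  proof (rule integral_cong_AE)
    show "AE y in lborel. indicator {0..<1} y *\<^sub>R circ j y = indicator {0..1} y *\<^sub>R circ j y"
      using AE_lborel_singleton[of 1] by eventually_elim (auto simp: indicator_def)
  qed measurable
  also have "\<dots> = exp (a * of_real 1) / a - exp (a * of_real 0) / a"
  proof (rule integral_FTC_Icc)
    show "((\<lambda>y. exp (a * of_real y) / a) has_vector_derivative circ j y) (at y within {0..1})" for y
      unfolding e using a
      by (auto intro!: derivative_eq_intros has_vector_derivative_real_field simp: field_simps)
  qed (auto intro: continuous_circ)
  also have "\<dots> = 0"
    using \<open>circ j 1 = 1\<close> unfolding e by simp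
  finally show ?thesis using False by simp
qed (use leb.moment_0 in simp)

definition series_on_circle :: "(nat \<Rightarrow> complex) \<Rightarrow> real \<Rightarrow> real \<Rightarrow> complex" where
  "series_on_circle f r y = (\<Sum>n. f n * (of_real r * circ 1 y) ^ n)"

context
  fixes f :: "nat \<Rightarrow> complex" and K r :: real
  assumes bnd: "\<And>n. cmod (f n) \<le> K" and r: "0 \<le> r" "r < 1"
begin

lemma series_on_circle_term_bound: "cmod (f n * (of_real r * circ 1 y) ^ n) \<le> K * r ^ n"
  using bnd[of n] r by (simp add: norm_mult norm_power mult_right_mono)

lemma series_on_circle_summable: "summable (\<lambda>n. cmod (f n * (of_real r * circ 1 y) ^ n))"
proof (rule summable_comparison_test')
  show "summable (\<lambda>n. K * r ^ n)"
    using r by (intro summable_mult summable_geometric) auto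
qed (use series_on_circle_term_bound in auto)

lemma bdd_borel_series_on_circle: "bdd_borel (series_on_circle f r)"
proof (rule bdd_borelI)
  have "(\<lambda>y. f n * (of_real r * circ 1 y) ^ n) \<in> borel_measurable borel" for n
    by (intro borel_measurable_continuous_onI continuous_intros continuous_circ)
  then show "series_on_circle f r \<in> borel_measurable borel"
    unfolding series_on_circle_def[abs_def] by measurable
  show "norm (series_on_circle f r y) \<le> (\<Sum>n. K * r ^ n)" for y
    unfolding series_on_circle_def
    using r series_on_circle_term_bound series_on_circle_summable
    by (intro order_trans[OF summable_norm] suminf_le summable_mult summable_geometric) auto
qed

lemma series_on_circle_times_sums:
  assumes "bdd_borel h"
  shows "(\<lambda>n. f n * of_real r ^ n * (LINT y|lebesgue01. circ (int n) y * h y)) sums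
    (LINT y|lebesgue01. series_on_circle f r y * h y)"
proof -
  obtain B where B: "\<And>y. norm (h y) \<le> B" using assms by (meson bdd_borelD)
  have eq: "f n * (of_real r * circ 1 y) ^ n * h y = (f n * of_real r ^ n) * (circ (int n) y * h y)" for n y
    by (simp add: circ_power[of n y] power_mult_distrib mult_ac)
  have int: "integrable lebesgue01 (\<lambda>y. f n * (of_real r * circ 1 y) ^ n * h y)" for n
    unfolding eq by (intro leb.integrable_bdd_borel bdd_borel_intros assms)
  have le: "cmod (f n * (of_real r * circ 1 y) ^ n * h y) \<le> K * r ^ n * B" for n y
  proof -
    have "0 \<le> K" using bnd[of 0] norm_ge_zero[of "f 0"] by linarith
    then have "0 \<le> K * r ^ n" using r by simp
    then show ?thesis
      unfolding norm_mult[of _ "h y"]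
      by (intro mult_mono series_on_circle_term_bound B norm_ge_zero)
  qed
  have "(\<lambda>n. (LINT y|lebesgue01. f n * (of_real r * circ 1 y) ^ n * h y)) sums
      (LINT y|lebesgue01. (\<Sum>n. f n * (of_real r * circ 1 y) ^ n * h y))"
  proof (rule sums_integral[OF int])
    show "AE y in lebesgue01. summable (\<lambda>n. norm (f n * (of_real r * circ 1 y) ^ n * h y))"
      using series_on_circle_summable by (simp add: norm_mult summable_mult2)
    have "(LINT y|lebesgue01. cmod (f n * (of_real r * circ 1 y) ^ n * h y)) \<le> (LINT y|lebesgue01. K * r ^ n * B)" for n
      using le int by (intro integral_mono integrable_norm) auto
    then have "(LINT y|lebesgue01. cmod (f n * (of_real r * circ 1 y) ^ n * h y)) \<le> K * r ^ n * B" for n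
      by (simp add: leb.prob_space)
    moreover have "summable (\<lambda>n. K * r ^ n * B)"
      using r by (intro summable_mult summable_mult2 summable_geometric) auto
    moreover have "0 \<le> (LINT y|lebesgue01. cmod (f n * (of_real r * circ 1 y) ^ n * h y))" for n
      by (rule Bochner_Integration.integral_nonneg) simp
    ultimately show "summable (\<lambda>n. LINT y|lebesgue01. norm (f n * (of_real r * circ 1 y) ^ n * h y))"
      by (metis (no_types, lifting) abs_of_nonneg real_norm_def summable_comparison_test')
  qed
  moreover have "(\<Sum>n. f n * (of_real r * circ 1 y) ^ n * h y) = series_on_circle f r y * h y" for y
    unfolding series_on_circle_def
    by (rule suminf_mult2[symmetric]) (rule summable_norm_cancel[OF series_on_circle_summable])
  ultimately show ?thesis
    by (simp add: eq)
qed

lemma series_on_circle_coeff: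
  "(LINT y|lebesgue01. series_on_circle f r y * circ j y)
    = (if j \<le> 0 then f (nat (- j)) * of_real r ^ nat (- j) else 0)"
proof -
  have "(\<lambda>n. f n * of_real r ^ n * (LINT y|lebesgue01. circ (int n) y * circ j y)) sums
      (LINT y|lebesgue01. series_on_circle f r y * circ j y)"
    by (rule series_on_circle_times_sums) (rule bdd_borel_circ)
  moreover have "(LINT y|lebesgue01. circ (int n) y * circ j y) = (if int n + j = 0 then 1 else 0)" for n
    using moment_lebesgue01[of "int n + j"] by (simp add: circ_add)
  moreover have "(if int n + j = 0 then 1 else 0 :: complex) = (if j \<le> 0 \<and> n = nat (- j) then 1 else 0)" for n
    by auto
  ultimately have *: "(\<lambda>n. f n * of_real r ^ n * (if j \<le> 0 \<and> n = nat (- j) then 1 else 0)) sums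
      (LINT y|lebesgue01. series_on_circle f r y * circ j y)"
    by simp
  show ?thesis
  proof (cases "j \<le> 0")
    case True
    have "(\<lambda>n. if n = nat (- j) then f n * of_real r ^ n else 0) sums (f (nat (- j)) * of_real r ^ nat (- j))"
      by (rule sums_single)
    moreover have "(\<lambda>n. f n * of_real r ^ n * (if j \<le> 0 \<and> n = nat (- j) then 1 else 0))
        = (\<lambda>n. if n = nat (- j) then f n * of_real r ^ n else 0)"
      using True by auto
    ultimately show ?thesis using * True sums_unique2 by auto
  next
    case False
    then show ?thesis using * sums_unique2[OF _ sums_zero] by auto
  qed
qed

lemma series_on_circle_parseval:
  "(\<lambda>n. (cmod (f n))\<^sup>2 * r ^ (2 * n)) sums (LINT y|lebesgue01. (cmod (series_on_circle f r y))\<^sup>2)"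
proof -
  let ?F = "series_on_circle f r"
  have "(\<lambda>n. f n * of_real r ^ n * (LINT y|lebesgue01. circ (int n) y * cnj (?F y))) sums
      (LINT y|lebesgue01. ?F y * cnj (?F y))"
    by (intro series_on_circle_times_sums bdd_borel_intros bdd_borel_series_on_circle)
  moreover have "(LINT y|lebesgue01. circ (int n) y * cnj (?F y)) = cnj (f n * of_real r ^ n)" for n
  proof -
    have "(LINT y|lebesgue01. circ (int n) y * cnj (?F y))
        = cnj (LINT y|lebesgue01. ?F y * circ (- int n) y)"
      unfolding Bochner_Integration.integral_cnj[symmetric] by (simp add: circ_minus mult.commute)
    then show ?thesis by (simp add: series_on_circle_coeff)
  qed
  moreover have "f n * of_real r ^ n * cnj (f n * of_real r ^ n) = of_real ((cmod (f n))\<^sup>2 * r ^ (2 * n))" for n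
  proof -
    have "f n * of_real r ^ n * cnj (f n * of_real r ^ n) = of_real ((cmod (f n * of_real r ^ n))\<^sup>2)"
      by (simp only: complex_norm_square)
    then show ?thesis using r by (simp add: norm_mult norm_power power_mult_distrib power_mult mult.commute[of 2] power_even_eq)
  qed
  moreover have "(LINT y|lebesgue01. ?F y * cnj (?F y)) = of_real (LINT y|lebesgue01. (cmod (?F y))\<^sup>2)"
    unfolding complex_norm_square[symmetric] of_real_power[symmetric]
    by (rule integral_complex_of_real)
  ultimately show ?thesis
    by (simp only: sums_of_real_iff)
qed

end

section \<open>The Herglotz function as a Poisson integral\<close>

context herglotz_measure
begin

definition herglotz_coeff :: "nat \<Rightarrow> complex" where
  "herglotz_coeff n = (if n = 0 then 1 else 2 * cnj (moment M (int n)))"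

lemma norm_herglotz_coeff: "cmod (herglotz_coeff n) \<le> 2"
  using norm_moment_le[of "int n"] by (simp add: herglotz_coeff_def norm_mult)

lemma norm_r_circ: "0 \<le> r \<Longrightarrow> cmod (of_real r * circ 1 y) = r"
  by (simp add: norm_mult)

lemma herglotz_fun_on_circle:
  assumes "0 \<le> r" "r < 1"
  shows "herglotz_fun (of_real r * circ 1 y) = series_on_circle herglotz_coeff r y"
proof -
  let ?w = "of_real r * circ 1 y"
  have "(\<lambda>n. 2 * (cnj (moment M (int n)) * ?w ^ n)) sums (2 * (\<Sum>n. cnj (moment M (int n)) * ?w ^ n))"
    using cauchy_transform_sums[of ?w] norm_r_circ[of r y] assms
    by (intro sums_mult) (simp add: sums_iff)
  moreover have "(\<lambda>n. if n = 0 then 1 else 0 :: complex) sums 1"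
    using sums_single[of 0 "\<lambda>_. 1 :: complex"] by simp
  ultimately have "(\<lambda>n. 2 * (cnj (moment M (int n)) * ?w ^ n) - (if n = 0 then 1 else 0)) sums herglotz_fun ?w"
    unfolding herglotz_fun_def by (rule sums_diff)
  moreover have "2 * (cnj (moment M (int n)) * ?w ^ n) - (if n = 0 then 1 else 0) = herglotz_coeff n * ?w ^ n" for n
    by (simp add: herglotz_coeff_def)
  ultimately show ?thesis by (simp add: series_on_circle_def sums_iff)
qed

text \<open>
  The real part of the Herglotz function is the Poisson integral of the measure; here this
  is stated through its Fourier coefficients.
\<close>

lemma poisson_coeff:
  assumes "0 \<le> r" "r < 1"
  shows "(LINT y|lebesgue01. circ j y * of_real (Re (herglotz_fun (of_real r * circ 1 y))))
    = moment M j * of_real r ^ nat \<bar>j\<bar>"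
proof -
  let ?H = "series_on_circle herglotz_coeff r"
  note H = bdd_borel_series_on_circle[OF norm_herglotz_coeff assms]
  note coeff = series_on_circle_coeff[OF norm_herglotz_coeff assms]
  have Re: "of_real (Re z) = (z + cnj z) / 2" for z
    by (simp add: complex_eq_iff)
  have "(LINT y|lebesgue01. circ j y * of_real (Re (?H y)))
      = (LINT y|lebesgue01. 1 / 2 * (?H y * circ j y) + 1 / 2 * cnj (?H y * circ (- j) y))"
    unfolding Re by (simp add: circ_minus algebra_simps add_divide_distrib)
  also have "\<dots> = (LINT y|lebesgue01. 1 / 2 * (?H y * circ j y))
      + (LINT y|lebesgue01. 1 / 2 * cnj (?H y * circ (- j) y))"
    by (intro Bochner_Integration.integral_add leb.integrable_bdd_borel bdd_borel_intros H)
  also have "\<dots> = 1 / 2 * (LINT y|lebesgue01. ?H y * circ j y)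
      + 1 / 2 * cnj (LINT y|lebesgue01. ?H y * circ (- j) y)"
    by (simp only: integral_mult_right_zero Bochner_Integration.integral_cnj)
  also have "\<dots> = moment M j * of_real r ^ nat \<bar>j\<bar>"
  proof -
    consider "j = 0" | "0 < j" | "j < 0" by linarith
    then show ?thesis
    proof cases
      case 3
      have "moment M j = cnj (moment M (- j))" by (simp add: moment_minus)
      with 3 show ?thesis by (simp add: coeff herglotz_coeff_def)
    qed (simp_all add: coeff herglotz_coeff_def)
  qed
  finally show ?thesis by (simp only: herglotz_fun_on_circle[OF assms])
qed

text \<open>
  Since \<open>Re ((1 + b) / (1 - b)) = (1 - |b|\<^sup>2) / |1 - b|\<^sup>2\<close> and \<open>|1 - b| \<le> 2\<close>, the defect of \<open>b\<close>
  from modulus \<open>1\<close> is controlled by the Poisson integral.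
\<close>

lemma one_minus_norm_b:
  assumes "cmod w < 1"
  shows "1 - (cmod (b w))\<^sup>2 \<le> 4 * Re (herglotz_fun w)"
    and "0 \<le> Re (herglotz_fun w)"
proof -
  have le: "cmod (b w) \<le> 1" using b_le assms by simp
  then have le2: "(cmod (b w))\<^sup>2 \<le> 1" by (simp add: power_le_one)
  have Re: "Re (herglotz_fun w) = (1 - (cmod (b w))\<^sup>2) / (cmod (1 - b w))\<^sup>2"
    unfolding herglotz_fun_eq[OF assms, symmetric] Re_divide cmod_power2
    by (simp add: power2_eq_square algebra_simps)
  show "0 \<le> Re (herglotz_fun w)"
    unfolding Re using le2 by simp
  have "cmod (1 - b w) \<le> 2"
    using norm_triangle_ineq4[of 1 "b w"] le by simp
  then have 4: "(cmod (1 - b w))\<^sup>2 \<le> 4"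
    using power_mono[of "cmod (1 - b w)" 2 2] by simp
  show "1 - (cmod (b w))\<^sup>2 \<le> 4 * Re (herglotz_fun w)"
  proof (cases "b w = 1")
    case False
    then have "0 < (cmod (1 - b w))\<^sup>2" by simp
    then show ?thesis
      unfolding Re using 4 le2 mult_right_mono[OF 4, of "1 - (cmod (b w))\<^sup>2"]
      by (simp add: field_simps)
  qed (simp add: Re)
qed

lemma b_on_circle:
  assumes "0 \<le> r" "r < 1"
  shows "b (of_real r * circ 1 y) = series_on_circle bc r y"
proof -
  have "(\<lambda>n. fps_nth (fps_expansion b 0) n * (of_real r * circ 1 y) ^ n) sums b (of_real r * circ 1 y)"
    using b_holo norm_r_circ[of r y] assms
    by (intro has_fps_expansion_imp_sums_complex[OF b_fps, where r = 1])
       (auto simp: one_ereal_def)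
  then show ?thesis
    by (simp add: series_on_circle_def taylor_coeff_def sums_iff)
qed

text \<open>
  The diagonal of \<open>gram_eq\<close>: the norms of the auxiliary sequence measure how much of the
  norm of \<open>b\<close> is still missing from its first coefficients.
\<close>

lemma sum_bc_le: "(\<Sum>j\<le>n. (cmod (bc j))\<^sup>2) \<le> 1"
  and nsq_aux: "nsq M (aux n) = 1 - (\<Sum>j\<le>n. (cmod (bc j))\<^sup>2)"
proof -
  have "(\<Sum>j\<le>n. cnj (shift j n) * shift j n) = (\<Sum>j\<le>n. of_real ((cmod (bc (n - j)))\<^sup>2))"
    by (intro sum.cong) (auto simp: shift_def complex_norm_square mult.commute simp del: of_real_power)
  also have "\<dots> = (\<Sum>j\<le>n. of_real ((cmod (bc j))\<^sup>2))"
    by (rule sum.reindex_bij_witness[where i = "\<lambda>k. n - k" and j = "\<lambda>k. n - k"]) auto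
  finally have "gram n n = of_real (1 - (\<Sum>j\<le>n. (cmod (bc j))\<^sup>2))"
    by (simp add: gram_eq)
  then show *: "nsq M (aux n) = 1 - (\<Sum>j\<le>n. (cmod (bc j))\<^sup>2)"
    by (simp only: gram_def[symmetric] Re_complex_of_real)
  show "(\<Sum>j\<le>n. (cmod (bc j))\<^sup>2) \<le> 1"
    using nsq_nonneg[of "aux n"] unfolding * by simp
qed

lemma summable_bc: "summable (\<lambda>n. (cmod (bc n))\<^sup>2)"
  by (rule bounded_imp_summable[where B = 1]) (use sum_bc_le in auto)

lemma norm_bc_le: "cmod (bc n) \<le> 1"
proof -
  have "(cmod (bc n))\<^sup>2 \<le> (\<Sum>j\<le>n. (cmod (bc j))\<^sup>2)"
    by (rule member_le_sum) auto
  then have "(cmod (bc n))\<^sup>2 \<le> 1" using sum_bc_le[of n] by linarith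
  then show ?thesis by (simp add: power2_le_iff_abs_le abs_square_le_1)
qed

end

section \<open>Singular measures have inner Herglotz transforms\<close>

text \<open>
  Unlike the elements of \<open>trig_module\<close>, these have scalar coefficients and also negative
  frequencies, so that they approximate all continuous functions on the circle.
\<close>

inductive trig_poly :: "(real \<Rightarrow> complex) \<Rightarrow> bool" where
  monomial: "trig_poly (\<lambda>y. a * circ j y)"
| add: "trig_poly p \<Longrightarrow> trig_poly q \<Longrightarrow> trig_poly (\<lambda>y. p y + q y)"

lemma bdd_borel_trig_poly: "trig_poly q \<Longrightarrow> bdd_borel q"
  by (induction rule: trig_poly.induct) (intro bdd_borel_intros; assumption)+

lemma trig_poly_mult:
  assumes "trig_poly p" "trig_poly q" shows "trig_poly (\<lambda>y. p y * q y)"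
  using assms
proof (induction rule: trig_poly.induct)
  case (monomial a i)
  from this show ?case
  proof (induction rule: trig_poly.induct)
    case (monomial c j)
    have "(\<lambda>y. a * circ i y * (c * circ j y)) = (\<lambda>y. a * c * circ (i + j) y)"
      by (simp add: circ_add mult_ac)
    then show ?case using trig_poly.monomial by simp
  qed (simp add: distrib_left trig_poly.add)
qed (simp add: distrib_right trig_poly.add)

lemma trig_poly_of_real_polynomial:
  assumes "real_polynomial_function p"
  shows "trig_poly (\<lambda>y. of_real (p (circ 1 y)))"
  using assms
proof (induction rule: real_polynomial_function.induct)
  case (linear f)
  interpret bounded_linear f by fact
  have f: "f z = Re z * f 1 + Im z * f \<i>" for z
  proof -
    have "f (Re z *\<^sub>R 1 + Im z *\<^sub>R \<i>) = Re z * f 1 + Im z * f \<i>"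
      by (simp add: add scaleR)
    moreover have "Re z *\<^sub>R 1 + Im z *\<^sub>R \<i> = z" by (simp add: complex_eq_iff)
    ultimately show ?thesis by simp
  qed
  have "of_real (f (circ 1 y)) =
      Complex (f 1 / 2) (- f \<i> / 2) * circ 1 y + Complex (f 1 / 2) (f \<i> / 2) * circ (- 1) y" for y
    unfolding f[of "circ 1 y"] circ_minus by (simp add: complex_eq_iff)
  then show ?case using trig_poly.intros by simp
next
  case (const c)
  then show ?case using trig_poly.monomial[of "of_real c" 0] by (simp add: circ_0)
qed (simp_all add: trig_poly.add trig_poly_mult)

lemma inj_on_circ_1: "inj_on (circ 1) {0..<1}"
proof (rule inj_onI)
  fix x y :: real assume xy: "x \<in> {0..<1}" "y \<in> {0..<1}" and eq: "circ 1 x = circ 1 y"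
  then obtain n :: int where
    n: "2 * of_real pi * \<i> * of_real x = 2 * of_real pi * \<i> * of_real y + of_int (2 * n) * of_real pi * \<i>"
    unfolding circ_def exp_eq by auto
  have "pi * (2 * x) = pi * (2 * y + 2 * of_int n)"
    using arg_cong[OF n, of Im] by (simp add: algebra_simps)
  then have *: "x = y + of_int n" by simp
  then have "of_int n < (1::real)" "(-1::real) < of_int n" using xy by auto
  then have "n = 0" by linarith
  then show "x = y" using * by simp
qed

context unit_interval_measure
begin

lemma singular_obtain_compact:
  assumes "singular_measure M" "0 < \<epsilon>"
  obtains K where "compact K" "K \<subseteq> {0..<1}" "emeasure lborel K = 0" "1 - \<epsilon> < measure M K"
proof -
  obtain A where A: "A \<in> null_sets M" "{0..<1} - A \<in> null_sets lebesgue01"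
    using assms by (auto simp: singular_measure_def)
  define S where "S = {0..<1} - A"
  have sets: "X \<in> sets borel \<and> X \<subseteq> {0..<1}" if "X \<in> sets M" for X
    using that by (auto simp: sets_M borel01_def sets_restrict_space)
  have AM: "A \<in> sets M" using A(1) by auto
  then have S: "S \<in> sets borel" using sets by (auto simp: S_def)
  have SM: "S \<in> sets M" using AM space_M by (metis S_def sets.compl_sets)
  define N where "N = distr M borel (\<lambda>y. y)"
  have id: "(\<lambda>y. y) \<in> measurable M borel" by (rule measurable_M) simp
  have N: "emeasure N X = emeasure M (X \<inter> {0..<1})" if "X \<in> sets borel" for X
    using that by (simp add: N_def emeasure_distr[OF id] space_M)
  have "emeasure M S = 1"
    using emeasure_Diff_null_set[OF A(1), of "space M"] emeasure_space_1 unfolding S_def space_M[symmetric] by simp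
  then have "emeasure N S = 1" using N[OF S] by (simp add: S_def Int_absorb2 Diff_subset)
  moreover have "emeasure N S = (SUP K\<in>{K. K \<subseteq> S \<and> compact K}. emeasure N K)"
    by (rule inner_regular) (use N[of UNIV] emeasure_space_1 S in \<open>auto simp: N_def space_M\<close>)
  ultimately have "ennreal (1 - \<epsilon>) < (SUP K\<in>{K. K \<subseteq> S \<and> compact K}. emeasure N K)"
    using assms(2) by (simp add: ennreal_less_one_iff)
  then obtain K where K: "K \<subseteq> S" "compact K" "ennreal (1 - \<epsilon>) < emeasure N K"
    unfolding less_SUP_iff by auto
  have Kb: "K \<in> sets borel" using K(2) by (simp add: borel_compact)
  have K01: "K \<subseteq> {0..<1}" using K(1) by (auto simp: S_def)
  have "emeasure N K = ennreal (measure M K)"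
    using N[OF Kb] K01 by (simp add: Int_absorb2 emeasure_eq_measure)
  then have "1 - \<epsilon> < measure M K"
    using K(3) by (metis ennreal_leI not_le)
  moreover have "emeasure lborel K = 0"
  proof -
    have "emeasure lborel K \<le> emeasure lborel S"
      using K(1) S by (intro emeasure_mono) auto
    also have "\<dots> = emeasure lebesgue01 S"
      using S by (intro emeasure_lebesgue01[symmetric]) (auto simp: S_def)
    also have "\<dots> = 0" using A(2) by (auto simp: S_def)
    finally show ?thesis by simp
  qed
  ultimately show ?thesis using that K K01 by blast
qed

text \<open>
  Most of the mass sits on a compact Lebesgue null set \<open>K\<close>. A continuous bump \<open>\<phi>\<close> around \<open>K\<close>
  has small Lebesgue integral, and by the Stone-Weierstrass theorem \<open>1 - \<phi>\<close> can be
  replaced by a polynomial. The bump is built on the circle in the complex plane, where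
  periodicity is automatic.
\<close>

lemma singular_obtain_polynomial:
  assumes "singular_measure M" "0 < \<epsilon>"
  obtains p \<phi> where "real_polynomial_function p" "bdd_borel \<phi>"
    "\<And>y. 0 \<le> p (circ 1 y)" "\<And>y. 0 \<le> \<phi> y" "\<And>y. 1 \<le> p (circ 1 y) + \<phi> y"
    "(LINT y|M. p (circ 1 y)) \<le> \<epsilon>" "(LINT y|lebesgue01. \<phi> y) \<le> \<epsilon>"
proof -
  \<comment> \<open>The integral of \<open>p\<close> picks up one \<open>d\<close> from the mass off \<open>K\<close> and two from the approximation.
      The bound \<open>d < 1\<close> makes \<open>K\<close> nonempty, so that the distance to it is meaningful.\<close>
  define d where "d = min (1/2) (\<epsilon> / 3)"
  have d: "0 < d" "d < 1" "3 * d \<le> \<epsilon>" using assms(2) by (auto simp: d_def)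
  obtain K where K: "compact K" "K \<subseteq> {0..<1}" "emeasure lborel K = 0" "1 - d < measure M K"
    using singular_obtain_compact[OF assms(1) d(1)] by blast
  have Kb [measurable]: "K \<in> sets borel" using K(1) by (simp add: borel_compact)
  define C where "C = circ 1 ` K"
  have "K \<noteq> {}" using K(4) d(2) by auto
  then have C: "compact C" "C \<noteq> {}"
    by (auto simp: C_def intro!: compact_continuous_image continuous_circ K(1))
  define h where "h = (\<lambda>n::nat. \<lambda>z. max 0 (1 - real n * infdist z C))"
  have h_cont: "continuous_on A (h n)" for A n
    unfolding h_def by (intro continuous_intros)
  have h_bound: "0 \<le> h n z" "h n z \<le> 1" for n z
    using infdist_nonneg[of z C] by (auto simp: h_def)
  have h_borel: "bdd_borel (\<lambda>y. h n (circ 1 y))" for n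
    by (rule bdd_borelI[where B = 1])
       (use h_bound in \<open>auto intro!: borel_measurable_continuous_onI
          continuous_on_compose2[OF h_cont continuous_circ]\<close>)
  have h_lim: "(\<lambda>n. h n (circ 1 y)) \<longlonglongrightarrow> indicator K y" if y: "y \<in> {0..<1}" for y
  proof (cases "y \<in> K")
    case True
    then have "infdist (circ 1 y) C = 0" by (simp add: C_def)
    then show ?thesis using True by (simp add: h_def)
  next
    case False
    then have "circ 1 y \<notin> C"
      using inj_onD[OF inj_on_circ_1] K(2) y unfolding C_def by blast
    then have pos: "0 < infdist (circ 1 y) C"
      using C by (metis compact_imp_closed in_closed_iff_infdist_zero infdist_nonneg less_eq_real_def)
    obtain n0 :: nat where n0: "1 / infdist (circ 1 y) C < real n0" using reals_Archimedean2 by blast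
    have "h n (circ 1 y) = 0" if "n0 \<le> n" for n
    proof -
      have "1 < real n0 * infdist (circ 1 y) C" using n0 pos by (simp add: divide_less_eq)
      also have "\<dots> \<le> real n * infdist (circ 1 y) C" using that pos by (intro mult_right_mono) auto
      finally show ?thesis by (simp add: h_def)
    qed
    then have "eventually (\<lambda>n. h n (circ 1 y) = 0) sequentially"
      by (auto simp: eventually_sequentially)
    then show ?thesis using False by (simp add: tendsto_eventually)
  qed
  have "(\<lambda>n. LINT y|lebesgue01. h n (circ 1 y)) \<longlonglongrightarrow> (LINT y|lebesgue01. indicator K y)"
  proof (rule integral_dominated_convergence[where w = "\<lambda>_. 1"])
    show "AE y in lebesgue01. (\<lambda>n. h n (circ 1 y)) \<longlonglongrightarrow> indicator K y"
      using h_lim by (intro AE_I2) (simp add: leb.space_M)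
    show "(\<lambda>y. indicator K y :: real) \<in> borel_measurable lebesgue01"
      by (rule leb.measurable_M) measurable
    show "(\<lambda>y. h n (circ 1 y)) \<in> borel_measurable lebesgue01" for n
      using h_borel by (intro leb.measurable_M) (auto simp: bdd_borel_def)
  qed (use h_bound in auto)
  moreover have "(LINT y|lebesgue01. indicator K y :: real) = 0"
  proof -
    have "K \<inter> space lebesgue01 = K" using K(2) leb.space_M by auto
    then show ?thesis
      using emeasure_lebesgue01[OF Kb K(2)] K(3) by (simp add: measure_def)
  qed
  ultimately have "eventually (\<lambda>n. (LINT y|lebesgue01. h n (circ 1 y)) < d) sequentially"
    using d(1) by (intro order_tendstoD) auto
  then obtain n where n: "(LINT y|lebesgue01. h n (circ 1 y)) < d"
    by (auto simp: eventually_sequentially)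
  \<comment> \<open>The summand \<open>d\<close> keeps an approximation with error below \<open>d\<close> nonnegative.\<close>
  have cont: "continuous_on (sphere 0 1) (\<lambda>z. 1 - h n z + d)"
    by (intro continuous_intros h_cont)
  obtain p where p: "real_polynomial_function p"
    "\<And>z. z \<in> sphere 0 1 \<Longrightarrow> \<bar>(1 - h n z + d) - p z\<bar> < d"
    using Stone_Weierstrass_real_polynomial_function[OF compact_sphere cont d(1)] by blast
  have p': "\<bar>(1 - h n (circ 1 y) + d) - p (circ 1 y)\<bar> < d" for y
    by (rule p(2)) simp
  have p_borel: "bdd_borel (\<lambda>y. p (circ 1 y))"
    using bdd_borel_Re[OF bdd_borel_trig_poly[OF trig_poly_of_real_polynomial[OF p(1)]]] by simp
  have Kind: "integrable M (indicator K :: real \<Rightarrow> real)"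
    by (intro integrable_bdd_borel bdd_borelI[where B = 1]) (auto simp: indicator_def)
  have "(LINT y|M. p (circ 1 y)) \<le> (LINT y|M. (1 + 2 * d) - indicator K y)"
  proof (rule integral_mono)
    show "integrable M (\<lambda>y. p (circ 1 y))" by (rule integrable_bdd_borel[OF p_borel])
    show "integrable M (\<lambda>y. (1 + 2 * d) - indicator K y)" using Kind by simp
    fix y
    have "indicator K y \<le> h n (circ 1 y)"
      using h_bound(1)[of n] by (cases "y \<in> K") (auto simp: h_def C_def)
    then show "p (circ 1 y) \<le> (1 + 2 * d) - indicator K y" using p'[of y] by linarith
  qed
  also have "\<dots> = (1 + 2 * d) - measure M K"
  proof -
    have "K \<inter> space M = K" using K(2) space_M by auto
    then show ?thesis
      using Kind by (subst Bochner_Integration.integral_diff) (auto simp: prob_space)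
  qed
  also have "\<dots> \<le> \<epsilon>" using K(4) d by linarith
  finally have "(LINT y|M. p (circ 1 y)) \<le> \<epsilon>" .
  moreover have "0 \<le> p (circ 1 y)" "1 \<le> p (circ 1 y) + h n (circ 1 y)" for y
    using p'[of y] h_bound[of n "circ 1 y"] by linarith+
  moreover have "(LINT y|lebesgue01. h n (circ 1 y)) \<le> \<epsilon>" using n d by linarith
  ultimately show ?thesis
    using that[of p "\<lambda>y. h n (circ 1 y)"] p(1) h_borel h_bound by blast
qed

end

context herglotz_measure
begin

lemma poisson_bdd_borel:
  assumes "0 \<le> r" "r < 1"
  shows "bdd_borel (\<lambda>y. Re (herglotz_fun (of_real r * circ 1 y)))"
  unfolding herglotz_fun_on_circle[OF assms]
  by (intro bdd_borel_Re bdd_borel_series_on_circle[OF norm_herglotz_coeff assms])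

text \<open>
  The Poisson integrals converge weakly to the measure. For trigonometric polynomials this
  is a statement about finitely many Fourier coefficients.
\<close>

lemma poisson_limit:
  assumes "trig_poly q"
  shows "((\<lambda>r. LINT y|lebesgue01. q y * of_real (Re (herglotz_fun (of_real r * circ 1 y)))) \<longlongrightarrow>
    (LINT y|M. q y)) (at_left 1)"
  using assms
proof (induction rule: trig_poly.induct)
  case (monomial a j)
  have "((\<lambda>r. a * (moment M j * of_real r ^ nat \<bar>j\<bar>)) \<longlongrightarrow> a * (moment M j * of_real 1 ^ nat \<bar>j\<bar>)) (at_left 1)"
    by (intro tendsto_intros)
  moreover have "eventually (\<lambda>r::real. r \<in> {0<..<1}) (at_left 1)"
    by (rule eventually_at_left_real) simp
  then have "eventually (\<lambda>r. a * (moment M j * of_real r ^ nat \<bar>j\<bar>) =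
      (LINT y|lebesgue01. a * circ j y * of_real (Re (herglotz_fun (of_real r * circ 1 y))))) (at_left 1)"
    by eventually_elim (simp add: poisson_coeff mult.assoc)
  ultimately show ?case
    by (simp add: filterlim_cong)
next
  case (add p q)
  have "eventually (\<lambda>r::real. r \<in> {0<..<1}) (at_left 1)"
    by (rule eventually_at_left_real) simp
  then have ev: "eventually (\<lambda>r.
      (LINT y|lebesgue01. p y * of_real (Re (herglotz_fun (of_real r * circ 1 y))))
      + (LINT y|lebesgue01. q y * of_real (Re (herglotz_fun (of_real r * circ 1 y))))
      = (LINT y|lebesgue01. (p y + q y) * of_real (Re (herglotz_fun (of_real r * circ 1 y))))) (at_left 1)"
  proof eventually_elim
    case (elim r)
    obtain B where B: "(\<lambda>y. Re (herglotz_fun (of_real r * circ 1 y))) \<in> borel_measurable borel"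
      "\<And>y. norm (Re (herglotz_fun (of_real r * circ 1 y))) \<le> B"
      using bdd_borelD[OF poisson_bdd_borel[of r]] elim by (metis greaterThanLessThan_iff less_imp_le)
    then have H: "bdd_borel (\<lambda>y. of_real (Re (herglotz_fun (of_real r * circ 1 y))) :: complex)"
      by (intro bdd_borelI[where B = B]) auto
    then show ?case
      unfolding distrib_right using add.hyps
      by (intro Bochner_Integration.integral_add[symmetric] leb.integrable_bdd_borel
          bdd_borel_mult[OF bdd_borel_trig_poly H])
  qed
  have "(LINT y|M. p y + q y) = (LINT y|M. p y) + (LINT y|M. q y)"
    using add.hyps
    by (intro Bochner_Integration.integral_add integrable_bdd_borel bdd_borel_trig_poly)
  then show ?case
    using Lim_transform_eventually[OF tendsto_add[OF add.IH] ev] by simp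
qed

lemma suminf_bc_le: "(\<Sum>n. (cmod (bc n))\<^sup>2) \<le> 1"
proof (rule suminf_le_const[OF summable_bc])
  show "(\<Sum>n<N. (cmod (bc n))\<^sup>2) \<le> 1" for N
    by (cases N) (use sum_bc_le in \<open>auto simp: lessThan_Suc_atMost simp del: sum.lessThan_Suc\<close>)
qed

text \<open>
  With \<open>p\<close> and \<open>\<phi>\<close> as in \<open>singular_obtain_polynomial\<close>, the defect \<open>1 - |b|\<^sup>2\<close> on a circle of radius
  \<open>r\<close> is at most \<open>p\<close> times four times the Poisson integral, plus \<open>\<phi>\<close>. As \<open>r \<rightarrow> 1\<close> the
  integral of the first summand tends to four times the integral of \<open>p\<close> against the
  measure, which is small, too.
\<close>

theorem singular_imp_norm_b_1:
  assumes "singular_measure M"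
  shows "(\<lambda>n. (cmod (bc n))\<^sup>2) sums 1"
proof -
  define S where "S = (\<Sum>n. (cmod (bc n))\<^sup>2)"
  have "1 - S \<le> 0 + \<epsilon>" if eps: "0 < \<epsilon>" for \<epsilon>
  proof -
    obtain p \<phi> where p: "real_polynomial_function p" and \<phi>: "bdd_borel \<phi>"
      and pos: "\<And>y. 0 \<le> p (circ 1 y)" "\<And>y. 0 \<le> \<phi> y" and ge: "\<And>y. 1 \<le> p (circ 1 y) + \<phi> y"
      and small: "(LINT y|M. p (circ 1 y)) \<le> \<epsilon> / 5" "(LINT y|lebesgue01. \<phi> y) \<le> \<epsilon> / 5"
      by (rule singular_obtain_polynomial[OF assms, of "\<epsilon> / 5"]) (use eps in auto)
    let ?w = "\<lambda>r y. complex_of_real r * circ 1 y"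
    let ?P = "\<lambda>r y. p (circ 1 y) * Re (herglotz_fun (?w r y))"
    have q: "trig_poly (\<lambda>y. of_real (p (circ 1 y)))"
      by (rule trig_poly_of_real_polynomial[OF p])
    have p_borel: "bdd_borel (\<lambda>y. p (circ 1 y))"
      using bdd_borel_Re[OF bdd_borel_trig_poly[OF q]] by simp
    have "((\<lambda>r. LINT y|lebesgue01. of_real (?P r y)) \<longlongrightarrow> (LINT y|M. complex_of_real (p (circ 1 y)))) (at_left 1)"
      using poisson_limit[OF q] by (simp only: of_real_mult)
    then have lim: "((\<lambda>r. LINT y|lebesgue01. ?P r y) \<longlongrightarrow> (LINT y|M. p (circ 1 y))) (at_left 1)"
      unfolding integral_complex_of_real tendsto_of_real_iff .
    have "1 - S \<le> 4 * (LINT y|lebesgue01. ?P r y) + (LINT y|lebesgue01. \<phi> y)" if r: "0 \<le> r" "r < 1" for r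
    proof -
      have bS: "bdd_borel (\<lambda>y. (cmod (b (?w r y)))\<^sup>2)"
      proof -
        have "bdd_borel (\<lambda>y. Re (series_on_circle bc r y * cnj (series_on_circle bc r y)))"
          by (intro bdd_borel_Re bdd_borel_intros bdd_borel_series_on_circle[OF norm_bc_le r])
        then show ?thesis
          by (simp only: b_on_circle[OF r] complex_norm_square[symmetric] of_real_power[symmetric] Re_complex_of_real)
      qed
      have "(LINT y|lebesgue01. (cmod (b (?w r y)))\<^sup>2) \<le> S"
      proof -
        have *: "(\<lambda>n. (cmod (bc n))\<^sup>2 * r ^ (2 * n)) sums (LINT y|lebesgue01. (cmod (b (?w r y)))\<^sup>2)"
          using series_on_circle_parseval[OF norm_bc_le r] by (simp only: b_on_circle[OF r])
        show ?thesis
          unfolding S_def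
          by (rule sums_le[OF _ * summable_sums[OF summable_bc]])
             (use r in \<open>auto intro!: mult_left_le power_le_one\<close>)
      qed
      then have "1 - S \<le> (LINT y|lebesgue01. 1 - (cmod (b (?w r y)))\<^sup>2)"
        by (subst Bochner_Integration.integral_diff)
           (auto simp: leb.prob_space intro: leb.integrable_bdd_borel[OF bS])
      also have "\<dots> \<le> (LINT y|lebesgue01. 4 * ?P r y + \<phi> y)"
      proof (rule integral_mono)
        show "integrable lebesgue01 (\<lambda>y. 1 - (cmod (b (?w r y)))\<^sup>2)"
          by (intro Bochner_Integration.integrable_diff leb.integrable_bdd_borel[OF bS]) simp
        show "integrable lebesgue01 (\<lambda>y. 4 * ?P r y + \<phi> y)"
          by (intro leb.integrable_bdd_borel bdd_borel_intros p_borel \<phi> poisson_bdd_borel r)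
        fix y
        have w: "cmod (?w r y) < 1" using norm_r_circ[OF r(1)] r(2) by simp
        let ?F = "1 - (cmod (b (?w r y)))\<^sup>2"
        have F: "0 \<le> ?F" "?F \<le> 1" using b_le[of "?w r y"] w by (auto simp: power_le_one)
        have "?F \<le> ?F * (p (circ 1 y) + \<phi> y)"
          using mult_left_mono[OF ge[of y] F(1)] by simp
        also have "\<dots> = p (circ 1 y) * ?F + ?F * \<phi> y" by (simp add: algebra_simps)
        also have "\<dots> \<le> p (circ 1 y) * (4 * Re (herglotz_fun (?w r y))) + 1 * \<phi> y"
          by (intro add_mono mult_left_mono mult_right_mono one_minus_norm_b w pos F)
        finally show "?F \<le> 4 * ?P r y + \<phi> y" by (simp add: mult_ac)
      qed
      also have "\<dots> = 4 * (LINT y|lebesgue01. ?P r y) + (LINT y|lebesgue01. \<phi> y)"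
        by (subst Bochner_Integration.integral_add)
           (auto intro!: leb.integrable_bdd_borel bdd_borel_mult p_borel \<phi> poisson_bdd_borel r)
      finally show ?thesis .
    qed
    moreover have "eventually (\<lambda>r::real. r \<in> {0<..<1}) (at_left 1)"
      by (rule eventually_at_left_real) simp
    ultimately have ev: "eventually (\<lambda>r. 1 - S \<le> 4 * (LINT y|lebesgue01. ?P r y) + (LINT y|lebesgue01. \<phi> y)) (at_left 1)"
      by (auto elim!: eventually_mono)
    have "((\<lambda>r. 4 * (LINT y|lebesgue01. ?P r y) + (LINT y|lebesgue01. \<phi> y)) \<longlongrightarrow>
        4 * (LINT y|M. p (circ 1 y)) + (LINT y|lebesgue01. \<phi> y)) (at_left 1)"
      by (intro tendsto_intros lim)
    then have "1 - S \<le> 4 * (LINT y|M. p (circ 1 y)) + (LINT y|lebesgue01. \<phi> y)"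
      by (rule tendsto_lowerbound[OF _ ev]) simp
    then show ?thesis using small by linarith
  qed
  then have "1 - S \<le> 0" by (rule field_le_epsilon)
  then have "S = 1" using suminf_bc_le by (simp add: S_def)
  then show ?thesis using summable_bc by (simp add: S_def sums_iff)
qed

end

section \<open>Orthogonality relations for the Gram matrix\<close>

context herglotz_measure
begin

text \<open>
  The inner product of two shifts at distance \<open>d\<close> is the autocorrelation of the Taylor
  coefficients of \<open>b\<close> at lag \<open>d\<close>. The entries on the \<open>d\<close>-th diagonal of the Gram matrix are
  \<open>1\<close> or \<open>0\<close>, according to whether \<open>d = 0\<close>, minus the partial sums of that autocorrelation. They
  tend to \<open>0\<close> by the Cauchy-Schwarz inequality, because the norms of the auxiliary sequence do.
\<close>

lemma shift_orthonormal:
  assumes "singular_measure M"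
  shows "(\<lambda>m. shift j m * cnj (shift k m)) sums (if j = k then 1 else 0)"
proof -
  have corr: "(\<lambda>i. bc (i + d) * cnj (bc i)) sums (if d = 0 then 1 else 0)" for d
  proof -
    have nsq_lim: "(\<lambda>n. nsq M (aux n)) \<longlonglongrightarrow> 0"
    proof -
      have "(\<lambda>n. \<Sum>j\<le>n. (cmod (bc j))\<^sup>2) \<longlonglongrightarrow> 1"
        using singular_imp_norm_b_1[OF assms] by (simp add: sums_def_le)
      from tendsto_diff[OF tendsto_const[of 1] this] show ?thesis
        by (simp add: nsq_aux)
    qed
    have "(\<lambda>n. gram n (n + d)) \<longlonglongrightarrow> 0"
    proof (rule Lim_null_comparison)
      have "cmod (gram n (n + d)) \<le> sqrt (nsq M (aux n))" for n
      proof -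
        have "0 \<le> (\<Sum>j\<le>n + d. (cmod (bc j))\<^sup>2)" by (intro sum_nonneg) auto
        then have "sqrt (nsq M (aux (n + d))) \<le> 1"
          by (simp add: nsq_aux)
        then have "sqrt (nsq M (aux n)) * sqrt (nsq M (aux (n + d))) \<le> sqrt (nsq M (aux n)) * 1"
          using nsq_nonneg by (intro mult_left_mono) auto
        then show ?thesis
          using ip_Cauchy_Schwarz[OF aux_bdd_borel[of n] aux_bdd_borel[of "n + d"]]
          by (simp add: gram_def)
      qed
      then show "eventually (\<lambda>n. norm (gram n (n + d)) \<le> sqrt (nsq M (aux n))) sequentially"
        by simp
      show "(\<lambda>n. sqrt (nsq M (aux n))) \<longlonglongrightarrow> 0"
        using tendsto_real_sqrt[OF nsq_lim] by simp
    qed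
    moreover have "gram n (n + d) = (if d = 0 then 1 else 0) - (\<Sum>i\<le>n. bc (i + d) * cnj (bc i))" for n
    proof -
      have "(\<Sum>j\<le>n. cnj (shift j n) * shift j (n + d)) = (\<Sum>i\<le>n. bc (i + d) * cnj (bc i))"
        by (rule sum.reindex_bij_witness[where i = "\<lambda>k. n - k" and j = "\<lambda>k. n - k"])
           (auto simp: shift_def mult.commute)
      then show ?thesis by (simp add: gram_eq)
    qed
    ultimately have "(\<lambda>n. (if d = 0 then 1 else 0) - (\<Sum>i\<le>n. bc (i + d) * cnj (bc i))) \<longlonglongrightarrow> 0"
      by simp
    from tendsto_diff[OF tendsto_const[of "if d = 0 then 1 else 0"] this]
    show ?thesis by (simp add: sums_def_le)
  qed
  have le: "(\<lambda>m. shift j m * cnj (shift k m)) sums (if j = k then 1 else 0)" if "j \<le> k" for j k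
  proof -
    have "(\<lambda>i. shift j (i + k) * cnj (shift k (i + k))) sums (if k - j = 0 then 1 else 0)"
      using corr[of "k - j"] that by (simp add: shift_def)
    then have "(\<lambda>m. shift j m * cnj (shift k m)) sums (if k - j = 0 then 1 else 0)"
      by (subst sums_zero_iff_shift[symmetric, of k]) (auto simp: shift_def)
    then show ?thesis using that by auto
  qed
  show ?thesis
  proof (cases "j \<le> k")
    case False
    then have "(\<lambda>m. cnj (shift k m * cnj (shift j m))) sums cnj (if k = j then 1 else 0)"
      unfolding sums_cnj by (intro le) simp
    then show ?thesis using False by (auto simp: mult.commute)
  qed (rule le)
qed

lemma bc_lebesgue:
  assumes "M = lebesgue01" shows "bc n = 0"
proof (cases n)
  case (Suc m)
  have "(\<Sum>k<n. bc k * cnj (moment M (int (n - k)))) = 0"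
    by (intro sum.neutral) (auto simp: assms moment_lebesgue01)
  then show ?thesis
    using bc_recursion[of n] Suc by (simp add: assms moment_lebesgue01)
qed simp

lemma shift_combination_norm_le:
  assumes "singular_measure M \<or> M = lebesgue01" "finite I"
  shows "(\<Sum>m<N. (cmod (\<Sum>k\<in>I. a k * shift k m))\<^sup>2) \<le> (\<Sum>k\<in>I. (cmod (a k))\<^sup>2)"
  using assms(1)
proof
  assume "M = lebesgue01"
  then have "shift k m = 0" for k m by (simp add: shift_def bc_lebesgue)
  then show ?thesis by (simp add: sum_nonneg)
next
  assume sing: "singular_measure M"
  have "(\<lambda>m. \<Sum>k\<in>I. \<Sum>l\<in>I. a k * cnj (a l) * (shift k m * cnj (shift l m))) sums
      (\<Sum>k\<in>I. \<Sum>l\<in>I. a k * cnj (a l) * (if k = l then 1 else 0))"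
    by (intro sums_sum sums_mult shift_orthonormal sing)
  moreover have "(\<Sum>k\<in>I. \<Sum>l\<in>I. a k * cnj (a l) * (shift k m * cnj (shift l m)))
      = of_real ((cmod (\<Sum>k\<in>I. a k * shift k m))\<^sup>2)" for m
    unfolding complex_norm_square cnj_sum sum_product
    by (intro sum.cong refl) (simp add: mult_ac)
  moreover have "(\<Sum>k\<in>I. \<Sum>l\<in>I. a k * cnj (a l) * (if k = l then 1 else 0))
      = of_real (\<Sum>k\<in>I. (cmod (a k))\<^sup>2)"
  proof -
    have "(\<Sum>l\<in>I. a k * cnj (a l) * (if k = l then 1 else 0)) = a k * cnj (a k)" if "k \<in> I" for k
      using assms(2) that by (simp add: if_distrib sum.delta cong: if_cong)
    then show ?thesis unfolding of_real_sum complex_norm_square by (intro sum.cong refl)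
  qed
  ultimately have *: "(\<lambda>m. (cmod (\<Sum>k\<in>I. a k * shift k m))\<^sup>2) sums (\<Sum>k\<in>I. (cmod (a k))\<^sup>2)"
    by (simp only: sums_of_real_iff)
  show ?thesis
    unfolding sums_unique[OF *] by (rule sum_le_suminf[OF sums_summable[OF *]]) auto
qed

text \<open>
  When \<open>T\<close> is an isometry, \<open>1 - T T\<^sup>*\<close> is the projection onto the complement of the range
  of \<open>T\<close>, so its rows are orthogonal to that range. For Lebesgue measure \<open>T = 0\<close>.
\<close>

lemma gram_orthogonal_shift:
  assumes "singular_measure M \<or> M = lebesgue01"
  shows "(\<lambda>m. gram n m * cnj (shift k m)) sums 0"
  using assms
proof
  assume "M = lebesgue01"
  then have "shift k m = 0" for m by (simp add: shift_def bc_lebesgue)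
  then show ?thesis by simp
next
  assume sing: "singular_measure M"
  have "(\<lambda>m. if m = n then cnj (shift k m) else 0) sums cnj (shift k n)"
    by (rule sums_single)
  moreover have "(\<lambda>m. \<Sum>j\<le>n. cnj (shift j n) * (shift j m * cnj (shift k m))) sums
      (\<Sum>j\<le>n. cnj (shift j n) * (if j = k then 1 else 0))"
    by (intro sums_sum sums_mult shift_orthonormal sing)
  ultimately have "(\<lambda>m. (if m = n then cnj (shift k m) else 0)
      - (\<Sum>j\<le>n. cnj (shift j n) * (shift j m * cnj (shift k m)))) sums
      (cnj (shift k n) - (\<Sum>j\<le>n. cnj (shift j n) * (if j = k then 1 else 0)))"
    by (rule sums_diff)
  moreover have "(\<Sum>j\<le>n. cnj (shift j n) * (if j = k then 1 else 0)) = cnj (shift k n)"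
  proof (cases "k \<le> n")
    case True
    then show ?thesis by (simp add: if_distrib sum.delta cong: if_cong)
  next
    case False
    then show ?thesis by (auto simp: shift_def intro!: sum.neutral)
  qed
  moreover have "(if m = n then cnj (shift k m) else 0)
      - (\<Sum>j\<le>n. cnj (shift j n) * (shift j m * cnj (shift k m))) = gram n m * cnj (shift k m)" for m
    by (auto simp: gram_eq left_diff_distrib sum_distrib_right mult.assoc)
  ultimately show ?thesis by simp
qed

text \<open>
  A projection \<open>P\<close> satisfies \<open>P P\<^sup>* = P\<close>; on the diagonal this gives the norms of the rows.
\<close>

lemma gram_row_norm:
  assumes "singular_measure M \<or> M = lebesgue01"
  shows "(\<lambda>m. (cmod (gram n m))\<^sup>2) sums nsq M (aux n)"
proof -
  have "(\<lambda>m. if m = n then gram n m else 0) sums gram n n"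
    by (rule sums_single)
  moreover have "(\<lambda>m. \<Sum>j\<le>n. shift j n * (gram n m * cnj (shift j m))) sums (\<Sum>j\<le>n. shift j n * 0)"
    by (intro sums_sum sums_mult gram_orthogonal_shift assms)
  ultimately have "(\<lambda>m. (if m = n then gram n m else 0)
      - (\<Sum>j\<le>n. shift j n * (gram n m * cnj (shift j m)))) sums (gram n n - (\<Sum>j\<le>n. shift j n * 0))"
    by (rule sums_diff)
  moreover have "(if m = n then gram n m else 0) - (\<Sum>j\<le>n. shift j n * (gram n m * cnj (shift j m)))
      = of_real ((cmod (gram n m))\<^sup>2)" for m
  proof -
    have "of_real ((cmod (gram n m))\<^sup>2) = gram n m * cnj (gram n m)"
      by (rule complex_norm_square)
    also have "cnj (gram n m) = (if n = m then 1 else 0) - (\<Sum>j\<le>n. shift j n * cnj (shift j m))"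
      by (simp add: gram_eq[of n m])
    finally show ?thesis
      by (simp add: right_diff_distrib sum_distrib_left mult_ac if_distrib cong: if_cong)
  qed
  moreover have "gram n n = of_real (nsq M (aux n))"
    unfolding gram_def by (rule ip_self)
  ultimately have "(\<lambda>m. complex_of_real ((cmod (gram n m))\<^sup>2)) sums of_real (nsq M (aux n))"
    by simp
  then show ?thesis by (simp only: sums_of_real_iff)
qed

text \<open>
  This is \<open>1 - T T\<^sup>* \<le> 1\<close>, tested on a finitely supported vector.
\<close>

lemma nsq_sum_aux_le:
  assumes "finite I"
  shows "nsq M (\<lambda>y. \<Sum>n\<in>I. h n * aux n y) \<le> (\<Sum>n\<in>I. (cmod (h n))\<^sup>2)"
proof -
  obtain L where L: "I \<subseteq> {..L}"
    using assms finite_nat_iff_bounded_le by blast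
  have gram_L: "gram n m = (if n = m then 1 else 0) - (\<Sum>j\<le>L. cnj (shift j n) * shift j m)" if "n \<in> I" for n m
  proof -
    have "(\<Sum>j\<le>L. cnj (shift j n) * shift j m) = (\<Sum>j\<le>n. cnj (shift j n) * shift j m)"
      using that L by (intro sum.mono_neutral_right) (auto simp: shift_def)
    then show ?thesis by (simp add: gram_eq)
  qed
  have "ip M (\<lambda>y. \<Sum>n\<in>I. h n * aux n y) (\<lambda>y. \<Sum>n\<in>I. h n * aux n y)
      = (\<Sum>n\<in>I. \<Sum>m\<in>I. h n * (cnj (h m) * gram n m))"
    by (simp add: ip_sum_left ip_sum_right ip_scale_left ip_scale_right bdd_borel_intros
        gram_def sum_distrib_left)
  also have "\<dots> = (\<Sum>n\<in>I. \<Sum>m\<in>I. h n * cnj (h m) * (if n = m then 1 else 0))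
      - (\<Sum>n\<in>I. \<Sum>m\<in>I. \<Sum>j\<le>L. (h n * cnj (shift j n)) * (cnj (h m * cnj (shift j m))))"
    by (simp add: gram_L right_diff_distrib sum_subtractf sum_distrib_left mult_ac cong: if_cong)
  also have "(\<Sum>n\<in>I. \<Sum>m\<in>I. h n * cnj (h m) * (if n = m then 1 else 0)) = of_real (\<Sum>n\<in>I. (cmod (h n))\<^sup>2)"
  proof -
    have "(\<Sum>m\<in>I. h n * cnj (h m) * (if n = m then 1 else 0)) = h n * cnj (h n)" if "n \<in> I" for n
      using assms that by (simp add: if_distrib sum.delta cong: if_cong)
    then show ?thesis unfolding of_real_sum complex_norm_square by (intro sum.cong refl)
  qed
  also have "(\<Sum>n\<in>I. \<Sum>m\<in>I. \<Sum>j\<le>L. (h n * cnj (shift j n)) * (cnj (h m * cnj (shift j m))))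
      = of_real (\<Sum>j\<le>L. (cmod (\<Sum>n\<in>I. h n * cnj (shift j n)))\<^sup>2)"
  proof -
    have "(\<Sum>n\<in>I. \<Sum>m\<in>I. \<Sum>j\<le>L. (h n * cnj (shift j n)) * (cnj (h m * cnj (shift j m))))
        = (\<Sum>n\<in>I. \<Sum>j\<le>L. \<Sum>m\<in>I. (h n * cnj (shift j n)) * (cnj (h m * cnj (shift j m))))"
      by (intro sum.cong refl sum.swap)
    also have "\<dots> = (\<Sum>j\<le>L. \<Sum>n\<in>I. \<Sum>m\<in>I. (h n * cnj (shift j n)) * (cnj (h m * cnj (shift j m))))"
      by (rule sum.swap)
    finally show ?thesis
      unfolding of_real_sum complex_norm_square cnj_sum sum_product .
  qed
  finally have "nsq M (\<lambda>y. \<Sum>n\<in>I. h n * aux n y)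
      = (\<Sum>n\<in>I. (cmod (h n))\<^sup>2) - (\<Sum>j\<le>L. (cmod (\<Sum>n\<in>I. h n * cnj (shift j n)))\<^sup>2)"
    by (simp only: of_real_diff[symmetric] Re_complex_of_real)
  moreover have "0 \<le> (\<Sum>j\<le>L. (cmod (\<Sum>n\<in>I. h n * cnj (shift j n)))\<^sup>2)"
    by (intro sum_nonneg) simp
  ultimately show ?thesis by linarith
qed

end

section \<open>Square-summable sequences and the Hardy space\<close>

lemma norm_add_squared_le: "(norm (x + y :: complex))\<^sup>2 \<le> 2 * (norm x)\<^sup>2 + 2 * (norm y)\<^sup>2"
proof -
  have "(norm (x + y))\<^sup>2 \<le> (norm x + norm y)\<^sup>2"
    by (intro power_mono norm_triangle_ineq) simp
  also have "\<dots> \<le> 2 * (norm x)\<^sup>2 + 2 * (norm y)\<^sup>2"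
    using zero_le_power2[of "norm x - norm y"] by (simp add: power2_eq_square algebra_simps)
  finally show ?thesis .
qed

lemma sum_norm_add_squared_le:
  "(\<Sum>n\<in>I. (cmod (a n + c n))\<^sup>2) \<le> 2 * (\<Sum>n\<in>I. (cmod (a n))\<^sup>2) + 2 * (\<Sum>n\<in>I. (cmod (c n))\<^sup>2)"
  unfolding sum_distrib_left sum.distrib[symmetric] by (intro sum_mono norm_add_squared_le)

lemma summable_inner_l2:
  assumes "summable (\<lambda>n. (cmod (a n))\<^sup>2)" "summable (\<lambda>n. (cmod (c n))\<^sup>2)"
  shows "summable (\<lambda>n. a n * cnj (c n))"
proof (rule summable_comparison_test'[where N = 0])
  show "summable (\<lambda>n. (cmod (a n))\<^sup>2 + (cmod (c n))\<^sup>2)"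
    by (intro summable_add assms)
  show "norm (a n * cnj (c n)) \<le> (cmod (a n))\<^sup>2 + (cmod (c n))\<^sup>2" for n
  proof -
    have "2 * (cmod (a n) * cmod (c n)) \<le> (cmod (a n))\<^sup>2 + (cmod (c n))\<^sup>2"
      using zero_le_power2[of "cmod (a n) - cmod (c n)"] by (simp add: power2_eq_square algebra_simps)
    moreover have "0 \<le> cmod (a n) * cmod (c n)" by simp
    ultimately show ?thesis unfolding norm_mult complex_mod_cnj by linarith
  qed
qed

lemma orthogonal_l2_limit:
  assumes t: "summable (\<lambda>n. (cmod (t n))\<^sup>2)" and v: "summable (\<lambda>n. (cmod (v n))\<^sup>2)"
    and approx: "\<And>\<epsilon>. 0 < \<epsilon> \<Longrightarrow>
      \<exists>w. (\<lambda>n. t n * cnj (w n)) sums 0 \<and> (\<forall>N. (\<Sum>n<N. (cmod (v n - w n))\<^sup>2) \<le> \<epsilon>)"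
  shows "(\<lambda>n. t n * cnj (v n)) sums 0"
proof -
  define T where "T = (\<Sum>n. (cmod (t n))\<^sup>2)"
  define I where "I = (\<Sum>n. t n * cnj (v n))"
  have I: "(\<lambda>n. t n * cnj (v n)) sums I"
    unfolding I_def by (intro summable_sums summable_inner_l2 t v)
  have T0: "0 \<le> T" unfolding T_def by (intro suminf_nonneg t) simp
  have "cmod I \<le> 0 + \<delta>" if \<delta>: "0 < \<delta>" for \<delta>
  proof -
    have "0 < \<delta>\<^sup>2 / (T + 1)" using \<delta> T0 by simp
    then obtain w where w: "(\<lambda>n. t n * cnj (w n)) sums 0"
      and le: "\<And>N. (\<Sum>n<N. (cmod (v n - w n))\<^sup>2) \<le> \<delta>\<^sup>2 / (T + 1)"
      using approx by blast
    have "(\<lambda>n. t n * cnj (v n) - t n * cnj (w n)) sums (I - 0)"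
      by (intro sums_diff I w)
    then have "(\<lambda>N. cmod (\<Sum>n<N. t n * cnj (v n) - t n * cnj (w n))) \<longlonglongrightarrow> cmod (I - 0)"
      unfolding sums_def by (rule tendsto_norm)
    moreover have "cmod (\<Sum>n<N. t n * cnj (v n) - t n * cnj (w n)) \<le> \<delta>" for N
    proof -
      have "cmod (\<Sum>n<N. t n * cnj (v n) - t n * cnj (w n)) \<le> (\<Sum>n<N. \<bar>cmod (t n)\<bar> * \<bar>cmod (v n - w n)\<bar>)"
        by (intro order_trans[OF norm_sum] sum_mono)
           (simp add: right_diff_distrib[symmetric] norm_mult flip: complex_cnj_diff)
      also have "\<dots> \<le> L2_set (\<lambda>n. cmod (t n)) {..<N} * L2_set (\<lambda>n. cmod (v n - w n)) {..<N}"
        by (rule L2_set_mult_ineq)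
      also have "\<dots> \<le> sqrt T * sqrt (\<delta>\<^sup>2 / (T + 1))"
      proof (intro mult_mono)
        have "(\<Sum>n<N. (cmod (t n))\<^sup>2) \<le> T"
          unfolding T_def by (rule sum_le_suminf[OF t]) auto
        then show "L2_set (\<lambda>n. cmod (t n)) {..<N} \<le> sqrt T"
          by (simp add: L2_set_def)
        show "L2_set (\<lambda>n. cmod (v n - w n)) {..<N} \<le> sqrt (\<delta>\<^sup>2 / (T + 1))"
          using le[of N] by (simp add: L2_set_def)
      qed (simp_all add: T0 L2_set_nonneg)
      also have "\<dots> = sqrt (T * (\<delta>\<^sup>2 / (T + 1)))"
        by (rule real_sqrt_mult[symmetric])
      also have "\<dots> \<le> sqrt (\<delta>\<^sup>2)"
        using T0 by (intro real_sqrt_le_mono) (simp add: divide_le_eq mult_right_mono algebra_simps)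
      also have "\<dots> = \<delta>" using \<delta> by simp
      finally show ?thesis .
    qed
    ultimately have "cmod (I - 0) \<le> \<delta>"
      by (intro tendsto_upperbound[where F = sequentially]) auto
    then show ?thesis by simp
  qed
  then have "cmod I \<le> 0" by (rule field_le_epsilon)
  then show ?thesis using I by simp
qed

definition power_series_fun :: "(nat \<Rightarrow> complex) \<Rightarrow> complex \<Rightarrow> complex" where
  "power_series_fun a = (\<lambda>w\<in>ball 0 1. \<Sum>n. a n * w ^ n)"

lemma power_series_fun_has_fps:
  assumes "summable (\<lambda>n. (cmod (a n))\<^sup>2)"
  shows "power_series_fun a has_fps_expansion Abs_fps a"
proof (rule has_fps_expansionI)
  have "(\<lambda>n. (cmod (a n))\<^sup>2) \<longlonglongrightarrow> 0" by (rule summable_LIMSEQ_zero[OF assms])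
  then have "Bseq (\<lambda>n. (cmod (a n))\<^sup>2)" by (intro convergent_imp_Bseq convergentI)
  then obtain B where B: "0 < B" "\<And>n. (cmod (a n))\<^sup>2 \<le> B" by (auto simp: Bseq_def)
  have bnd: "cmod (a n) \<le> sqrt B" for n
    by (rule real_le_rsqrt) (rule B)
  have "eventually (\<lambda>w::complex. w \<in> ball 0 1) (nhds 0)"
    by (intro eventually_nhds_in_open) auto
  then show "eventually (\<lambda>w. (\<lambda>n. fps_nth (Abs_fps a) n * w ^ n) sums power_series_fun a w) (nhds 0)"
  proof eventually_elim
    case (elim w)
    then have w: "cmod w < 1" by simp
    have "summable (\<lambda>n. a n * w ^ n)"
    proof (rule summable_comparison_test'[where N = 0])
      show "summable (\<lambda>n. sqrt B * cmod w ^ n)"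
        using w by (intro summable_mult summable_geometric) auto
      show "norm (a n * w ^ n) \<le> sqrt B * cmod w ^ n" for n
        using bnd[of n] by (simp add: norm_mult norm_power mult_right_mono)
    qed
    then show ?case
      using w by (simp add: power_series_fun_def summable_sums)
  qed
qed

lemma taylor_coeff_eq: "F has_fps_expansion A \<Longrightarrow> taylor_coeff F n = fps_nth A n"
  by (simp add: taylor_coeff_def fps_expansion_eqI)

lemma taylor_coeff_power_series:
  assumes "summable (\<lambda>n. (cmod (a n))\<^sup>2)"
  shows "taylor_coeff (power_series_fun a) = a"
  using taylor_coeff_eq[OF power_series_fun_has_fps[OF assms]] by auto

lemma hardy2_iff: "F \<in> hardy2 \<longleftrightarrow> (\<exists>a. summable (\<lambda>n. (cmod (a n))\<^sup>2) \<and> F = power_series_fun a)"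
  by (simp add: hardy2_def power_series_fun_def)

lemma taylor_coeff_diff:
  assumes "summable (\<lambda>n. (cmod (a n))\<^sup>2)" "summable (\<lambda>n. (cmod (c n))\<^sup>2)"
  shows "taylor_coeff (\<lambda>w. power_series_fun a w - power_series_fun c w) n = a n - c n"
proof -
  have "(\<lambda>w. power_series_fun a w - power_series_fun c w) has_fps_expansion Abs_fps a - Abs_fps c"
    by (intro fps_expansion_intros power_series_fun_has_fps assms)
  from taylor_coeff_eq[OF this] show ?thesis by simp
qed

section \<open>Continuous families in the Hardy space\<close>

lemma continuous_on_UNIV_iff_nhds:
  "continuous_on UNIV f \<longleftrightarrow> (\<forall>x. (f \<longlongrightarrow> f x) (nhds x))"
  unfolding continuous_on_def by (simp add: tendsto_at_iff_tendsto_nhds)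

lemma compact_eventually_uniform:
  fixes P :: "nat \<Rightarrow> 'x::topological_space \<Rightarrow> bool"
  assumes "compact (UNIV :: 'x set)"
    and local: "\<And>x. \<exists>M. eventually (P M) (nhds x)"
    and mono: "\<And>M M' x. P M x \<Longrightarrow> M \<le> M' \<Longrightarrow> P M' x"
  shows "\<exists>M. \<forall>x. P M x"
proof -
  have "\<forall>x. \<exists>M U. open U \<and> x \<in> U \<and> (\<forall>y\<in>U. P M y)"
    using local unfolding eventually_nhds by blast
  then obtain m U where U: "\<And>x. open (U x)" "\<And>x. x \<in> U x" "\<And>x y. y \<in> U x \<Longrightarrow> P (m x) y"
    by metis
  obtain D where D: "finite D" "UNIV \<subseteq> (\<Union>x\<in>D. U x)"
    by (rule compactE_image[OF assms(1), of UNIV U]) (use U(1,2) in auto)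
  have "P (Max (m ` D)) y" for y
  proof -
    obtain x where x: "x \<in> D" "y \<in> U x" using D(2) by blast
    then show ?thesis using D(1) by (intro mono[OF U(3)[OF x(2)]]) simp
  qed
  then show ?thesis by blast
qed

text \<open>
  On a compact space this describes the norm-continuous maps into \<open>\<ell>\<^sup>2\<close>. The description
  through uniformly small tails mentions finite sums only, and it passes to uniform limits
  without any continuity argument in the norm.
\<close>

definition uniform_l2 :: "('x::topological_space \<Rightarrow> nat \<Rightarrow> complex) \<Rightarrow> bool" where
  "uniform_l2 a \<longleftrightarrow> (\<forall>n. continuous_on UNIV (\<lambda>x. a x n)) \<and>
     (\<forall>\<epsilon>>0. \<exists>M. \<forall>x N. (\<Sum>n\<in>{M..<N}. (cmod (a x n))\<^sup>2) \<le> \<epsilon>)"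

lemma uniform_l2_tail:
  assumes "uniform_l2 a" "0 < \<epsilon>"
  obtains M where "\<And>x N. (\<Sum>n\<in>{M..<N}. (cmod (a x n))\<^sup>2) \<le> \<epsilon>"
  using assms unfolding uniform_l2_def by blast

lemma sum_lessThan_le_split:
  fixes f :: "nat \<Rightarrow> real"
  assumes "\<And>n. 0 \<le> f n"
  shows "(\<Sum>n<N. f n) \<le> (\<Sum>n<M. f n) + (\<Sum>n\<in>{M..<N}. f n)"
proof -
  have "(\<Sum>n<N. f n) \<le> (\<Sum>n\<in>{..<M} \<union> {M..<N}. f n)"
    by (intro sum_mono2) (auto simp: assms)
  also have "\<dots> = (\<Sum>n<M. f n) + (\<Sum>n\<in>{M..<N}. f n)"
    by (intro sum.union_disjoint) auto
  finally show ?thesis .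
qed

lemma uniform_l2_summable:
  assumes "uniform_l2 a" shows "summable (\<lambda>n. (cmod (a x n))\<^sup>2)"
proof -
  obtain M where M: "\<And>x N. (\<Sum>n\<in>{M..<N}. (cmod (a x n))\<^sup>2) \<le> 1"
    using uniform_l2_tail[OF assms zero_less_one] by blast
  have "(\<Sum>n<N. (cmod (a x n))\<^sup>2) \<le> (\<Sum>n<M. (cmod (a x n))\<^sup>2) + 1" for N
    using sum_lessThan_le_split[of "\<lambda>n. (cmod (a x n))\<^sup>2" N M] M[where x = x and N = N] by simp
  then show ?thesis
    by (intro bounded_imp_summable[where B = "(\<Sum>n<M. (cmod (a x n))\<^sup>2) + 1"])
       (simp_all add: lessThan_Suc_atMost[symmetric] del: sum.lessThan_Suc)
qed

lemma uniform_l2_zero: "uniform_l2 (\<lambda>x n. 0)"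
  by (auto simp: uniform_l2_def)

lemma uniform_l2_add:
  assumes "uniform_l2 a" "uniform_l2 c" shows "uniform_l2 (\<lambda>x n. a x n + c x n)"
  unfolding uniform_l2_def
proof (intro conjI allI impI)
  show "continuous_on UNIV (\<lambda>x. a x n + c x n)" for n
    using assms by (intro continuous_intros) (auto simp: uniform_l2_def)
  fix \<epsilon> :: real assume "0 < \<epsilon>"
  then have \<epsilon>: "0 < \<epsilon> / 4" by simp
  obtain M where M: "\<And>x N. (\<Sum>n\<in>{M..<N}. (cmod (a x n))\<^sup>2) \<le> \<epsilon> / 4"
    using uniform_l2_tail[OF assms(1) \<epsilon>] by blast
  obtain M' where M': "\<And>x N. (\<Sum>n\<in>{M'..<N}. (cmod (c x n))\<^sup>2) \<le> \<epsilon> / 4"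
    using uniform_l2_tail[OF assms(2) \<epsilon>] by blast
  have "(\<Sum>n\<in>{max M M'..<N}. (cmod (a x n + c x n))\<^sup>2) \<le> \<epsilon>" for x N
  proof -
    have "(\<Sum>n\<in>{max M M'..<N}. (cmod (a x n))\<^sup>2) \<le> (\<Sum>n\<in>{M..<N}. (cmod (a x n))\<^sup>2)"
      "(\<Sum>n\<in>{max M M'..<N}. (cmod (c x n))\<^sup>2) \<le> (\<Sum>n\<in>{M'..<N}. (cmod (c x n))\<^sup>2)"
      by (auto intro!: sum_mono2)
    then show ?thesis
      using M[where x = x and N = N] M'[where x = x and N = N]
        sum_norm_add_squared_le[of "a x" "c x" "{max M M'..<N}"] by linarith
  qed
  then show "\<exists>M. \<forall>x N. (\<Sum>n\<in>{M..<N}. (cmod (a x n + c x n))\<^sup>2) \<le> \<epsilon>" by blast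
qed

lemma uniform_l2_scale:
  assumes "compact (UNIV :: 'x::topological_space set)" "continuous_on UNIV c" "uniform_l2 a"
  shows "uniform_l2 (\<lambda>x::'x. \<lambda>n. c x * a x n)"
  unfolding uniform_l2_def
proof (intro conjI allI impI)
  show "continuous_on UNIV (\<lambda>x. c x * a x n)" for n
    using assms by (intro continuous_intros) (auto simp: uniform_l2_def)
  have "bounded (range c)"
    using assms by (intro compact_imp_bounded compact_continuous_image)
  then obtain B where B: "0 < B" "\<And>x. cmod (c x) \<le> B" by (auto simp: bounded_pos)
  fix \<epsilon> :: real assume "0 < \<epsilon>"
  then have "0 < \<epsilon> / B\<^sup>2" using B(1) by simp
  then obtain M where M: "\<And>x N. (\<Sum>n\<in>{M..<N}. (cmod (a x n))\<^sup>2) \<le> \<epsilon> / B\<^sup>2"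
    using uniform_l2_tail[OF assms(3)] by blast
  have "(\<Sum>n\<in>{M..<N}. (cmod (c x * a x n))\<^sup>2) \<le> \<epsilon>" for x N
  proof -
    have "(\<Sum>n\<in>{M..<N}. (cmod (c x * a x n))\<^sup>2) = (cmod (c x))\<^sup>2 * (\<Sum>n\<in>{M..<N}. (cmod (a x n))\<^sup>2)"
      by (simp add: norm_mult power_mult_distrib sum_distrib_left)
    also have "\<dots> \<le> B\<^sup>2 * (\<epsilon> / B\<^sup>2)"
      using B M by (intro mult_mono power_mono) (auto intro: sum_nonneg)
    also have "\<dots> = \<epsilon>" using B(1) by simp
    finally show ?thesis .
  qed
  then show "\<exists>M. \<forall>x N. (\<Sum>n\<in>{M..<N}. (cmod (c x * a x n))\<^sup>2) \<le> \<epsilon>" by blast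
qed

lemma uniform_l2_sum:
  assumes "\<And>i. i \<in> I \<Longrightarrow> uniform_l2 (a i)" shows "uniform_l2 (\<lambda>x n. \<Sum>i\<in>I. a i x n)"
  using assms by (induction I rule: infinite_finite_induct) (auto intro: uniform_l2_zero uniform_l2_add)

lemma uniform_l2_limit:
  assumes a: "\<And>k. uniform_l2 (a k)"
    and lim: "\<And>\<epsilon>. 0 < \<epsilon> \<Longrightarrow> \<exists>k. \<forall>x N. (\<Sum>n<N. (cmod (t x n - a k x n))\<^sup>2) \<le> \<epsilon>"
  shows "uniform_l2 t"
  unfolding uniform_l2_def
proof (intro conjI allI impI)
  fix n
  have "((\<lambda>x. t x n) \<longlongrightarrow> t x0 n) (nhds x0)" for x0
  proof (rule tendstoI)
    fix e :: real assume e: "0 < e"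
    then have "0 < (e / 3)\<^sup>2" by simp
    then obtain k where k: "\<And>x N. (\<Sum>n<N. (cmod (t x n - a k x n))\<^sup>2) \<le> (e / 3)\<^sup>2"
      using lim by blast
    have near: "cmod (t x n - a k x n) \<le> e / 3" for x
    proof -
      have "(cmod (t x n - a k x n))\<^sup>2 \<le> (\<Sum>i<Suc n. (cmod (t x i - a k x i))\<^sup>2)"
        by (rule member_le_sum) auto
      also have "\<dots> \<le> (e / 3)\<^sup>2" by (rule k)
      finally show ?thesis by (rule power2_le_imp_le) (use e in simp)
    qed
    have "((\<lambda>x. a k x n) \<longlongrightarrow> a k x0 n) (nhds x0)"
      using a[of k] by (auto simp: uniform_l2_def continuous_on_UNIV_iff_nhds)
    then have "eventually (\<lambda>x. dist (a k x n) (a k x0 n) < e / 3) (nhds x0)"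
      by (rule tendstoD) (use e in simp)
    then show "eventually (\<lambda>x. dist (t x n) (t x0 n) < e) (nhds x0)"
    proof eventually_elim
      case (elim x)
      have "t x n - t x0 n = (t x n - a k x n) + (a k x n - a k x0 n) - (t x0 n - a k x0 n)" by simp
      then have "cmod (t x n - t x0 n) \<le> cmod (t x n - a k x n) + cmod (a k x n - a k x0 n) + cmod (t x0 n - a k x0 n)"
        by (metis (no_types, lifting) norm_triangle_ineq norm_triangle_ineq4 order_trans add_right_mono)
      then show ?case
        using near[of x] near[of x0] elim by (simp add: dist_norm)
    qed
  qed
  then show "continuous_on UNIV (\<lambda>x. t x n)"
    by (simp add: continuous_on_UNIV_iff_nhds)
next
  fix \<epsilon> :: real assume "0 < \<epsilon>"
  then have \<epsilon>: "0 < \<epsilon> / 4" by simp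
  obtain k where k: "\<And>x N. (\<Sum>n<N. (cmod (t x n - a k x n))\<^sup>2) \<le> \<epsilon> / 4"
    using lim[OF \<epsilon>] by blast
  obtain M where M: "\<And>x N. (\<Sum>n\<in>{M..<N}. (cmod (a k x n))\<^sup>2) \<le> \<epsilon> / 4"
    using uniform_l2_tail[OF a \<epsilon>] by blast
  have "(\<Sum>n\<in>{M..<N}. (cmod (t x n))\<^sup>2) \<le> \<epsilon>" for x N
  proof -
    have "(\<Sum>n\<in>{M..<N}. (cmod (t x n - a k x n))\<^sup>2) \<le> (\<Sum>n<N. (cmod (t x n - a k x n))\<^sup>2)"
      by (intro sum_mono2) auto
    then show ?thesis
      using k[where x = x and N = N] M[where x = x and N = N]
        sum_norm_add_squared_le[of "\<lambda>n. t x n - a k x n" "a k x" "{M..<N}"] \<open>0 < \<epsilon>\<close> by simp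
  qed
  then show "\<exists>M. \<forall>x N. (\<Sum>n\<in>{M..<N}. (cmod (t x n))\<^sup>2) \<le> \<epsilon>" by blast
qed

text \<open>This is Dini's theorem for the partial sums of the squared norms.\<close>

lemma uniform_l2_if_norm_continuous:
  assumes "compact (UNIV :: 'x::topological_space set)"
    and a: "\<And>n. continuous_on UNIV (\<lambda>x::'x. a x n)"
    and s: "\<And>x. (\<lambda>n. (cmod (a x n))\<^sup>2) sums s x" "continuous_on UNIV s"
  shows "uniform_l2 a"
  unfolding uniform_l2_def
proof (intro conjI allI impI a)
  fix \<epsilon> :: real assume \<epsilon>: "0 < \<epsilon>"
  show "\<exists>M. \<forall>x N. (\<Sum>n\<in>{M..<N}. (cmod (a x n))\<^sup>2) \<le> \<epsilon>"
  proof (rule compact_eventually_uniform[OF assms(1)])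
    fix M M' x assume *: "\<forall>N. (\<Sum>n\<in>{M..<N}. (cmod (a x n))\<^sup>2) \<le> \<epsilon>" "M \<le> M'"
    have "(\<Sum>n\<in>{M'..<N}. (cmod (a x n))\<^sup>2) \<le> (\<Sum>n\<in>{M..<N}. (cmod (a x n))\<^sup>2)" for N
      using *(2) by (intro sum_mono2) auto
    then show "\<forall>N. (\<Sum>n\<in>{M'..<N}. (cmod (a x n))\<^sup>2) \<le> \<epsilon>" using *(1) order_trans by blast
  next
    fix x0
    have "eventually (\<lambda>M. s x0 - \<epsilon> < (\<Sum>n<M. (cmod (a x0 n))\<^sup>2)) sequentially"
      using s(1)[of x0] \<epsilon> unfolding sums_def by (intro order_tendstoD(1)) auto
    then obtain M where M: "s x0 - (\<Sum>n<M. (cmod (a x0 n))\<^sup>2) < \<epsilon>"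
      by (auto simp: eventually_sequentially algebra_simps)
    have "continuous_on UNIV (\<lambda>x. s x - (\<Sum>n<M. (cmod (a x n))\<^sup>2))"
      by (intro continuous_intros a s)
    then have "((\<lambda>x. s x - (\<Sum>n<M. (cmod (a x n))\<^sup>2)) \<longlongrightarrow> s x0 - (\<Sum>n<M. (cmod (a x0 n))\<^sup>2)) (nhds x0)"
      unfolding continuous_on_UNIV_iff_nhds by blast
    then have "eventually (\<lambda>x. s x - (\<Sum>n<M. (cmod (a x n))\<^sup>2) < \<epsilon>) (nhds x0)"
      by (rule order_tendstoD(2)) (rule M)
    then have "eventually (\<lambda>x. \<forall>N. (\<Sum>n\<in>{M..<N}. (cmod (a x n))\<^sup>2) \<le> \<epsilon>) (nhds x0)"
    proof eventually_elim
      case (elim x)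
      show ?case
      proof
        fix N
        have "(\<Sum>n\<in>{M..<N}. (cmod (a x n))\<^sup>2) + (\<Sum>n<M. (cmod (a x n))\<^sup>2) = (\<Sum>n\<in>{M..<N} \<union> {..<M}. (cmod (a x n))\<^sup>2)"
          by (rule sum.union_disjoint[symmetric]) auto
        also have "\<dots> \<le> s x"
          unfolding sums_unique[OF s(1)] by (rule sum_le_suminf[OF sums_summable[OF s(1)]]) auto
        finally show "(\<Sum>n\<in>{M..<N}. (cmod (a x n))\<^sup>2) \<le> \<epsilon>" using elim by linarith
      qed
    qed
    then show "\<exists>M. eventually (\<lambda>x. \<forall>N. (\<Sum>n\<in>{M..<N}. (cmod (a x n))\<^sup>2) \<le> \<epsilon>) (nhds x0)" by blast
  qed
qed

lemma C_hardy2_power_series: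
  assumes a: "uniform_l2 a"
  shows "(\<lambda>x. power_series_fun (a x)) \<in> C_hardy2"
proof -
  have sm: "summable (\<lambda>n. (cmod (a x n))\<^sup>2)" for x by (rule uniform_l2_summable[OF a])
  have "((\<lambda>x. hardy2_norm (\<lambda>w. power_series_fun (a x) w - power_series_fun (a x0) w)) \<longlongrightarrow> 0) (nhds x0)" for x0
  proof (rule tendstoI)
    fix e :: real assume e: "0 < e"
    define \<epsilon> where "\<epsilon> = e\<^sup>2 / 6"
    have \<epsilon>: "0 < \<epsilon>" using e by (simp add: \<epsilon>_def)
    obtain M where M: "\<And>x N. (\<Sum>n\<in>{M..<N}. (cmod (a x n))\<^sup>2) \<le> \<epsilon>"
      using uniform_l2_tail[OF a \<epsilon>] by blast
    have "continuous_on UNIV (\<lambda>x. \<Sum>n<M. (cmod (a x n - a x0 n))\<^sup>2)"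
      using a by (intro continuous_intros) (auto simp: uniform_l2_def)
    then have "((\<lambda>x. \<Sum>n<M. (cmod (a x n - a x0 n))\<^sup>2) \<longlongrightarrow> (\<Sum>n<M. (cmod (a x0 n - a x0 n))\<^sup>2)) (nhds x0)"
      unfolding continuous_on_UNIV_iff_nhds by blast
    then have "eventually (\<lambda>x. (\<Sum>n<M. (cmod (a x n - a x0 n))\<^sup>2) < \<epsilon>) (nhds x0)"
      by (rule order_tendstoD(2)) (use \<epsilon> in simp)
    then show "eventually (\<lambda>x. dist (hardy2_norm (\<lambda>w. power_series_fun (a x) w - power_series_fun (a x0) w)) 0 < e) (nhds x0)"
    proof eventually_elim
      case (elim x)
      have fin: "(\<Sum>n<N. (cmod (a x n - a x0 n))\<^sup>2) \<le> 5 * \<epsilon>" for N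
        using sum_lessThan_le_split[of "\<lambda>n. (cmod (a x n - a x0 n))\<^sup>2" N M] elim
          sum_norm_add_squared_le[of "a x" "\<lambda>n. - a x0 n" "{M..<N}"]
          M[where x = x and N = N] M[where x = x0 and N = N] by simp
      have sm': "summable (\<lambda>n. (cmod (a x n - a x0 n))\<^sup>2)"
        using fin by (intro bounded_imp_summable[where B = "5 * \<epsilon>"])
          (simp_all add: lessThan_Suc_atMost[symmetric] del: sum.lessThan_Suc)
      have "(\<Sum>n. (cmod (a x n - a x0 n))\<^sup>2) \<le> 5 * \<epsilon>"
        by (rule suminf_le_const[OF sm' fin])
      also have "\<dots> < e\<^sup>2" using e by (simp add: \<epsilon>_def)
      finally have "sqrt (\<Sum>n. (cmod (a x n - a x0 n))\<^sup>2) < e"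
        using e by (simp add: real_less_lsqrt)
      moreover have "0 \<le> sqrt (\<Sum>n. (cmod (a x n - a x0 n))\<^sup>2)"
        using sm' by (simp add: suminf_nonneg)
      ultimately show ?case
        by (simp add: hardy2_norm_def taylor_coeff_diff sm)
    qed
  qed
  then show ?thesis
    using sm by (auto simp: C_hardy2_def hardy2_iff)
qed

lemma C_hardy2_obtain_power_series:
  assumes cpt: "compact (UNIV :: 'x::topological_space set)" and F: "F \<in> C_hardy2"
  obtains a where "uniform_l2 (a :: 'x \<Rightarrow> nat \<Rightarrow> complex)" "F = (\<lambda>x. power_series_fun (a x))"
proof -
  have "\<forall>x. \<exists>a. summable (\<lambda>n. (cmod (a n))\<^sup>2) \<and> F x = power_series_fun a"
    using F by (auto simp: C_hardy2_def hardy2_iff)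
  then obtain a where sm: "\<And>x. summable (\<lambda>n. (cmod (a x n))\<^sup>2)" and Fa: "\<And>x. F x = power_series_fun (a x)"
    by metis
  define D where "D = (\<lambda>x0 x. hardy2_norm (\<lambda>w. F x w - F x0 w))"
  have D_lim: "(D x0 \<longlongrightarrow> 0) (nhds x0)" for x0
    using F by (simp add: D_def C_hardy2_def)
  have sm': "summable (\<lambda>n. (cmod (a x n - a x0 n))\<^sup>2)" for x x0
  proof (rule summable_comparison_test'[where N = 0])
    show "summable (\<lambda>n. 2 * (cmod (a x n))\<^sup>2 + 2 * (cmod (a x0 n))\<^sup>2)"
      by (intro summable_add summable_mult sm)
    show "norm ((cmod (a x n - a x0 n))\<^sup>2) \<le> 2 * (cmod (a x n))\<^sup>2 + 2 * (cmod (a x0 n))\<^sup>2" for n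
      using norm_add_squared_le[of "a x n" "- a x0 n"] by simp
  qed
  have D_sq: "(D x0 x)\<^sup>2 = (\<Sum>n. (cmod (a x n - a x0 n))\<^sup>2)" for x0 x
    by (simp add: D_def Fa hardy2_norm_def taylor_coeff_diff sm suminf_nonneg sm')
  have D_nonneg: "0 \<le> D x0 x" for x0 x
    by (simp add: D_def Fa hardy2_norm_def taylor_coeff_diff sm suminf_nonneg sm')
  have fin: "(\<Sum>n\<in>I. (cmod (a x n - a x0 n))\<^sup>2) \<le> (D x0 x)\<^sup>2" if "finite I" for I x x0
    unfolding D_sq by (rule sum_le_suminf[OF sm' that]) simp
  have "uniform_l2 a"
    unfolding uniform_l2_def
  proof (intro conjI allI impI)
    fix n
    have "((\<lambda>x. a x n) \<longlongrightarrow> a x0 n) (nhds x0)" for x0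
    proof -
      have "cmod (a x n - a x0 n) \<le> D x0 x" for x
        by (rule power2_le_imp_le[OF _ D_nonneg]) (use fin[of "{n}" x x0] in simp)
      then have "((\<lambda>x. a x n - a x0 n) \<longlongrightarrow> 0) (nhds x0)"
        by (intro Lim_null_comparison[OF _ D_lim]) simp
      then show ?thesis by (simp add: LIM_zero_iff)
    qed
    then show "continuous_on UNIV (\<lambda>x. a x n)"
      by (simp add: continuous_on_UNIV_iff_nhds)
  next
    fix \<epsilon> :: real assume \<epsilon>: "0 < \<epsilon>"
    show "\<exists>M. \<forall>x N. (\<Sum>n\<in>{M..<N}. (cmod (a x n))\<^sup>2) \<le> \<epsilon>"
    proof (rule compact_eventually_uniform[OF cpt])
      fix M M' x assume *: "\<forall>N. (\<Sum>n\<in>{M..<N}. (cmod (a x n))\<^sup>2) \<le> \<epsilon>" "M \<le> M'"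
      have "(\<Sum>n\<in>{M'..<N}. (cmod (a x n))\<^sup>2) \<le> (\<Sum>n\<in>{M..<N}. (cmod (a x n))\<^sup>2)" for N
        using *(2) by (intro sum_mono2) auto
      then show "\<forall>N. (\<Sum>n\<in>{M'..<N}. (cmod (a x n))\<^sup>2) \<le> \<epsilon>" using *(1) order_trans by blast
    next
      fix x0
      have "eventually (\<lambda>M. (\<Sum>n. (cmod (a x0 n))\<^sup>2) - \<epsilon> / 4 < (\<Sum>n<M. (cmod (a x0 n))\<^sup>2)) sequentially"
        using summable_LIMSEQ[OF sm] \<epsilon> by (intro order_tendstoD(1)) auto
      then obtain M where M: "(\<Sum>n. (cmod (a x0 n))\<^sup>2) - \<epsilon> / 4 < (\<Sum>n<M. (cmod (a x0 n))\<^sup>2)"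
        by (auto simp: eventually_sequentially)
      have tail: "(\<Sum>n\<in>{M..<N}. (cmod (a x0 n))\<^sup>2) \<le> \<epsilon> / 4" for N
      proof -
        have "(\<Sum>n\<in>{M..<N}. (cmod (a x0 n))\<^sup>2) + (\<Sum>n<M. (cmod (a x0 n))\<^sup>2) = (\<Sum>n\<in>{M..<N} \<union> {..<M}. (cmod (a x0 n))\<^sup>2)"
          by (rule sum.union_disjoint[symmetric]) auto
        also have "\<dots> \<le> (\<Sum>n. (cmod (a x0 n))\<^sup>2)"
          by (rule sum_le_suminf[OF sm]) auto
        finally show ?thesis using M by linarith
      qed
      have "eventually (\<lambda>x. D x0 x < sqrt (\<epsilon> / 4)) (nhds x0)"
        using D_lim \<epsilon> by (intro order_tendstoD(2)) auto
      then have "eventually (\<lambda>x. \<forall>N. (\<Sum>n\<in>{M..<N}. (cmod (a x n))\<^sup>2) \<le> \<epsilon>) (nhds x0)"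
      proof eventually_elim
        case (elim x)
        have "(D x0 x)\<^sup>2 \<le> (sqrt (\<epsilon> / 4))\<^sup>2"
          using elim D_nonneg by (intro power_mono) auto
        then have D: "(D x0 x)\<^sup>2 \<le> \<epsilon> / 4" using \<epsilon> by simp
        show ?case
        proof
          fix N
          show "(\<Sum>n\<in>{M..<N}. (cmod (a x n))\<^sup>2) \<le> \<epsilon>"
            using fin[of "{M..<N}" x x0] D tail[of N]
              sum_norm_add_squared_le[of "\<lambda>n. a x n - a x0 n" "a x0" "{M..<N}"] by simp
        qed
      qed
      then show "\<exists>M. eventually (\<lambda>x. \<forall>N. (\<Sum>n\<in>{M..<N}. (cmod (a x n))\<^sup>2) \<le> \<epsilon>) (nhds x0)" by blast
    qed
  qed
  moreover have "F = (\<lambda>x. power_series_fun (a x))" using Fa by auto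
  ultimately show ?thesis by (rule that)
qed

section \<open>The module of trigonometric polynomials over \<open>C(X)\<close>\<close>

lemma trig_module_add:
  assumes "f \<in> trig_module" "g \<in> trig_module"
  shows "(\<lambda>x y. f x y + g x y) \<in> trig_module"
proof -
  obtain N c where c: "\<And>n. continuous_on UNIV (c n)" "f = (\<lambda>x y. \<Sum>n<N. c n x * expo n x y)"
    using assms(1) by (auto simp: trig_module_def)
  obtain K d where d: "\<And>n. continuous_on UNIV (d n)" "g = (\<lambda>x y. \<Sum>n<K. d n x * expo n x y)"
    using assms(2) by (auto simp: trig_module_def)
  define e where "e = (\<lambda>n x. (if n < N then c n x else 0) + (if n < K then d n x else 0))"
  have "continuous_on UNIV (e n)" for n
  proof -
    have "continuous_on UNIV (\<lambda>x. if n < N then c n x else 0)"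
      by (cases "n < N") (simp_all add: c(1))
    moreover have "continuous_on UNIV (\<lambda>x. if n < K then d n x else 0)"
      by (cases "n < K") (simp_all add: d(1))
    ultimately show ?thesis
      unfolding e_def by (rule continuous_on_add)
  qed
  moreover have "f x y + g x y = (\<Sum>n<max N K. e n x * expo n x y)" for x y
  proof -
    have "(\<Sum>n<N. c n x * expo n x y) = (\<Sum>n<max N K. if n < N then c n x * expo n x y else 0)"
      by (intro sum.mono_neutral_cong_left) auto
    moreover have "(\<Sum>n<K. d n x * expo n x y) = (\<Sum>n<max N K. if n < K then d n x * expo n x y else 0)"
      by (intro sum.mono_neutral_cong_left) auto
    ultimately have "f x y + g x y = (\<Sum>n<max N K. (if n < N then c n x * expo n x y else 0)
        + (if n < K then d n x * expo n x y else 0))"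
      by (simp add: c(2) d(2) sum.distrib)
    also have "\<dots> = (\<Sum>n<max N K. e n x * expo n x y)"
      by (intro sum.cong refl) (auto simp: e_def distrib_right)
    finally show ?thesis .
  qed
  ultimately show ?thesis unfolding trig_module_def by blast
qed

lemma trig_module_scale:
  assumes "continuous_on UNIV h" "f \<in> trig_module"
  shows "(\<lambda>x y. h x * f x y) \<in> trig_module"
proof -
  obtain N c where c: "\<And>n. continuous_on UNIV (c n)" "f = (\<lambda>x y. \<Sum>n<N. c n x * expo n x y)"
    using assms(2) by (auto simp: trig_module_def)
  have "continuous_on UNIV (\<lambda>x. h x * c n x)" for n
    by (intro continuous_intros assms c)
  moreover have "(\<lambda>x y. h x * f x y) = (\<lambda>x y. \<Sum>n<N. (h x * c n x) * expo n x y)"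
    by (simp add: c(2) sum_distrib_left mult.assoc)
  ultimately show ?thesis
    unfolding trig_module_def by (intro CollectI exI[of _ N] exI[of _ "\<lambda>n x. h x * c n x"]) auto
qed

lemma trig_module_zero: "(\<lambda>x y. 0) \<in> trig_module"
  unfolding trig_module_def by (intro CollectI exI[of _ 0] exI[of _ "\<lambda>n x. 0"]) auto

lemma trig_module_diff:
  assumes "f \<in> trig_module" "g \<in> trig_module"
  shows "(\<lambda>x y. f x y - g x y) \<in> trig_module"
  using trig_module_add[OF assms(1) trig_module_scale[OF _ assms(2), of "\<lambda>x. - 1"]] by simp

lemma trig_module_sum:
  assumes "\<And>i. i \<in> I \<Longrightarrow> f i \<in> trig_module"
  shows "(\<lambda>x y. \<Sum>i\<in>I. f i x y) \<in> trig_module"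
  using assms
  by (induction I rule: infinite_finite_induct) (auto intro: trig_module_zero trig_module_add)

lemma trig_module_expo: "(\<lambda>x. circ (int n)) \<in> trig_module"
proof -
  have "(\<lambda>x. circ (int n)) = (\<lambda>x y. \<Sum>k<Suc n. (if k = n then 1 else 0) * expo k x y)"
    by (intro ext) (simp add: expo_eq_circ)
  then show ?thesis
    unfolding trig_module_def
    by (intro CollectI exI[of _ "Suc n"] exI[of _ "\<lambda>k x. if k = n then 1 else 0"]) (simp only: continuous_on_const simp_thms)
qed

lemma trig_module_bdd_borel: "f \<in> trig_module \<Longrightarrow> bdd_borel (f x)"
  by (auto simp: trig_module_def expo_eq_circ intro!: bdd_borel_intros)

locale herglotz_family =
  fixes \<mu> :: "'x::t2_space \<Rightarrow> real measure" and b :: "'x \<Rightarrow> complex \<Rightarrow> complex"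
  assumes compact_X: "compact (UNIV :: 'x set)"
    and fibre: "herglotz_measure (\<mu> x) (b x)"
    and weak: "weakly_continuous \<mu>"
    and singular_or_lebesgue: "singular_measure (\<mu> x) \<or> \<mu> x = lebesgue01"
begin

sublocale fibre: herglotz_measure "\<mu> x" "b x" for x
  by (rule fibre)

lemma continuous_moment: "continuous_on UNIV (\<lambda>x. moment (\<mu> x) j)"
proof -
  have "bounded (circ j ` {0..<1})" by (auto simp: bounded_iff intro!: exI[of _ 1])
  then show ?thesis
    using weak continuous_circ unfolding weakly_continuous_def by blast
qed

lemma continuous_bc: "continuous_on UNIV (\<lambda>x. fibre.bc x n)"
proof (induction n rule: less_induct)
  case (less n)
  show ?case
  proof (cases "n = 0")
    case False
    then have "(\<lambda>x. fibre.bc x n) = (\<lambda>x. cnj (moment (\<mu> x) (int n))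
        - (\<Sum>k<n. fibre.bc x k * cnj (moment (\<mu> x) (int (n - k)))))"
      by (intro ext fibre.bc_recursion) simp
    moreover have "continuous_on UNIV (\<lambda>x. cnj (moment (\<mu> x) (int n))
        - (\<Sum>k<n. fibre.bc x k * cnj (moment (\<mu> x) (int (n - k)))))"
      by (intro continuous_intros continuous_moment less) simp
    ultimately show ?thesis by (simp only:)
  qed simp
qed

lemma aux_trig_module: "(\<lambda>x. fibre.aux x n) \<in> trig_module"
proof -
  have "(\<lambda>x y. circ (int n) y - (\<Sum>j\<le>n. cnj (fibre.bc x (n - j)) * circ (int j) y)) \<in> trig_module"
    by (intro trig_module_diff trig_module_sum trig_module_scale trig_module_expo
        continuous_intros continuous_bc)
  then show ?thesis by (simp only: fibre.aux_def[abs_def])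
qed

lemma auxiliary_seq_eq_aux: "auxiliary_seq \<mu> expo n = (\<lambda>x. fibre.aux x n)"
proof
  show "auxiliary_seq \<mu> expo n x = fibre.aux x n" for x
    by (rule fibre.auxiliary_seq_eq) (rule refl)
qed

lemma continuous_V_inner:
  assumes "f \<in> trig_module" "g \<in> trig_module"
  shows "continuous_on UNIV (V_inner \<mu> f g)"
proof -
  obtain N c where c: "\<And>n. continuous_on UNIV (c n)" "f = (\<lambda>x y. \<Sum>n<N. c n x * expo n x y)"
    using assms(1) by (auto simp: trig_module_def)
  obtain K d where d: "\<And>n. continuous_on UNIV (d n)" "g = (\<lambda>x y. \<Sum>n<K. d n x * expo n x y)"
    using assms(2) by (auto simp: trig_module_def)
  have "V_inner \<mu> f g = (\<lambda>x. \<Sum>n<N. \<Sum>k<K. c n x * cnj (d k x) * moment (\<mu> x) (int n - int k))"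
    unfolding c(2) d(2) circ_def
    by (intro ext V_inner_trig fibre.prob_space_axioms fibre.sets_M)
  moreover have "continuous_on UNIV (\<lambda>x. \<Sum>n<N. \<Sum>k<K. c n x * cnj (d k x) * moment (\<mu> x) (int n - int k))"
    by (intro continuous_intros c d continuous_moment)
  ultimately show ?thesis by simp
qed

abbreviation fnorm :: "('x \<Rightarrow> real \<Rightarrow> complex) \<Rightarrow> 'x \<Rightarrow> real" where
  "fnorm f x \<equiv> sqrt (nsq (\<mu> x) (f x))"

lemma cmod_V_inner_self: "cmod (V_inner \<mu> f f x) = nsq (\<mu> x) (f x)"
  unfolding V_inner_eq_ip by (subst fibre.ip_self) (simp add: fibre.nsq_nonneg)

lemma fnorm_le_V_norm:
  assumes "f \<in> trig_module" shows "fnorm f x \<le> V_norm \<mu> f"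
proof -
  have "compact (range (\<lambda>x. cmod (V_inner \<mu> f f x)))"
    by (intro compact_continuous_image compact_X continuous_intros continuous_V_inner assms)
  then have "bdd_above (range (\<lambda>x. cmod (V_inner \<mu> f f x)))"
    by (intro bounded_imp_bdd_above compact_imp_bounded)
  then have "cmod (V_inner \<mu> f f x) \<le> (SUP x. cmod (V_inner \<mu> f f x))"
    by (intro cSUP_upper) auto
  then show ?thesis
    by (simp add: V_norm_def cmod_V_inner_self)
qed

lemma V_norm_le:
  assumes "\<And>x. nsq (\<mu> x) (f x) \<le> B" shows "V_norm \<mu> f \<le> sqrt B"
  unfolding V_norm_def cmod_V_inner_self by (intro real_sqrt_le_mono cSUP_least assms) auto

lemma V_norm_nonneg: "f \<in> trig_module \<Longrightarrow> 0 \<le> V_norm \<mu> f"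
  using fnorm_le_V_norm[of f undefined] fibre.nsq_nonneg[of undefined "f undefined"]
  by (meson order_trans real_sqrt_ge_zero)

lemma nsq_le_V_norm:
  assumes "f \<in> trig_module" shows "nsq (\<mu> x) (f x) \<le> (V_norm \<mu> f)\<^sup>2"
  using fnorm_le_V_norm[OF assms, of x] fibre.nsq_nonneg[of x "f x"] sqrt_le_D by blast

lemma V_dist_commute: "V_dist \<mu> f g = V_dist \<mu> g f"
proof -
  have "(f x y - g x y) * cnj (f x y - g x y) = (g x y - f x y) * cnj (g x y - f x y)" for x y
    by (simp add: algebra_simps)
  then show ?thesis by (simp only: V_norm_def V_inner_def)
qed

lemma norm_ip_le_V_norm:
  assumes "f \<in> trig_module" "g \<in> trig_module"
  shows "cmod (ip (\<mu> x) (f x) (g x)) \<le> V_norm \<mu> f * V_norm \<mu> g"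
proof -
  have "cmod (ip (\<mu> x) (f x) (g x)) \<le> fnorm f x * fnorm g x"
    by (intro fibre.ip_Cauchy_Schwarz trig_module_bdd_borel assms)
  also have "\<dots> \<le> V_norm \<mu> f * V_norm \<mu> g"
    by (intro mult_mono fnorm_le_V_norm V_norm_nonneg assms) (simp add: fibre.nsq_nonneg)
  finally show ?thesis .
qed

lemma WC_cauchyD:
  assumes "u \<in> WC_cauchy \<mu>"
  shows "u n \<in> trig_module" "0 < \<epsilon> \<Longrightarrow> \<exists>N. \<forall>m\<ge>N. \<forall>n\<ge>N. V_dist \<mu> (u m) (u n) < \<epsilon>"
  using assms by (auto simp: WC_cauchy_def)

lemma WC_cauchy_fibre_bounded:
  assumes u: "u \<in> WC_cauchy \<mu>"
  obtains C where "0 \<le> C" "eventually (\<lambda>n. fnorm (u n) x \<le> C) sequentially"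
proof -
  note t = WC_cauchyD(1)[OF u]
  obtain N where N: "\<And>m n. m \<ge> N \<Longrightarrow> n \<ge> N \<Longrightarrow> V_dist \<mu> (u m) (u n) < 1"
    using WC_cauchyD(2)[OF u zero_less_one] by blast
  have "fnorm (u n) x \<le> 1 + V_norm \<mu> (u N)" if "N \<le> n" for n
  proof -
    let ?d = "\<lambda>x y. u n x y - u N x y"
    have d: "?d \<in> trig_module" by (intro trig_module_diff t)
    have D: "V_norm \<mu> ?d \<le> 1" using N[of n N] that by simp
    have "nsq (\<mu> x) (u n x) = nsq (\<mu> x) (\<lambda>y. ?d x y - (- 1) * u N x y)" by simp
    also have "\<dots> = nsq (\<mu> x) (?d x) - 2 * Re (cnj (- 1) * ip (\<mu> x) (?d x) (u N x))
        + (cmod (- 1))\<^sup>2 * nsq (\<mu> x) (u N x)"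
      by (intro fibre.nsq_diff_scaled trig_module_bdd_borel[OF d] trig_module_bdd_borel t)
    also have "\<dots> = nsq (\<mu> x) (?d x) + 2 * Re (ip (\<mu> x) (?d x) (u N x)) + nsq (\<mu> x) (u N x)"
      by simp
    also have "\<dots> \<le> (V_norm \<mu> ?d)\<^sup>2 + 2 * (V_norm \<mu> ?d * V_norm \<mu> (u N)) + (V_norm \<mu> (u N))\<^sup>2"
      using complex_Re_le_cmod[of "ip (\<mu> x) (?d x) (u N x)"] norm_ip_le_V_norm[OF d t, of x N]
        nsq_le_V_norm[OF d, of x] nsq_le_V_norm[OF t, of x N] by linarith
    also have "\<dots> = (V_norm \<mu> ?d + V_norm \<mu> (u N))\<^sup>2"
      by (simp add: power2_sum)
    finally have "fnorm (u n) x \<le> V_norm \<mu> ?d + V_norm \<mu> (u N)"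
      by (intro real_le_lsqrt add_nonneg_nonneg V_norm_nonneg d t)
    then show ?thesis using D by linarith
  qed
  then have "eventually (\<lambda>n. fnorm (u n) x \<le> 1 + V_norm \<mu> (u N)) sequentially"
    by (auto simp: eventually_sequentially)
  moreover have "0 \<le> 1 + V_norm \<mu> (u N)" using V_norm_nonneg[OF t, of N] by simp
  ultimately show ?thesis using that by blast
qed

lemma WC_const_cauchy:
  assumes "g \<in> trig_module" shows "(\<lambda>_. g) \<in> WC_cauchy \<mu>"
proof -
  have "V_dist \<mu> g g = 0" by (simp add: V_norm_def V_inner_def)
  then show ?thesis using assms by (simp add: WC_cauchy_def)
qed

text \<open>
  Any representative of the class computes the inner product, and for a class in the image
  of the embedding the second argument may be taken constant.
\<close>

lemma WC_inner_limit:
  assumes u: "u \<in> WC_cauchy \<mu>" and g: "g \<in> trig_module"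
  shows "(\<lambda>k. ip (\<mu> x) (u k x) (g x)) \<longlonglongrightarrow> WC_inner \<mu> (WC_rel \<mu> `` {u}) (WC_embed \<mu> g) x"
proof -
  have "Cauchy (\<lambda>k. ip (\<mu> x) (u k x) (g x))"
  proof (rule CauchyI)
    fix e :: real assume e: "0 < e"
    have g0: "0 \<le> V_norm \<mu> g" by (rule V_norm_nonneg[OF g])
    then have "0 < e / (V_norm \<mu> g + 1)" using e by simp
    then obtain N where N: "\<And>m n. m \<ge> N \<Longrightarrow> n \<ge> N \<Longrightarrow> V_dist \<mu> (u m) (u n) < e / (V_norm \<mu> g + 1)"
      using WC_cauchyD(2)[OF u] by blast
    have "cmod (ip (\<mu> x) (u m x) (g x) - ip (\<mu> x) (u n x) (g x)) < e" if "m \<ge> N" "n \<ge> N" for m n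
    proof -
      have d: "(\<lambda>x y. u m x y - u n x y) \<in> trig_module"
        by (intro trig_module_diff WC_cauchyD(1)[OF u])
      have "cmod (ip (\<mu> x) (u m x) (g x) - ip (\<mu> x) (u n x) (g x))
          = cmod (ip (\<mu> x) (\<lambda>y. u m x y - u n x y) (g x))"
        by (subst fibre.ip_diff_left) (auto intro!: trig_module_bdd_borel WC_cauchyD(1)[OF u] g)
      also have "\<dots> \<le> V_dist \<mu> (u m) (u n) * V_norm \<mu> g"
        by (rule norm_ip_le_V_norm[OF d g])
      also have "\<dots> \<le> V_dist \<mu> (u m) (u n) * (V_norm \<mu> g + 1)"
        using V_norm_nonneg[OF d] by (intro mult_left_mono) auto
      also have "\<dots> < e"
        using N[OF that] g0 by (simp add: less_divide_eq)
      finally show ?thesis .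
    qed
    then show "\<exists>M. \<forall>m\<ge>M. \<forall>n\<ge>M. norm (ip (\<mu> x) (u m x) (g x) - ip (\<mu> x) (u n x) (g x)) < e" by blast
  qed
  then obtain z where z: "(\<lambda>k. ip (\<mu> x) (u k x) (g x)) \<longlonglongrightarrow> z"
    by (auto simp: Cauchy_convergent_iff convergent_def)
  have lim: "(\<lambda>k. V_inner \<mu> (u' k) (v k) x) \<longlonglongrightarrow> z"
    if "u' \<in> WC_rel \<mu> `` {u}" "v \<in> WC_embed \<mu> g" for u' v
  proof -
    have u': "u' \<in> WC_cauchy \<mu>" and D: "(\<lambda>k. V_dist \<mu> (u k) (u' k)) \<longlonglongrightarrow> 0"
      using that(1) by (auto simp: WC_rel_def)
    have v: "v \<in> WC_cauchy \<mu>" and E: "(\<lambda>k. V_dist \<mu> g (v k)) \<longlonglongrightarrow> 0"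
      using that(2) by (auto simp: WC_rel_def WC_embed_def)
    note t = WC_cauchyD(1)[OF u] WC_cauchyD(1)[OF u'] WC_cauchyD(1)[OF v] g
    obtain C where C: "0 \<le> C" "eventually (\<lambda>n. fnorm (u' n) x \<le> C) sequentially"
      using WC_cauchy_fibre_bounded[OF u'] by blast
    have "(\<lambda>k. ip (\<mu> x) (u k x) (g x) - ip (\<mu> x) (u' k x) (v k x)) \<longlonglongrightarrow> 0"
    proof (rule Lim_null_comparison)
      show "(\<lambda>k. V_dist \<mu> (u k) (u' k) * V_norm \<mu> g + C * V_dist \<mu> g (v k)) \<longlonglongrightarrow> 0"
        using tendsto_add[OF tendsto_mult_left_zero[OF D] tendsto_mult_right_zero[OF E]] by simp
      show "eventually (\<lambda>k. norm (ip (\<mu> x) (u k x) (g x) - ip (\<mu> x) (u' k x) (v k x))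
          \<le> V_dist \<mu> (u k) (u' k) * V_norm \<mu> g + C * V_dist \<mu> g (v k)) sequentially"
        using C(2)
      proof eventually_elim
        case (elim k)
        have d: "(\<lambda>x y. u k x y - u' k x y) \<in> trig_module" "(\<lambda>x y. g x y - v k x y) \<in> trig_module"
          by (intro trig_module_diff t)+
        have "ip (\<mu> x) (u k x) (g x) - ip (\<mu> x) (u' k x) (v k x)
            = ip (\<mu> x) (\<lambda>y. u k x y - u' k x y) (g x) + ip (\<mu> x) (u' k x) (\<lambda>y. g x y - v k x y)"
          by (simp add: fibre.ip_diff_left fibre.ip_diff_right trig_module_bdd_borel t)
        then have "cmod (ip (\<mu> x) (u k x) (g x) - ip (\<mu> x) (u' k x) (v k x))
            \<le> cmod (ip (\<mu> x) (\<lambda>y. u k x y - u' k x y) (g x)) + cmod (ip (\<mu> x) (u' k x) (\<lambda>y. g x y - v k x y))"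
          by (simp add: norm_triangle_ineq)
        also have "\<dots> \<le> V_dist \<mu> (u k) (u' k) * V_norm \<mu> g + C * V_dist \<mu> g (v k)"
        proof (rule add_mono)
          show "cmod (ip (\<mu> x) (\<lambda>y. u k x y - u' k x y) (g x)) \<le> V_dist \<mu> (u k) (u' k) * V_norm \<mu> g"
            by (rule norm_ip_le_V_norm[OF d(1) g])
          have "cmod (ip (\<mu> x) (u' k x) (\<lambda>y. g x y - v k x y))
              \<le> fnorm (u' k) x * fnorm (\<lambda>x y. g x y - v k x y) x"
            by (intro fibre.ip_Cauchy_Schwarz trig_module_bdd_borel[OF d(2)] trig_module_bdd_borel t)
          also have "\<dots> \<le> C * V_dist \<mu> g (v k)"
            by (intro mult_mono elim C(1) fnorm_le_V_norm[OF d(2)]) (simp add: fibre.nsq_nonneg)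
          finally show "cmod (ip (\<mu> x) (u' k x) (\<lambda>y. g x y - v k x y)) \<le> C * V_dist \<mu> g (v k)" .
        qed
        finally show ?case .
      qed
    qed
    from tendsto_diff[OF z this] show ?thesis by (simp add: V_inner_eq_ip)
  qed
  have mem: "u \<in> WC_rel \<mu> `` {u}" "(\<lambda>_. g) \<in> WC_embed \<mu> g"
    using u WC_const_cauchy[OF g] by (simp_all add: WC_embed_def WC_rel_def V_norm_def V_inner_def)
  have "WC_inner \<mu> (WC_rel \<mu> `` {u}) (WC_embed \<mu> g) x = z"
    unfolding WC_inner_def
  proof (rule the_equality)
    show "\<forall>u'\<in>WC_rel \<mu> `` {u}. \<forall>v\<in>WC_embed \<mu> g. (\<lambda>k. V_inner \<mu> (u' k) (v k) x) \<longlonglongrightarrow> z"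
      by (intro ballI lim)
    fix z'
    assume z': "\<forall>u'\<in>WC_rel \<mu> `` {u}. \<forall>v\<in>WC_embed \<mu> g. (\<lambda>k. V_inner \<mu> (u' k) (v k) x) \<longlonglongrightarrow> z'"
    have "(\<lambda>k. V_inner \<mu> (u k) g x) \<longlonglongrightarrow> z'"
      by (rule bspec[OF bspec[OF z' mem(1)] mem(2)])
    then show "z' = z"
      using lim[OF mem] by (rule LIMSEQ_unique)
  qed
  then show ?thesis using z by simp
qed

section \<open>The image of the operator\<close>

definition aux_coeffs :: "('x \<Rightarrow> real \<Rightarrow> complex) \<Rightarrow> 'x \<Rightarrow> nat \<Rightarrow> complex" where
  "aux_coeffs f x m = ip (\<mu> x) (f x) (fibre.aux x m)"

lemma aux_coeffs_trig:
  assumes "f = (\<lambda>x y. \<Sum>n<N. c n x * expo n x y)"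
  shows "aux_coeffs f x m = (\<Sum>n<N. c n x * (\<Sum>k\<le>n. moment (\<mu> x) (int (n - k)) * fibre.gram x k m))"
proof -
  have "expo n x = (\<lambda>y. \<Sum>k\<le>n. moment (\<mu> x) (int (n - k)) * fibre.aux x k y)" for n
    unfolding expo_eq_circ by (intro ext fibre.circ_eq_sum_aux)
  then show ?thesis
    unfolding aux_coeffs_def assms
    by (simp add: fibre.ip_sum_left fibre.ip_scale_left fibre.gram_def bdd_borel_intros)
qed

text \<open>
  The rows of the Gram matrix form continuous families although \<open>b\<^sup>x\<close> itself may jump in norm:
  by \<open>gram_row_norm\<close> the norm of a row is an inner product of trigonometric polynomials, hence
  continuous in \<open>x\<close>.
\<close>

lemma uniform_l2_aux_coeffs:
  assumes "f \<in> trig_module" shows "uniform_l2 (aux_coeffs f)"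
proof -
  have gram: "uniform_l2 (\<lambda>x m. fibre.gram x n m)" for n
  proof (rule uniform_l2_if_norm_continuous[OF compact_X])
    show "continuous_on UNIV (\<lambda>x. fibre.gram x n m)" for m
      using continuous_V_inner[OF aux_trig_module aux_trig_module, of n m]
      by (simp add: V_inner_eq_ip[abs_def] fibre.gram_def)
    show "(\<lambda>m. (cmod (fibre.gram x n m))\<^sup>2) sums nsq (\<mu> x) (fibre.aux x n)" for x
      by (rule fibre.gram_row_norm[OF singular_or_lebesgue])
    show "continuous_on UNIV (\<lambda>x. nsq (\<mu> x) (fibre.aux x n))"
      using continuous_on_Re[OF continuous_V_inner[OF aux_trig_module aux_trig_module, of n n]]
      by (simp add: V_inner_eq_ip[abs_def])
  qed
  obtain N c where c: "\<And>n. continuous_on UNIV (c n)" "f = (\<lambda>x y. \<Sum>n<N. c n x * expo n x y)"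
    using assms by (auto simp: trig_module_def)
  have "uniform_l2 (\<lambda>x m. \<Sum>n<N. c n x * (\<Sum>k\<le>n. moment (\<mu> x) (int (n - k)) * fibre.gram x k m))"
    by (intro uniform_l2_sum uniform_l2_scale compact_X c continuous_moment gram)
  then show ?thesis
    by (simp only: aux_coeffs_trig[OF c(2), abs_def])
qed

lemma aux_coeffs_orthogonal_shift:
  assumes "f \<in> trig_module"
  shows "(\<lambda>m. aux_coeffs f x m * cnj (fibre.shift x k m)) sums 0"
proof -
  obtain N c where c: "f = (\<lambda>x y. \<Sum>n<N. c n x * expo n x y)"
    using assms by (auto simp: trig_module_def)
  have "(\<lambda>m. \<Sum>n<N. c n x * (\<Sum>i\<le>n. moment (\<mu> x) (int (n - i)) * (fibre.gram x i m * cnj (fibre.shift x k m))))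
      sums (\<Sum>n<N. c n x * (\<Sum>i\<le>n. moment (\<mu> x) (int (n - i)) * 0))"
    by (intro sums_sum sums_mult fibre.gram_orthogonal_shift singular_or_lebesgue)
  then show ?thesis
    by (simp add: aux_coeffs_trig[OF c] sum_distrib_right mult.assoc)
qed

lemma aux_coeffs_diff_norm_le:
  assumes "f \<in> trig_module" "g \<in> trig_module"
  shows "(\<Sum>m<N. (cmod (aux_coeffs f x m - aux_coeffs g x m))\<^sup>2) \<le> (V_dist \<mu> f g)\<^sup>2"
proof -
  have d: "(\<lambda>x y. f x y - g x y) \<in> trig_module" by (intro trig_module_diff assms)
  have "aux_coeffs f x m - aux_coeffs g x m = ip (\<mu> x) (\<lambda>y. f x y - g x y) (fibre.aux x m)" for m
    unfolding aux_coeffs_def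
    by (rule fibre.ip_diff_left[symmetric]) (auto intro: trig_module_bdd_borel assms bdd_borel_intros)
  then have "(\<Sum>m<N. (cmod (aux_coeffs f x m - aux_coeffs g x m))\<^sup>2) \<le> nsq (\<mu> x) (\<lambda>y. f x y - g x y)"
    using fibre.bessel_aux[OF trig_module_bdd_borel[OF d], where N = N and x = x] by simp
  also have "\<dots> \<le> (V_dist \<mu> f g)\<^sup>2"
    using nsq_le_V_norm[OF d] by simp
  finally show ?thesis .
qed

lemma aux_coeffs_uniform_approx:
  assumes u: "u \<in> WC_cauchy \<mu>" and lim: "\<And>x m. (\<lambda>k. aux_coeffs (u k) x m) \<longlonglongrightarrow> t x m" and \<epsilon>: "0 < \<epsilon>"
  shows "\<exists>k. \<forall>x N. (\<Sum>m<N. (cmod (t x m - aux_coeffs (u k) x m))\<^sup>2) \<le> \<epsilon>"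
proof -
  obtain K where K: "\<And>m n. m \<ge> K \<Longrightarrow> n \<ge> K \<Longrightarrow> V_dist \<mu> (u m) (u n) < sqrt \<epsilon>"
    using WC_cauchyD(2)[OF u] \<epsilon> real_sqrt_gt_zero by metis
  have "(\<Sum>m<N. (cmod (t x m - aux_coeffs (u K) x m))\<^sup>2) \<le> \<epsilon>" for x N
  proof (rule tendsto_upperbound)
    show "(\<lambda>k. \<Sum>m<N. (cmod (aux_coeffs (u k) x m - aux_coeffs (u K) x m))\<^sup>2) \<longlonglongrightarrow>
        (\<Sum>m<N. (cmod (t x m - aux_coeffs (u K) x m))\<^sup>2)"
      by (intro tendsto_intros lim)
    have "(\<Sum>m<N. (cmod (aux_coeffs (u k) x m - aux_coeffs (u K) x m))\<^sup>2) \<le> \<epsilon>" if "K \<le> k" for k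
    proof -
      have "0 \<le> V_dist \<mu> (u k) (u K)"
        by (intro V_norm_nonneg trig_module_diff WC_cauchyD(1)[OF u])
      then have "(V_dist \<mu> (u k) (u K))\<^sup>2 \<le> (sqrt \<epsilon>)\<^sup>2"
        using K[of k K] that by (intro power_mono) auto
      then show ?thesis
        using aux_coeffs_diff_norm_le[OF WC_cauchyD(1)[OF u, of k] WC_cauchyD(1)[OF u, of K], where N = N and x = x] \<epsilon> by simp
    qed
    then show "eventually (\<lambda>k. (\<Sum>m<N. (cmod (aux_coeffs (u k) x m - aux_coeffs (u K) x m))\<^sup>2) \<le> \<epsilon>) sequentially"
      by (auto simp: eventually_sequentially)
  qed simp
  then show ?thesis by blast
qed

lemma V_op_eq:
  assumes "u \<in> WC_cauchy \<mu>" "\<And>x m. (\<lambda>k. aux_coeffs (u k) x m) \<longlonglongrightarrow> t x m"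
  shows "V_op \<mu> (WC_rel \<mu> `` {u}) = (\<lambda>x. power_series_fun (t x))"
proof -
  have "WC_inner \<mu> (WC_rel \<mu> `` {u}) (WC_embed \<mu> (auxiliary_seq \<mu> expo m)) x = t x m" for x m
    using LIMSEQ_unique[OF WC_inner_limit[OF assms(1) aux_trig_module[of m], of x]] assms(2)[of x m]
    by (simp add: auxiliary_seq_eq_aux aux_coeffs_def)
  then show ?thesis by (simp add: V_op_def power_series_fun_def)
qed

text \<open>
  The Cauchy product with the Taylor coefficients of \<open>b\<^sup>x\<close>, written as a combination of shifts so that
  orthogonality to all shifts can be used term by term.
\<close>

definition mult_b :: "'x \<Rightarrow> (nat \<Rightarrow> complex) \<Rightarrow> nat \<Rightarrow> complex" where
  "mult_b x f m = (\<Sum>k\<le>m. f k * fibre.shift x k m)"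

lemma mult_b_extend: "m \<le> L \<Longrightarrow> mult_b x f m = (\<Sum>k\<le>L. f k * fibre.shift x k m)"
  unfolding mult_b_def by (intro sum.mono_neutral_left) (auto simp: fibre.shift_def)

lemma taylor_coeff_mult_b:
  assumes "summable (\<lambda>n. (cmod (f n))\<^sup>2)"
  shows "taylor_coeff (\<lambda>w\<in>ball 0 1. b x w * power_series_fun f w) = mult_b x f"
proof
  fix m
  have "(\<lambda>w. b x w * power_series_fun f w) has_fps_expansion fps_expansion (b x) 0 * Abs_fps f"
    by (intro fps_expansion_intros fibre.b_fps power_series_fun_has_fps assms)
  moreover have "eventually (\<lambda>w::complex. w \<in> ball 0 1) (nhds 0)"
    by (intro eventually_nhds_in_open) auto
  then have "eventually (\<lambda>w. b x w * power_series_fun f w = (\<lambda>w\<in>ball 0 1. b x w * power_series_fun f w) w) (nhds 0)"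
    by eventually_elim simp
  then have "(\<lambda>w. b x w * power_series_fun f w) has_fps_expansion fps_expansion (b x) 0 * Abs_fps f \<longleftrightarrow>
      (\<lambda>w\<in>ball 0 1. b x w * power_series_fun f w) has_fps_expansion fps_expansion (b x) 0 * Abs_fps f"
    by (rule has_fps_expansion_cong) simp
  ultimately have "(\<lambda>w\<in>ball 0 1. b x w * power_series_fun f w) has_fps_expansion Abs_fps f * fps_expansion (b x) 0"
    by (simp add: mult.commute)
  from taylor_coeff_eq[OF this, of m] show "taylor_coeff (\<lambda>w\<in>ball 0 1. b x w * power_series_fun f w) m = mult_b x f m"
    by (simp add: fps_mult_nth mult_b_def fibre.shift_def taylor_coeff_def atLeast0AtMost)
qed

lemma summable_mult_b:
  assumes "summable (\<lambda>n. (cmod (f n))\<^sup>2)"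
  shows "summable (\<lambda>m. (cmod (mult_b x f m))\<^sup>2)"
proof (rule bounded_imp_summable[where B = "\<Sum>n. (cmod (f n))\<^sup>2"])
  fix N
  have "(\<Sum>m\<le>N. (cmod (mult_b x f m))\<^sup>2) = (\<Sum>m<Suc N. (cmod (\<Sum>k\<le>N. f k * fibre.shift x k m))\<^sup>2)"
    unfolding lessThan_Suc_atMost by (intro sum.cong refl) (simp add: mult_b_extend)
  also have "\<dots> \<le> (\<Sum>k\<le>N. (cmod (f k))\<^sup>2)"
    by (rule fibre.shift_combination_norm_le[OF singular_or_lebesgue]) simp
  also have "\<dots> \<le> (\<Sum>n. (cmod (f n))\<^sup>2)"
    by (rule sum_le_suminf[OF assms]) auto
  finally show "(\<Sum>m\<le>N. (cmod (mult_b x f m))\<^sup>2) \<le> (\<Sum>n. (cmod (f n))\<^sup>2)" .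
qed simp

text \<open>
  Because \<open>T\<close> does not increase norms, cutting off the tail of \<open>f\<close> changes \<open>T f\<close> only by a
  small amount, and \<open>T\<close> of the remaining finite part is a finite combination of shifts.
\<close>

lemma orthogonal_mult_b:
  assumes t: "summable (\<lambda>n. (cmod (t n))\<^sup>2)" and orth: "\<And>k. (\<lambda>m. t m * cnj (fibre.shift x k m)) sums 0"
    and f: "summable (\<lambda>n. (cmod (f n))\<^sup>2)"
  shows "(\<lambda>m. t m * cnj (mult_b x f m)) sums 0"
proof (rule orthogonal_l2_limit[OF t summable_mult_b[OF f]])
  fix \<epsilon> :: real assume \<epsilon>: "0 < \<epsilon>"
  have "eventually (\<lambda>K. (\<Sum>n. (cmod (f n))\<^sup>2) - \<epsilon> < (\<Sum>n<K. (cmod (f n))\<^sup>2)) sequentially"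
    using summable_LIMSEQ[OF f] \<epsilon> by (intro order_tendstoD(1)) auto
  then obtain K where K: "(\<Sum>n. (cmod (f n))\<^sup>2) - \<epsilon> < (\<Sum>n<K. (cmod (f n))\<^sup>2)"
    by (auto simp: eventually_sequentially)
  define w where "w = (\<lambda>m. \<Sum>k<K. f k * fibre.shift x k m)"
  have "(\<lambda>m. \<Sum>k<K. cnj (f k) * (t m * cnj (fibre.shift x k m))) sums (\<Sum>k<K. cnj (f k) * 0)"
    by (intro sums_sum sums_mult orth)
  then have "(\<lambda>m. t m * cnj (w m)) sums 0"
    by (simp add: w_def sum_distrib_left mult_ac)
  moreover have "(\<Sum>m<N. (cmod (mult_b x f m - w m))\<^sup>2) \<le> \<epsilon>" for N
  proof -
    have "mult_b x f m - w m = (\<Sum>k\<in>{K..K + N}. f k * fibre.shift x k m)" if "m < N" for m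
    proof -
      have "mult_b x f m = (\<Sum>k\<in>{..<K} \<union> {K..K + N}. f k * fibre.shift x k m)"
        using mult_b_extend[of m "K + N" x f] that by (simp add: ivl_disj_un)
      also have "\<dots> = w m + (\<Sum>k\<in>{K..K + N}. f k * fibre.shift x k m)"
        unfolding w_def by (rule sum.union_disjoint) auto
      finally show ?thesis by simp
    qed
    then have "(\<Sum>m<N. (cmod (mult_b x f m - w m))\<^sup>2) = (\<Sum>m<N. (cmod (\<Sum>k\<in>{K..K + N}. f k * fibre.shift x k m))\<^sup>2)"
      by (intro sum.cong refl) simp
    also have "\<dots> \<le> (\<Sum>k\<in>{K..K + N}. (cmod (f k))\<^sup>2)"
      by (rule fibre.shift_combination_norm_le[OF singular_or_lebesgue]) simp
    also have "\<dots> = (\<Sum>k\<in>{..<K} \<union> {K..K + N}. (cmod (f k))\<^sup>2) - (\<Sum>k<K. (cmod (f k))\<^sup>2)"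
      by (subst sum.union_disjoint) auto
    also have "\<dots> \<le> (\<Sum>n. (cmod (f n))\<^sup>2) - (\<Sum>k<K. (cmod (f k))\<^sup>2)"
      by (intro diff_right_mono sum_le_suminf[OF f]) auto
    also have "\<dots> \<le> \<epsilon>" using K by linarith
    finally show ?thesis .
  qed
  ultimately show "\<exists>w. (\<lambda>n. t n * cnj (w n)) sums 0 \<and> (\<forall>N. (\<Sum>n<N. (cmod (mult_b x f n - w n))\<^sup>2) \<le> \<epsilon>)"
    by blast
qed

text \<open>
  The families with constant value \<open>w\<^sup>k\<close> pick out the single shifts. Conversely, orthogonality to
  the shifts passes to \<open>b\<^sup>x\<close> times an arbitrary element of the Hardy space by
  \<open>orthogonal_mult_b\<close>.
\<close>

lemma perp_mult_iff:
  assumes t: "uniform_l2 t"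
  shows "(\<lambda>x. power_series_fun (t x)) \<in> perp_mult b \<longleftrightarrow>
    (\<forall>x k. (\<lambda>m. t x m * cnj (fibre.shift x k m)) sums 0)"
proof -
  note sm = uniform_l2_summable[OF t]
  have inner: "hardy2_inner (power_series_fun (t x)) (\<lambda>w\<in>ball 0 1. b x w * power_series_fun f w)
      = (\<Sum>m. t x m * cnj (mult_b x f m))" if "summable (\<lambda>n. (cmod (f n))\<^sup>2)" for x f
    unfolding hardy2_inner_def taylor_coeff_mult_b[OF that] taylor_coeff_power_series[OF sm] ..
  show ?thesis
  proof
    assume perp: "(\<lambda>x. power_series_fun (t x)) \<in> perp_mult b"
    show "\<forall>x k. (\<lambda>m. t x m * cnj (fibre.shift x k m)) sums 0"
    proof (intro allI)
      fix x k
      define f where "f = (\<lambda>n::nat. if n = k then 1 else 0 :: complex)"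
      have "uniform_l2 (\<lambda>x::'x. f)"
        unfolding uniform_l2_def
      proof (intro conjI allI impI)
        fix \<epsilon> :: real assume "0 < \<epsilon>"
        then show "\<exists>M. \<forall>x N. (\<Sum>n\<in>{M..<N}. (cmod (f n))\<^sup>2) \<le> \<epsilon>"
          by (intro exI[of _ "Suc k"] allI) (auto simp: f_def intro!: order_trans[OF eq_refl[OF sum.neutral]])
      qed simp
      then have C: "(\<lambda>x::'x. power_series_fun f) \<in> C_hardy2" and sf: "summable (\<lambda>n. (cmod (f n))\<^sup>2)"
        by (rule C_hardy2_power_series, rule uniform_l2_summable)
      have "mult_b x f m = fibre.shift x k m" for m
      proof -
        have "mult_b x f m = (\<Sum>i\<le>max m k. f i * fibre.shift x i m)" by (rule mult_b_extend) simp
        also have "\<dots> = (\<Sum>i\<le>max m k. if i = k then fibre.shift x i m else 0)"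
          by (intro sum.cong) (auto simp: f_def)
        finally show ?thesis by simp
      qed
      then have eq: "mult_b x f = fibre.shift x k" by auto
      have all: "\<forall>f\<in>C_hardy2. hardy2_inner (power_series_fun (t x)) (\<lambda>w\<in>ball 0 1. b x w * f x w) = 0"
        using perp by (simp add: perp_mult_def)
      have "(\<Sum>m. t x m * cnj (mult_b x f m)) = 0"
        unfolding inner[OF sf, symmetric] by (rule bspec[OF all C])
      moreover have "summable (\<lambda>m. t x m * cnj (mult_b x f m))"
        by (rule summable_inner_l2[OF sm summable_mult_b[OF sf]])
      ultimately show "(\<lambda>m. t x m * cnj (fibre.shift x k m)) sums 0"
        by (simp add: eq sums_iff)
    qed
  next
    assume orth: "\<forall>x k. (\<lambda>m. t x m * cnj (fibre.shift x k m)) sums 0"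
    have "hardy2_inner (power_series_fun (t x)) (\<lambda>w\<in>ball 0 1. b x w * f x w) = 0" if f: "f \<in> C_hardy2" for x f
    proof -
      obtain a where a: "uniform_l2 a" "f = (\<lambda>x. power_series_fun (a x))"
        using C_hardy2_obtain_power_series[OF compact_X f] by blast
      have "(\<lambda>m. t x m * cnj (mult_b x (a x) m)) sums 0"
        using orth by (intro orthogonal_mult_b sm uniform_l2_summable[OF a(1)]) auto
      then show ?thesis
        unfolding a(2) inner[OF uniform_l2_summable[OF a(1)]] by (simp add: sums_iff)
    qed
    then show "(\<lambda>x. power_series_fun (t x)) \<in> perp_mult b"
      using C_hardy2_power_series[OF t] by (simp add: perp_mult_def)
  qed
qed

text \<open>
  Bessel's inequality makes the coefficients of a Cauchy sequence converge in \<open>\<ell>\<^sup>2\<close> uniformly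
  in \<open>x\<close>, so that continuity and orthogonality survive in the limit.
\<close>

lemma V_op_in_perp_mult:
  assumes "F \<in> WC \<mu>" shows "V_op \<mu> F \<in> perp_mult b"
proof -
  obtain u where u: "u \<in> WC_cauchy \<mu>" and F: "F = WC_rel \<mu> `` {u}"
    using assms unfolding WC_def by (rule quotientE)
  define t where "t = (\<lambda>x m. WC_inner \<mu> F (WC_embed \<mu> (\<lambda>x. fibre.aux x m)) x)"
  have lim: "(\<lambda>k. aux_coeffs (u k) x m) \<longlonglongrightarrow> t x m" for x m
    unfolding t_def F aux_coeffs_def by (rule WC_inner_limit[OF u aux_trig_module])
  note trig = WC_cauchyD(1)[OF u]
  note approx = aux_coeffs_uniform_approx[OF u lim]
  have t: "uniform_l2 t"
    by (rule uniform_l2_limit[OF uniform_l2_aux_coeffs[OF trig] approx])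
  have "(\<lambda>m. t x m * cnj (fibre.shift x k m)) sums 0" for x k
  proof -
    have shift: "summable (\<lambda>m. (cmod (fibre.shift x k m))\<^sup>2)"
      using fibre.summable_bc[of x] by (subst summable_iff_shift[of _ k, symmetric]) (simp add: fibre.shift_def)
    have "(\<lambda>m. fibre.shift x k m * cnj (t x m)) sums 0"
    proof (rule orthogonal_l2_limit[OF shift uniform_l2_summable[OF t]])
      fix \<epsilon> :: real assume "0 < \<epsilon>"
      then obtain j where j: "\<And>x N. (\<Sum>m<N. (cmod (t x m - aux_coeffs (u j) x m))\<^sup>2) \<le> \<epsilon>"
        using approx by blast
      have "(\<lambda>m. cnj (aux_coeffs (u j) x m * cnj (fibre.shift x k m))) sums cnj 0"
        unfolding sums_cnj by (rule aux_coeffs_orthogonal_shift[OF trig])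
      then show "\<exists>w. (\<lambda>n. fibre.shift x k n * cnj (w n)) sums 0 \<and> (\<forall>N. (\<Sum>n<N. (cmod (t x n - w n))\<^sup>2) \<le> \<epsilon>)"
        using j by (intro exI[of _ "aux_coeffs (u j) x"]) (simp add: mult.commute)
    qed
    then have "(\<lambda>m. cnj (fibre.shift x k m * cnj (t x m))) sums cnj 0"
      unfolding sums_cnj .
    then show ?thesis by (simp add: mult.commute)
  qed
  then show ?thesis
    unfolding F V_op_eq[OF u lim] perp_mult_iff[OF t] by blast
qed

text \<open>
  The adjoint of \<open>V\<close> maps \<open>w\<^sup>n\<close> to the \<open>n\<close>-th term of the auxiliary sequence, so the preimage of
  \<open>h\<close> has to be the series of the auxiliary sequence with the coefficients of \<open>h\<close>. Its
  partial sums have continuous coefficients and therefore lie in the module.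
\<close>

lemma perp_mult_in_image:
  assumes "h \<in> perp_mult b" shows "h \<in> V_op \<mu> ` WC \<mu>"
proof -
  have "h \<in> C_hardy2" using assms by (simp add: perp_mult_def)
  then obtain a where a: "uniform_l2 a" and h: "h = (\<lambda>x. power_series_fun (a x))"
    using C_hardy2_obtain_power_series[OF compact_X] by blast
  have orth: "(\<lambda>m. a x m * cnj (fibre.shift x k m)) sums 0" for x k
    using assms unfolding h perp_mult_iff[OF a] by blast
  have a_cont: "continuous_on UNIV (\<lambda>x. a x n)" for n
    using a by (simp add: uniform_l2_def)
  define u where "u = (\<lambda>N x y. \<Sum>n<N. a x n * fibre.aux x n y)"
  have trig: "u N \<in> trig_module" for N
    unfolding u_def by (intro trig_module_sum trig_module_scale a_cont aux_trig_module)
  have dist: "V_dist \<mu> (u N) (u M) \<le> sqrt \<epsilon>"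
    if "M \<le> N" "\<And>x N. (\<Sum>n\<in>{M..<N}. (cmod (a x n))\<^sup>2) \<le> \<epsilon>" for N M \<epsilon>
  proof (rule V_norm_le)
    fix x
    have "u N x y - u M x y = (\<Sum>n\<in>{M..<N}. a x n * fibre.aux x n y)" for y
    proof -
      have "u N x y = (\<Sum>n\<in>{..<M} \<union> {M..<N}. a x n * fibre.aux x n y)"
        unfolding u_def using that(1) by (intro sum.cong) auto
      also have "\<dots> = u M x y + (\<Sum>n\<in>{M..<N}. a x n * fibre.aux x n y)"
        unfolding u_def by (rule sum.union_disjoint) auto
      finally show ?thesis by simp
    qed
    then have "nsq (\<mu> x) (\<lambda>y. u N x y - u M x y) \<le> (\<Sum>n\<in>{M..<N}. (cmod (a x n))\<^sup>2)"
      using fibre.nsq_sum_aux_le[of "{M..<N}" x "a x"] by simp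
    then show "nsq (\<mu> x) (\<lambda>y. u N x y - u M x y) \<le> \<epsilon>"
      using that(2)[of x N] by linarith
  qed
  have "\<exists>K. \<forall>m\<ge>K. \<forall>n\<ge>K. V_dist \<mu> (u m) (u n) < e" if e: "0 < e" for e
  proof -
    have "0 < (e / 2)\<^sup>2" using e by simp
    then obtain K where K: "\<And>x N. (\<Sum>n\<in>{K..<N}. (cmod (a x n))\<^sup>2) \<le> (e / 2)\<^sup>2"
      using uniform_l2_tail[OF a] by blast
    have K': "(\<Sum>n\<in>{m..<N}. (cmod (a x n))\<^sup>2) \<le> (e / 2)\<^sup>2" if "K \<le> m" for m x N
    proof -
      have "(\<Sum>n\<in>{m..<N}. (cmod (a x n))\<^sup>2) \<le> (\<Sum>n\<in>{K..<N}. (cmod (a x n))\<^sup>2)"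
        using that by (intro sum_mono2) auto
      then show ?thesis by (rule order_trans[OF _ K])
    qed
    have le: "V_dist \<mu> (u n) (u m) < e" if "K \<le> m" "m \<le> n" for m n
      using dist[OF that(2) K'[OF that(1)]] e by simp
    have "V_dist \<mu> (u m) (u n) < e" if "K \<le> m" "K \<le> n" for m n
      using le[of m n] le[of n m] that V_dist_commute[of "u m" "u n"] by (cases "m \<le> n") auto
    then show ?thesis by blast
  qed
  then have u: "u \<in> WC_cauchy \<mu>" using trig by (auto simp: WC_cauchy_def)
  have "(\<lambda>N. aux_coeffs (u N) x m) \<longlonglongrightarrow> a x m" for x m
  proof -
    have "(\<lambda>n. if n = m then a x n else 0) sums a x m"
      by (rule sums_single)
    moreover have "(\<lambda>n. \<Sum>j\<le>m. fibre.shift x j m * (a x n * cnj (fibre.shift x j n)))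
        sums (\<Sum>j\<le>m. fibre.shift x j m * 0)"
      by (intro sums_sum sums_mult orth)
    ultimately have "(\<lambda>n. (if n = m then a x n else 0)
        - (\<Sum>j\<le>m. fibre.shift x j m * (a x n * cnj (fibre.shift x j n))))
        sums (a x m - (\<Sum>j\<le>m. fibre.shift x j m * 0))"
      by (rule sums_diff)
    moreover have "(if n = m then a x n else 0)
        - (\<Sum>j\<le>m. fibre.shift x j m * (a x n * cnj (fibre.shift x j n))) = a x n * fibre.gram x n m" for n
    proof -
      have "(\<Sum>j\<le>n. cnj (fibre.shift x j n) * fibre.shift x j m)
          = (\<Sum>j\<le>max n m. cnj (fibre.shift x j n) * fibre.shift x j m)"
        by (intro sum.mono_neutral_left) (auto simp: fibre.shift_def)
      also have "\<dots> = (\<Sum>j\<le>m. cnj (fibre.shift x j n) * fibre.shift x j m)"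
        by (intro sum.mono_neutral_right) (auto simp: fibre.shift_def)
      finally have "fibre.gram x n m = (if n = m then 1 else 0) - (\<Sum>j\<le>m. cnj (fibre.shift x j n) * fibre.shift x j m)"
        by (simp add: fibre.gram_eq)
      then show ?thesis by (simp add: right_diff_distrib sum_distrib_left mult_ac)
    qed
    ultimately have "(\<lambda>n. a x n * fibre.gram x n m) sums a x m" by simp
    moreover have "aux_coeffs (u N) x m = (\<Sum>n<N. a x n * fibre.gram x n m)" for N
      unfolding aux_coeffs_def u_def
      by (simp add: fibre.ip_sum_left fibre.ip_scale_left fibre.gram_def bdd_borel_intros)
    ultimately show ?thesis by (simp add: sums_def)
  qed
  then have "V_op \<mu> (WC_rel \<mu> `` {u}) = h"
    unfolding h by (rule V_op_eq[OF u])
  moreover have "WC_rel \<mu> `` {u} \<in> WC \<mu>"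
    unfolding WC_def by (rule quotientI[OF u])
  ultimately show ?thesis by blast
qed

end

theorem theorem5p3:
  fixes \<mu> :: "'x::t2_space \<Rightarrow> real measure"
    and b :: "'x \<Rightarrow> complex \<Rightarrow> complex"
  assumes "compact (UNIV :: 'x set)"
    and "\<And>x. prob_space (\<mu> x)"
    and "\<And>x. sets (\<mu> x) = sets borel01"
    and "weakly_continuous \<mu>"
    and "\<And>x. singular_measure (\<mu> x) \<or> \<mu> x = lebesgue01"
    and "\<And>x. herglotz (\<mu> x) (b x)"
  shows "V_op \<mu> ` WC \<mu> = perp_mult b"
proof -
  have fibre: "herglotz_measure (\<mu> x) (b x)" for x
    using assms by (simp add: herglotz_measure_def herglotz_measure_axioms_def
        unit_interval_measure_def unit_interval_measure_axioms_def)
  interpret herglotz_family \<mu> b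
    by (rule herglotz_family.intro) (use assms fibre in auto)
  show ?thesis
    using V_op_in_perp_mult perp_mult_in_image by blast
qed

end
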